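(* Let $1<\alpha<2$, $0\le r\le 1$, let $\beta\in[\alpha-1,1]$ be determined by $r=\frac{\sin(\pi\beta)}{\sin(\pi(\alpha-\beta))+\sin(\pi\beta)}$, let $0<K_m\le K(x)\le K_M<\infty$ on $(0,1)$, and let $f\in L^2_{\omega^{(\beta,\alpha-\beta)}}(0,1)$. Put $f_1(x)=\frac1{K(x)}\int_0^xf(y)\,dy$, $f_2(x)=\frac1{K(x)}$, and let $u$ be the solution of $$L_r^\alpha u(x)=f_1(x)-A f_2(x),\quad x\in(0,1),\qquad u(0)=u(1)=0.$$ For $j\in\mathbb N$, if $D^jf_k\in L^2_{\omega^{(\beta+j-1,\,\alpha-\beta+j-1)}}(0,1)$ for $k=1,2$, then $$D^j\Big(\frac{u(x)}{\omega^{(\alpha-\beta,\beta)}(x)}\Big)\in L^2_{\omega^{(\alpha-\beta+j,\,\beta+j)}}(0,1).$$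
   Context: Weights and spaces: $\omega^{(a,b)}(x)=(1-x)^a x^b$ on $(0,1)$; $\|g\|_\omega=(\int_0^1\omega g^2dx)^{1/2}$, $L^2_\omega(0,1)=\{g:\|g\|_\omega<\infty\}$. $D^j$ denotes the $j$-th (weak) derivative. Fractional integrals for $0<\sigma<1$: ${}_0I_x^\sigma w(x)=\frac1{\Gamma(\sigma)}\int_0^x w(s)(x-s)^{\sigma-1}ds$ and ${}_xI_1^\sigma w(x)=\frac1{\Gamma(\sigma)}\int_x^1 w(s)(s-x)^{\sigma-1}ds$. Operator: $L_r^\alpha u=-\big(r\,{}_0I_x^{2-\alpha}+(1-r)\,{}_xI_1^{2-\alpha}\big)Du$. In the problem, $A$ is the constant (depending on $u$) $A=K(0)\big[\big(r\,{}_0I_x^{2-\alpha}+(1-r)\,{}_xI_1^{2-\alpha}\big)Du(x)\big]\big|_{x=0}$, which is formally what the equation gives when multiplied by $K$ and evaluated at $x=0$; thus one seeks $u$ together with the constant $A$. "The solution" is the unique solution $u\in L^2_{\omega^{(-(\alpha-\beta),-\beta)}}(0,1)$; for it, $A=\dfrac{\int_0^1\omega^{(\beta-1,\alpha-\beta-1)}f_1\,dx}{\int_0^1\omega^{(\beta-1,\alpha-\beta-1)}f_2\,dx}$. Jacobi polynomials on $(0,1)$: $G_n^{(a,b)}(x)=P_n^{(a,b)}(2x-1)$, with $P_n^{(a,b)}$ the standard Jacobi polynomials on $[-1,1]$ (orthogonal for $(1-x)^a(1+x)^b$). Sense of solution: every $u\in L^2_{\omega^{(-(\alpha-\beta),-\beta)}}(0,1)$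 has a unique expansion $u=\omega^{(\alpha-\beta,\beta)}\sum_{j\ge0}c_jG_j^{(\alpha-\beta,\beta)}$ converging in that space. With $u_N=\omega^{(\alpha-\beta,\beta)}\sum_{j=0}^N c_jG_j^{(\alpha-\beta,\beta)}$, $L_r^\alpha u$ is the limit of $L_r^\alpha u_N$ in $L^2_{\omega^{(\beta-1,\alpha-\beta-1)}}(0,1)$ when this limit exists; the homogeneous boundary conditions are understood as those carried by the truncations $u_N$ (each vanishing at $0$ and $1$). *)

theory Defs
  imports "HOL-Analysis.Analysis"
begin

text \<open>All function spaces live on the open unit interval; functions are total on the reals, but
  only their values (almost everywhere) on \<open>{0<..<1}\<close> are used.\<close>

definition weight :: "real \<Rightarrow> real \<Rightarrow> real \<Rightarrow> real" where
  "weight a b x = (1 - x) powr a * x powr b"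

definition L2w :: "real \<Rightarrow> real \<Rightarrow> (real \<Rightarrow> real) set" where
  "L2w a b = {g. g \<in> borel_measurable (lebesgue_on {0<..<1}) \<and>
                 integrable (lebesgue_on {0<..<1}) (\<lambda>x. weight a b x * (g x)\<^sup>2)}"

definition norm_L2w :: "real \<Rightarrow> real \<Rightarrow> (real \<Rightarrow> real) \<Rightarrow> real" where
  "norm_L2w a b g = sqrt (integral\<^sup>L (lebesgue_on {0<..<1}) (\<lambda>x. weight a b x * (g x)\<^sup>2))"

text \<open>The membership conditions matter: without them the norm of a difference could be the
  conventional value 0 of a non-existing integral.\<close>

definition converges_L2w :: "real \<Rightarrow> real \<Rightarrow> (nat \<Rightarrow> real \<Rightarrow> real) \<Rightarrow> (real \<Rightarrow> real) \<Rightarrow> bool" where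
  "converges_L2w a b X g \<longleftrightarrow>
     (\<forall>N. X N \<in> L2w a b) \<and> g \<in> L2w a b \<and>
     (\<lambda>N. norm_L2w a b (\<lambda>x. X N x - g x)) \<longlonglongrightarrow> 0"

definition test_function :: "(real \<Rightarrow> real) \<Rightarrow> bool" where
  "test_function \<phi> \<longleftrightarrow>
     (\<forall>k x. (deriv ^^ k) \<phi> field_differentiable at x) \<and>
     (\<exists>c d. 0 < c \<and> d < 1 \<and> (\<forall>x. x \<notin> {c..d} \<longrightarrow> \<phi> x = 0))"

definition locally_integrable :: "(real \<Rightarrow> real) \<Rightarrow> bool" where
  "locally_integrable g \<longleftrightarrow> (\<forall>c d. 0 < c \<and> d < 1 \<longrightarrow> g absolutely_integrable_on {c..d})"

definition has_weak_deriv :: "nat \<Rightarrow> (real \<Rightarrow> real) \<Rightarrow> (real \<Rightarrow> real) \<Rightarrow> bool" where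
  "has_weak_deriv j g h \<longleftrightarrow>
     locally_integrable g \<and> locally_integrable h \<and>
     (\<forall>\<phi>. test_function \<phi> \<longrightarrow>
        integral\<^sup>L (lebesgue_on {0<..<1}) (\<lambda>x. g x * (deriv ^^ j) \<phi> x) =
        (- 1) ^ j * integral\<^sup>L (lebesgue_on {0<..<1}) (\<lambda>x. h x * \<phi> x))"

text \<open>``The \<open>j\<close>-th weak derivative of \<open>g\<close> exists and belongs to the weighted space''.\<close>

definition weak_deriv_in_L2w :: "nat \<Rightarrow> (real \<Rightarrow> real) \<Rightarrow> real \<Rightarrow> real \<Rightarrow> bool" where
  "weak_deriv_in_L2w j g a b \<longleftrightarrow> (\<exists>h. has_weak_deriv j g h \<and> h \<in> L2w a b)"

definition frac_int_left :: "real \<Rightarrow> (real \<Rightarrow> real) \<Rightarrow> real \<Rightarrow> real" where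
  "frac_int_left \<sigma> w x =
     1 / Gamma \<sigma> * integral\<^sup>L (lebesgue_on {0<..<x}) (\<lambda>s. w s * (x - s) powr (\<sigma> - 1))"

definition frac_int_right :: "real \<Rightarrow> (real \<Rightarrow> real) \<Rightarrow> real \<Rightarrow> real" where
  "frac_int_right \<sigma> w x =
     1 / Gamma \<sigma> * integral\<^sup>L (lebesgue_on {x<..<1}) (\<lambda>s. w s * (s - x) powr (\<sigma> - 1))"

text \<open>This pointwise operator is only applied to the truncations below. These are smooth on
  \<open>{0<..<1}\<close>, so their weak derivative is the classical one.\<close>

definition L_op :: "real \<Rightarrow> real \<Rightarrow> (real \<Rightarrow> real) \<Rightarrow> real \<Rightarrow> real" where
  "L_op \<alpha> r u x =
     - (r * frac_int_left (2 - \<alpha>) (deriv u) x + (1 - r) * frac_int_right (2 - \<alpha>) (deriv u) x)"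

text \<open>Standard Jacobi polynomials on \<open>{-1..1}\<close>, with value \<open>(n + a) gchoose n\<close> at \<open>1\<close>.\<close>

definition jacobi_P :: "nat \<Rightarrow> real \<Rightarrow> real \<Rightarrow> real \<Rightarrow> real" where
  "jacobi_P n a b t =
     (\<Sum>s\<le>n. ((real n + a) gchoose (n - s)) * ((real n + b) gchoose s) *
             ((t - 1) / 2) ^ s * ((t + 1) / 2) ^ (n - s))"

definition jacobi_G :: "nat \<Rightarrow> real \<Rightarrow> real \<Rightarrow> real \<Rightarrow> real" where
  "jacobi_G n a b x = jacobi_P n a b (2 * x - 1)"

definition truncation :: "real \<Rightarrow> real \<Rightarrow> (nat \<Rightarrow> real) \<Rightarrow> nat \<Rightarrow> real \<Rightarrow> real" where
  "truncation \<alpha> \<beta> c N x =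
     weight (\<alpha> - \<beta>) \<beta> x * (\<Sum>j\<le>N. c j * jacobi_G j (\<alpha> - \<beta>) \<beta> x)"

text \<open>\<open>L u = g\<close> with \<open>u(0) = u(1) = 0\<close>: the operator is applied to \<open>u\<close> as the limit of its values on
  the truncations of the Jacobi expansion of \<open>u\<close>, and the boundary values are those of the
  truncations.\<close>

definition solves_bvp ::
  "real \<Rightarrow> real \<Rightarrow> real \<Rightarrow> (real \<Rightarrow> real) \<Rightarrow> (real \<Rightarrow> real) \<Rightarrow> bool" where
  "solves_bvp \<alpha> \<beta> r g u \<longleftrightarrow>
     (\<exists>c. converges_L2w (- (\<alpha> - \<beta>)) (- \<beta>) (truncation \<alpha> \<beta> c) u \<and>
          (\<forall>N. truncation \<alpha> \<beta> c N 0 = 0 \<and> truncation \<alpha> \<beta> c N 1 = 0) \<and>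
          converges_L2w (\<beta> - 1) (\<alpha> - \<beta> - 1) (\<lambda>N. L_op \<alpha> r (truncation \<alpha> \<beta> c N)) g)"

text \<open>The problem determines \<open>u\<close> together with the constant \<open>A\<close>. The images of the truncations are
  orthogonal to the constants in the space with weight \<open>(\<beta> - 1, \<alpha> - \<beta> - 1)\<close>, hence for a
  solution pair \<open>A\<close> is the quotient of the weighted integrals of \<open>f1\<close> and \<open>f2\<close>.\<close>

definition solution_pair ::
  "real \<Rightarrow> real \<Rightarrow> real \<Rightarrow> (real \<Rightarrow> real) \<Rightarrow> (real \<Rightarrow> real) \<Rightarrow> (real \<Rightarrow> real) \<Rightarrow> real \<Rightarrow> bool" where
  "solution_pair \<alpha> \<beta> r f1 f2 u A \<longleftrightarrow> solves_bvp \<alpha> \<beta> r (\<lambda>x. f1 x - A * f2 x) u"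

end

theory Submission
  imports Defs
begin

text \<open>
Write \<open>a = \<alpha> - \<beta>\<close>, \<open>b = \<beta>\<close>, \<open>\<sigma> = 2 - \<alpha>\<close>, \<open>A = a - 1\<close>, \<open>B = b - 1\<close>, let \<open>v\<close> be the quotient of \<open>u\<close> by
the weight \<open>(a, b)\<close>, and let \<open>g\<close> be the right-hand side of the equation, a combination of
\<open>f1\<close> and \<open>f2\<close>. Both smoothness hypotheses and the smoothness claim are statements about the decay of
coefficients in orthogonal polynomials, and the operator is diagonal in these coefficients.

\<^emph>\<open>Diagonal form.\<close> Differentiation turns the weight \<open>(a, b)\<close> times a polynomial into the weight \<open>(A, B)\<close>
times a polynomial, so the operator acts, up to a factor, as a Riesz-type potential on the weight
\<open>(A, B)\<close> times a polynomial, where \<open>A + B = - \<sigma>\<close>. The relation between \<open>r\<close> and \<open>\<beta>\<close> makes the potential of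
the bare weight \<open>(A, B)\<close> constant (\<open>nn_integral_riesz_weight_constant\<close>): its two one-sided parts
are multiples of the two parts of one incomplete Beta integral, and the reflection formula of the
Gamma function matches the multiples. Since \<open>t k(t)\<close> is a primitive of \<open>\<sigma> k(t)\<close> for the kernel \<open>k\<close>,
the potential of the weight times \<open>s p(s)\<close> comes from that of the weight times \<open>p(s)\<close> by
multiplication and integration; so polynomials of degree \<open>n\<close> go to polynomials of degree \<open>n\<close>, and the
leading coefficient is multiplied by an explicit number of order \<open>n powr (- \<sigma>)\<close> (\<open>riesz_pot_poly\<close>).
The adjoint potential has the same form with \<open>r\<close>, \<open>A\<close>, \<open>B\<close> replaced by \<open>1 - r\<close>, \<open>B\<close>, \<open>A\<close>. A
degree-raising map whose adjoint lowers the degree sends orthogonal polynomials to orthogonal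
polynomials, and the square of the multiplier between the orthonormal ones is the product of the two
leading multipliers, here bounded below (\<open>riesz_spectral_bound\<close>). The Jacobi
truncations enter as the weight times polynomials that converge to \<open>v\<close>.

\<^emph>\<open>Smoothness in coefficients.\<close> Derivatives of orthogonal polynomials for the weight \<open>(a, b)\<close> are
orthogonal for \<open>(a + 1, b + 1)\<close>, so the \<open>j\<close>-th derivative multiplies the square norm of the \<open>n\<close>-th
polynomial by the product of \<open>(n - i) (n + i + a + b + 1)\<close> over \<open>i < j\<close>. Testing the weak derivative
of \<open>g\<close> against weighted polynomials, after a smooth cutoff at the end points, gives its coefficients,
and Bessel's inequality bounds their weighted square sum (\<open>weak_deriv_coefficients_bounded\<close>).
Conversely, if the weighted square sum of the coefficients of \<open>v\<close> is finite, then the \<open>j\<close>-th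
derivatives of the partial sums form a Cauchy sequence, whose limit is the weak derivative
(\<open>weak_deriv_of_expansion\<close>). The index shift from \<open>n\<close> to \<open>n + 1\<close> under the operator is harmless,
because \<open>(n - i) (n + i + \<alpha> + 1) \<le> (n + 1 - i) (n + i + \<alpha>)\<close>.
\<close>

section \<open>The potential of the weight\<close>

lemma nn_integral_Beta_scaled:
  fixes p q x :: real
  assumes "0 < p" "0 < q" "0 < x"
  shows "(\<integral>\<^sup>+s\<in>{0<..<x}. ennreal (s powr (p - 1) * (x - s) powr (q - 1)) \<partial>lborel) =
         ennreal (x powr (p + q - 1) * Beta p q)"
proof -
  have "(\<integral>\<^sup>+s\<in>{0<..<x}. ennreal (s powr (p - 1) * (x - s) powr (q - 1)) \<partial>lborel) =
        ennreal x * (\<integral>\<^sup>+y. ennreal ((0 + x * y) powr (p - 1) * (x - (0 + x * y)) powr (q - 1)) *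
                     indicator {0<..<x} (0 + x * y) \<partial>lborel)"
    using assms by (subst nn_integral_real_affine[where c = x and t = 0]) auto
  also have "\<dots> = ennreal x * (\<integral>\<^sup>+y. ennreal (x powr (p + q - 2)) *
      (ennreal (y powr (p - 1) * (1 - y) powr (q - 1)) * indicator {0<..<1} y) \<partial>lborel)"
  proof -
    have "ennreal ((0 + x * y) powr (p - 1) * (x - (0 + x * y)) powr (q - 1)) *
            indicator {0<..<x} (0 + x * y) =
          ennreal (x powr (p + q - 2)) *
            (ennreal (y powr (p - 1) * (1 - y) powr (q - 1)) * indicator {0<..<1} y)" for y
    proof (cases "0 < y \<and> y < 1")
      case True
      have "x - x * y = x * (1 - y)" by (simp add: algebra_simps)
      then have "(x * y) powr (p - 1) * (x - x * y) powr (q - 1) =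
                 x powr (p + q - 2) * (y powr (p - 1) * (1 - y) powr (q - 1))"
        using True assms powr_add[of x "p - 1" "q - 1"]
        by (simp add: powr_mult)
      then show ?thesis using True assms
        by (simp add: indicator_def ennreal_mult')
    next
      case False
      then show ?thesis using assms
        by (auto simp: indicator_def zero_less_mult_iff)
    qed
    then show ?thesis by (simp only:)
  qed
  also have "\<dots> = ennreal x * (ennreal (x powr (p + q - 2)) *
      (\<integral>\<^sup>+y\<in>{0<..<1}. ennreal (y powr (p - 1) * (1 - y) powr (q - 1)) \<partial>lborel))"
    by (subst nn_integral_cmult) auto
  also have "(\<integral>\<^sup>+y\<in>{0<..<1}. ennreal (y powr (p - 1) * (1 - y) powr (q - 1)) \<partial>lborel) = ennreal (Beta p q)"
    using has_integral_Beta_real[OF assms(1,2)]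
    by (intro nn_integral_has_integral_lebesgue') (auto simp: has_integral_Icc_iff_Ioo)
  also have "ennreal x * (ennreal (x powr (p + q - 2)) * ennreal (Beta p q)) =
             ennreal (x powr (p + q - 1) * Beta p q)"
  proof -
    have "x powr 1 * x powr (p + q - 2) = x powr (p + q - 1)"
      by (subst powr_add[symmetric]) (simp add: algebra_simps)
    then show ?thesis using assms
      by (simp add: ennreal_mult'[symmetric] mult.assoc[symmetric])
  qed
  finally show ?thesis .
qed

lemma powr_minus_sums_pochhammer:
  fixes c s :: real
  assumes "\<bar>s\<bar> < 1"
  shows "(\<lambda>k. pochhammer c k / fact k * s ^ k) sums ((1 - s) powr (- c))"
proof -
  have "(- c gchoose k) * (- s) ^ k = pochhammer c k / fact k * s ^ k" for k
  proof -
    have "(- s) ^ k = (- 1) ^ k * s ^ k" by (rule power_minus)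
    moreover have "(- 1) ^ k * (- 1) ^ k = (1::real)" by (simp flip: power_mult_distrib)
    ultimately show ?thesis by (simp add: gbinomial_pochhammer)
  qed
  then show ?thesis using gen_binomial_real[of "- s" "- c"] assms by simp
qed

text \<open>Expanding the last factor in the binomial series gives terms of one sign because \<open>0 \<le> c\<close>, so
sum and integral may be exchanged. Both sides of
\<open>nn_integral_abel_eq_incomplete_Beta\<close> are instances.\<close>

lemma nn_integral_Beta_binomial_series:
  fixes p q c x :: real
  assumes "0 < p" "0 < q" "0 \<le> c" "0 < x" "x < 1"
  shows "(\<integral>\<^sup>+s\<in>{0<..<x}. ennreal (s powr (p - 1) * (x - s) powr (q - 1) * (1 - s) powr (- c)) \<partial>lborel) =
         (\<Sum>k. ennreal (pochhammer c k / fact k * (x powr (p + q + real k - 1) * Beta (p + real k) q)))"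
proof -
  have poch: "0 \<le> pochhammer c k" for k using assms by (cases "c = 0") (auto simp: pochhammer_0_left pochhammer_pos less_imp_le)
  have "(\<integral>\<^sup>+s\<in>{0<..<x}. ennreal (s powr (p - 1) * (x - s) powr (q - 1) * (1 - s) powr (- c)) \<partial>lborel) =
        (\<integral>\<^sup>+s. (\<Sum>k. ennreal (pochhammer c k / fact k) *
           (ennreal (s powr (p + real k - 1) * (x - s) powr (q - 1)) * indicator {0<..<x} s)) \<partial>lborel)"
  proof (intro nn_integral_cong)
    fix s :: real
    show "ennreal (s powr (p - 1) * (x - s) powr (q - 1) * (1 - s) powr (- c)) * indicator {0<..<x} s =
          (\<Sum>k. ennreal (pochhammer c k / fact k) *
           (ennreal (s powr (p + real k - 1) * (x - s) powr (q - 1)) * indicator {0<..<x} s))"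
    proof (cases "s \<in> {0<..<x}")
      case True
      then have "(\<lambda>k. pochhammer c k / fact k * s ^ k) sums ((1 - s) powr (- c))"
        using assms by (intro powr_minus_sums_pochhammer) auto
      then have "(\<lambda>k. s powr (p - 1) * (x - s) powr (q - 1) * (pochhammer c k / fact k * s ^ k)) sums
                 (s powr (p - 1) * (x - s) powr (q - 1) * (1 - s) powr (- c))"
        by (rule sums_mult)
      moreover have "s powr (p - 1) * (x - s) powr (q - 1) * (pochhammer c k / fact k * s ^ k) =
        pochhammer c k / fact k * (s powr (p + real k - 1) * (x - s) powr (q - 1))" for k
      proof -
        have "s powr (p + real k - 1) = s powr (p - 1) * s ^ k"
          using True powr_add[of s "p - 1" "real k"] by (simp add: powr_realpow algebra_simps)
        then show ?thesis by simp
      qed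
      ultimately have "(\<lambda>k. pochhammer c k / fact k * (s powr (p + real k - 1) * (x - s) powr (q - 1))) sums
                 (s powr (p - 1) * (x - s) powr (q - 1) * (1 - s) powr (- c))" by (simp only:)
      then have "(\<Sum>k. ennreal (pochhammer c k / fact k * (s powr (p + real k - 1) * (x - s) powr (q - 1)))) =
                 ennreal (s powr (p - 1) * (x - s) powr (q - 1) * (1 - s) powr (- c))"
        using poch by (intro suminf_ennreal_eq) auto
      then show ?thesis using True poch by (simp add: ennreal_mult'[symmetric])
    qed simp
  qed
  also have "\<dots> = (\<Sum>k. \<integral>\<^sup>+s. ennreal (pochhammer c k / fact k) *
           (ennreal (s powr (p + real k - 1) * (x - s) powr (q - 1)) * indicator {0<..<x} s) \<partial>lborel)"
    by (rule nn_integral_suminf) auto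
  also have "\<dots> = (\<Sum>k. ennreal (pochhammer c k / fact k) *
           (\<integral>\<^sup>+s\<in>{0<..<x}. ennreal (s powr (p + real k - 1) * (x - s) powr (q - 1)) \<partial>lborel))"
    by (subst nn_integral_cmult) auto
  also have "\<dots> = (\<Sum>k. ennreal (pochhammer c k / fact k * (x powr (p + q + real k - 1) * Beta (p + real k) q)))"
    using assms poch by (subst nn_integral_Beta_scaled) (auto simp: ennreal_mult'[symmetric] add.assoc add.commute[of q])
  finally show ?thesis .
qed

abbreviation abel_mass :: "real \<Rightarrow> real \<Rightarrow> real \<Rightarrow> real \<Rightarrow> ennreal" where
  "abel_mass \<sigma> A B x \<equiv>
     (\<integral>\<^sup>+s\<in>{0<..<x}. ennreal (s powr B * (x - s) powr (\<sigma> - 1) * (1 - s) powr A) \<partial>lborel)"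

text \<open>The two series from \<open>nn_integral_Beta_binomial_series\<close>, with \<open>c = - A\<close> on the left and \<open>c = B + 1\<close>
on the right, agree term by term up to the constant: \<open>A + B = - \<sigma>\<close> makes the exponents of \<open>x\<close>
equal, and the Gamma quotients telescope.\<close>

lemma nn_integral_abel_eq_incomplete_Beta:
  fixes A B \<sigma> x :: real
  assumes "A < 0" "-1 < B" "0 < \<sigma>" "A + B = - \<sigma>" "0 < x" "x < 1"
  shows "abel_mass \<sigma> A B x =
         ennreal (Gamma (B + 1) * Gamma \<sigma> / Gamma (- A)) *
         (\<integral>\<^sup>+t\<in>{0<..<x}. ennreal (t powr (- A - 1) * (1 - t) powr (- B - 1)) \<partial>lborel)"
proof -
  define c where "c = Gamma (B + 1) * Gamma \<sigma> / Gamma (- A)"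
  have G: "Gamma (B + 1) > 0" "Gamma \<sigma> > 0" "Gamma (- A) > 0" using assms by (auto intro: Gamma_real_pos)
  then have c: "c > 0" by (simp add: c_def)
  have ni: "z \<notin> \<int>\<^sub>\<le>\<^sub>0" if "z > 0" for z :: real using that by (auto elim!: nonpos_Ints_cases)
  have "abel_mass \<sigma> A B x =
     (\<Sum>k. ennreal (pochhammer (- A) k / fact k * (x powr (B + 1 + \<sigma> + real k - 1) * Beta (B + 1 + real k) \<sigma>)))"
    using nn_integral_Beta_binomial_series[of "B + 1" \<sigma> "- A" x] assms by simp
  also have "\<dots> = (\<Sum>k. ennreal c * ennreal (pochhammer (B + 1) k / fact k * (x powr (- A + 1 + real k - 1) * Beta (- A + real k) 1)))"
  proof (intro arg_cong[where f = suminf] ext)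
    fix k :: nat
    have Gk: "Gamma (real k - A) > 0" using assms by (intro Gamma_real_pos) auto
    then have b1: "Beta (- A + real k) 1 = 1 / (real k - A)"
      using assms Gamma_plus1[of "- A + real k"] ni[of "- A + real k"] Gk[THEN less_imp_neq]
      by (simp add: Beta_def divide_simps)
    have e1: "pochhammer (- A) k = Gamma (real k - A) / Gamma (- A)"
      using assms by (subst pochhammer_Gamma) (auto intro!: ni)
    have e2: "pochhammer (B + 1) k = Gamma (B + 1 + real k) / Gamma (B + 1)"
      using assms by (subst pochhammer_Gamma) (auto intro!: ni)
    have e3: "Gamma (B + 1 + real k + \<sigma>) = (real k - A) * Gamma (real k - A)"
    proof -
      have "B + 1 + real k + \<sigma> = real k - A + 1" using assms by simp
      moreover have "Gamma (real k - A + 1) = (real k - A) * Gamma (real k - A)"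
        using assms by (intro Gamma_plus1 ni) auto
      ultimately show ?thesis by (simp only:)
    qed
    have e5: "pochhammer (- A) k * Beta (B + 1 + real k) \<sigma> = c * (pochhammer (B + 1) k * Beta (- A + real k) 1)"
      using G[THEN less_imp_neq] Gk[THEN less_imp_neq] assms
      unfolding b1 e1 e2 unfolding Beta_def e3 c_def by (simp add: divide_simps)
    have "pochhammer (- A) k / fact k * (x powr (B + 1 + \<sigma> + real k - 1) * Beta (B + 1 + real k) \<sigma>) =
      c * (pochhammer (B + 1) k / fact k * (x powr (- A + 1 + real k - 1) * Beta (- A + real k) 1))"
    proof -
      have "B + 1 + \<sigma> + real k - 1 = - A + 1 + real k - 1" using assms by simp
      then have e4: "x powr (B + 1 + \<sigma> + real k - 1) = x powr (- A + 1 + real k - 1)" by (simp only:)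
      have "pochhammer (- A) k * Beta (B + 1 + real k) \<sigma> * (x powr (- A + 1 + real k - 1) / fact k) =
            c * (pochhammer (B + 1) k * Beta (- A + real k) 1) * (x powr (- A + 1 + real k - 1) / fact k)"
        by (simp only: e5)
      then show ?thesis unfolding e4 by (simp only: times_divide_eq_left times_divide_eq_right mult_ac)
    qed
    then show "ennreal (pochhammer (- A) k / fact k * (x powr (B + 1 + \<sigma> + real k - 1) * Beta (B + 1 + real k) \<sigma>)) =
      ennreal c * ennreal (pochhammer (B + 1) k / fact k * (x powr (- A + 1 + real k - 1) * Beta (- A + real k) 1))"
      using c by (simp add: ennreal_mult'[symmetric])
  qed
  also have "\<dots> = ennreal c * (\<Sum>k. ennreal (pochhammer (B + 1) k / fact k * (x powr (- A + 1 + real k - 1) * Beta (- A + real k) 1)))"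
    by simp
  also have "(\<Sum>k. ennreal (pochhammer (B + 1) k / fact k * (x powr (- A + 1 + real k - 1) * Beta (- A + real k) 1))) =
     (\<integral>\<^sup>+t\<in>{0<..<x}. ennreal (t powr (- A - 1) * (x - t) powr (1 - 1) * (1 - t) powr (- (B + 1))) \<partial>lborel)"
    using assms by (subst nn_integral_Beta_binomial_series) auto
  also have "\<dots> = (\<integral>\<^sup>+t\<in>{0<..<x}. ennreal (t powr (- A - 1) * (1 - t) powr (- B - 1)) \<partial>lborel)"
    by (intro nn_integral_cong) (auto simp: indicator_def)
  finally show ?thesis by (simp add: c_def)
qed

lemma nn_integral_reflect_unit:
  fixes f :: "real \<Rightarrow> ennreal"
  assumes [measurable]: "f \<in> borel_measurable borel"
  shows "(\<integral>\<^sup>+s. f (1 - s) \<partial>lborel) = (\<integral>\<^sup>+s. f s \<partial>lborel)"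
  using nn_integral_real_affine[of f "-1" 1] by simp

lemma minus_mult_less_pi: "- 1 < z \<Longrightarrow> - (pi * z) < pi"
  using mult_strict_left_mono[of "- z" 1 pi] by simp

text \<open>Euler's reflection formula; it converts the constants of the one-sided potentials into the sines in
the definition of \<open>r\<close>.\<close>

lemma Gamma_reflection_real_minus:
  fixes x :: real
  assumes that: "-1 < x" "x < 0"
  shows "Gamma (1 + x) * Gamma (- x) * sin (pi * x) = - pi"
proof -
  have "complex_of_real (Gamma x * Gamma (- x)) = complex_of_real (- pi / (x * sin (pi * x)))"
    using Gamma_reflection_complex'[of "of_real x"]
    by (simp add: Gamma_complex_of_real[symmetric] sin_of_real[symmetric])
  then have *: "Gamma x * Gamma (- x) = - pi / (x * sin (pi * x))"
    unfolding of_real_eq_iff .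
  have "sin (pi * x) \<noteq> 0"
  proof -
    have "sin (pi * (- x)) > 0" using that by (intro sin_gt_zero) (auto simp: mult_less_0_iff intro!: minus_mult_less_pi)
    then show ?thesis by simp
  qed
  moreover have "Gamma (1 + x) = x * Gamma x"
  proof -
    have "x \<notin> \<int>\<^sub>\<le>\<^sub>0" using that by (auto elim!: nonpos_Ints_cases)
    then show ?thesis using Gamma_plus1[of x] by (simp add: add.commute)
  qed
  ultimately show ?thesis using that * by (simp add: field_simps)
qed

text \<open>Convolution with this kernel, divided by \<open>Gamma \<sigma>\<close>, is the mean of the left and right fractional
integrals of order \<open>\<sigma>\<close> with the proportions \<open>r\<close> and \<open>1 - r\<close>.\<close>

definition riesz_kernel :: "real \<Rightarrow> real \<Rightarrow> real \<Rightarrow> real" where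
  "riesz_kernel \<sigma> r t = (if 0 < t then r else 1 - r) * \<bar>t\<bar> powr (\<sigma> - 1)"

lemma riesz_kernel_measurable [measurable]: "riesz_kernel \<sigma> r \<in> borel_measurable borel"
  unfolding riesz_kernel_def by measurable

lemma weight_measurable [measurable]: "weight A B \<in> borel_measurable borel"
  unfolding weight_def by measurable

lemma riesz_kernel_nonneg: "0 \<le> r \<Longrightarrow> r \<le> 1 \<Longrightarrow> 0 \<le> riesz_kernel \<sigma> r t"
  unfolding riesz_kernel_def by simp

lemma weight_nonneg [simp]: "0 \<le> weight a b x"
  by (simp add: weight_def)

abbreviation riesz_mass :: "real \<Rightarrow> real \<Rightarrow> real \<Rightarrow> real \<Rightarrow> real \<Rightarrow> ennreal" where
  "riesz_mass \<sigma> r A B x \<equiv> (\<integral>\<^sup>+s\<in>{0<..<1}. ennreal (riesz_kernel \<sigma> r (x - s) * weight A B s) \<partial>lborel)"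

text \<open>Reflecting the part to the right of \<open>x\<close> turns it into a left-sided integral up to \<open>1 - x\<close> with \<open>A\<close>
and \<open>B\<close> exchanged, so that one computation serves both parts.\<close>

lemma nn_integral_riesz_split:
  fixes A B \<sigma> r x :: real
  assumes "0 \<le> r" "r \<le> 1" "0 < x" "x < 1"
  shows "riesz_mass \<sigma> r A B x =
     ennreal r * abel_mass \<sigma> A B x +
     ennreal (1 - r) * abel_mass \<sigma> B A (1 - x)"
proof -
  have ae: "AE s in lborel. s \<noteq> x" by (rule AE_lborel_singleton)
  have "riesz_mass \<sigma> r A B x =
    (\<integral>\<^sup>+s. ennreal r * (ennreal (s powr B * (x - s) powr (\<sigma> - 1) * (1 - s) powr A) * indicator {0<..<x} s) +
       ennreal (1 - r) * (ennreal (s powr B * (s - x) powr (\<sigma> - 1) * (1 - s) powr A) * indicator {x<..<1} s) \<partial>lborel)"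
    using ae
  proof (intro nn_integral_cong_AE, eventually_elim)
    fix s assume "s \<noteq> x"
    then show "ennreal (riesz_kernel \<sigma> r (x - s) * weight A B s) * indicator {0<..<1} s =
      ennreal r * (ennreal (s powr B * (x - s) powr (\<sigma> - 1) * (1 - s) powr A) * indicator {0<..<x} s) +
       ennreal (1 - r) * (ennreal (s powr B * (s - x) powr (\<sigma> - 1) * (1 - s) powr A) * indicator {x<..<1} s)"
      using assms by (cases "s < x")
        (auto simp: riesz_kernel_def weight_def indicator_def ennreal_mult'[symmetric] mult_ac)
  qed
  also have "\<dots> = ennreal r * abel_mass \<sigma> A B x +
     ennreal (1 - r) * (\<integral>\<^sup>+s\<in>{x<..<1}. ennreal (s powr B * (s - x) powr (\<sigma> - 1) * (1 - s) powr A) \<partial>lborel)"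
    by (subst nn_integral_add, simp, simp, subst nn_integral_cmult, simp, subst nn_integral_cmult, auto)
  also have "(\<integral>\<^sup>+s\<in>{x<..<1}. ennreal (s powr B * (s - x) powr (\<sigma> - 1) * (1 - s) powr A) \<partial>lborel) =
     (\<integral>\<^sup>+s. ennreal ((1 - s) powr B * ((1 - s) - x) powr (\<sigma> - 1) * (1 - (1 - s)) powr A) * indicator {x<..<1} (1 - s) \<partial>lborel)"
    by (subst nn_integral_reflect_unit[symmetric]) auto
  also have "\<dots> = abel_mass \<sigma> B A (1 - x)"
    by (intro nn_integral_cong) (auto simp: indicator_def algebra_simps)
  finally show ?thesis .
qed

text \<open>The left part is a multiple of the incomplete Beta integral over \<open>(0, x)\<close>, the right part a multiple
of the same integral over \<open>(x, 1)\<close>. The condition on \<open>r\<close> makes the two multiples equal, and the sum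
is the complete integral, which does not depend on \<open>x\<close>.\<close>

lemma nn_integral_riesz_weight_generic:
  fixes A B \<sigma> r :: real
  assumes AB: "- 1 < A" "A < 0" "- 1 < B" "B < 0" "0 < \<sigma>" "A + B = - \<sigma>"
    and r: "0 \<le> r" "r \<le> 1" "r * sin (pi * A) = (1 - r) * sin (pi * B)"
  shows "\<exists>C>0. \<forall>x\<in>{0<..<1}.
    riesz_mass \<sigma> r A B x = ennreal C"
proof -
  define cA where "cA = Gamma (B + 1) * Gamma \<sigma> / Gamma (- A)"
  define cB where "cB = Gamma (A + 1) * Gamma \<sigma> / Gamma (- B)"
  have G: "Gamma (B + 1) > 0" "Gamma (A + 1) > 0" "Gamma \<sigma> > 0" "Gamma (- A) > 0" "Gamma (- B) > 0"
    using AB by (auto intro: Gamma_real_pos)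
  \<comment> \<open>This is where the choice of \<open>r\<close> enters.\<close>
  have eqc: "r * cA = (1 - r) * cB"
  proof -
    define gA where "gA = Gamma (1 + A) * Gamma (- A)"
    define gB where "gB = Gamma (1 + B) * Gamma (- B)"
    have g: "gA * sin (pi * A) = - pi" "gB * sin (pi * B) = - pi"
      unfolding gA_def gB_def using AB by (auto intro!: Gamma_reflection_real_minus)
    have "gA * gB * (r * sin (pi * A)) = gA * gB * ((1 - r) * sin (pi * B))" using r by simp
    then have "r * (gA * sin (pi * A)) * gB = (1 - r) * (gB * sin (pi * B)) * gA"
      by (simp add: algebra_simps)
    then have "r * gB = (1 - r) * gA" using g by simp
    then have "r * gB * (Gamma \<sigma> / (Gamma (- A) * Gamma (- B))) = (1 - r) * gA * (Gamma \<sigma> / (Gamma (- A) * Gamma (- B)))"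
      by simp
    then show ?thesis using G by (simp add: cA_def cB_def gA_def gB_def add.commute mult_ac)
  qed
  have pos: "r * cA > 0"
  proof -
    have "cA > 0" "cB > 0" using G by (auto simp: cA_def cB_def)
    moreover have "r > 0" using eqc r \<open>cB > 0\<close> by (cases "r = 0") auto
    ultimately show ?thesis by simp
  qed
  let ?J = "\<lambda>S. \<integral>\<^sup>+t\<in>S. ennreal (t powr (- A - 1) * (1 - t) powr (- B - 1)) \<partial>lborel"
  have "riesz_mass \<sigma> r A B x = ennreal (r * cA * Beta (- A) (- B))"
    if x: "0 < x" "x < 1" for x
  proof -
    have "riesz_mass \<sigma> r A B x =
      ennreal r * (ennreal cA * ?J {0<..<x}) +
      ennreal (1 - r) * (ennreal cB * (\<integral>\<^sup>+t\<in>{0<..<1 - x}. ennreal (t powr (- B - 1) * (1 - t) powr (- A - 1)) \<partial>lborel))"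
      unfolding cA_def cB_def using AB x
      by (subst nn_integral_riesz_split[OF r(1,2) x], subst nn_integral_abel_eq_incomplete_Beta,
          (simp_all)[6], subst nn_integral_abel_eq_incomplete_Beta) auto
    also have "(\<integral>\<^sup>+t\<in>{0<..<1 - x}. ennreal (t powr (- B - 1) * (1 - t) powr (- A - 1)) \<partial>lborel) =
      (\<integral>\<^sup>+t. ennreal ((1 - t) powr (- B - 1) * (1 - (1 - t)) powr (- A - 1)) * indicator {0<..<1 - x} (1 - t) \<partial>lborel)"
      by (subst nn_integral_reflect_unit[symmetric]) auto
    also have "\<dots> = ?J {x<..<1}"
      by (intro nn_integral_cong) (auto simp: indicator_def mult_ac)
    also have "ennreal r * (ennreal cA * ?J {0<..<x}) + ennreal (1 - r) * (ennreal cB * ?J {x<..<1}) =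
      ennreal (r * cA) * (?J {0<..<x} + ?J {x<..<1})"
    proof -
      have "cA \<ge> 0" "cB \<ge> 0" using G by (auto simp: cA_def cB_def)
      then have "ennreal r * ennreal cA = ennreal (r * cA)" "ennreal (1 - r) * ennreal cB = ennreal (r * cA)"
        using r eqc by (auto simp: ennreal_mult'[symmetric])
      then show ?thesis by (simp only: mult.assoc[symmetric] distrib_left)
    qed
    also have "?J {0<..<x} + ?J {x<..<1} = ?J {0<..<1}"
    proof -
      have "?J {0<..<1} = (\<integral>\<^sup>+t. ennreal (t powr (- A - 1) * (1 - t) powr (- B - 1)) * indicator {0<..<x} t +
         ennreal (t powr (- A - 1) * (1 - t) powr (- B - 1)) * indicator {x<..<1} t \<partial>lborel)"
        using AE_lborel_singleton[of x]
      proof (intro nn_integral_cong_AE, eventually_elim)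
        fix t assume "t \<noteq> x"
        then show "ennreal (t powr (- A - 1) * (1 - t) powr (- B - 1)) * indicator {0<..<1} t =
          ennreal (t powr (- A - 1) * (1 - t) powr (- B - 1)) * indicator {0<..<x} t +
          ennreal (t powr (- A - 1) * (1 - t) powr (- B - 1)) * indicator {x<..<1} t"
          using x by (auto simp: indicator_def)
      qed
      also have "\<dots> = ?J {0<..<x} + ?J {x<..<1}" by (rule nn_integral_add) auto
      finally show ?thesis by simp
    qed
    also have "?J {0<..<1} = ennreal (Beta (- A) (- B))"
      using has_integral_Beta_real[of "- A" "- B"] AB
      by (intro nn_integral_has_integral_lebesgue') (auto simp: has_integral_Icc_iff_Ioo)
    finally show ?thesis using pos by (simp add: ennreal_mult'[symmetric])
  qed
  moreover have "Beta (- A) (- B) > 0" using AB by (auto simp: Beta_def intro!: divide_pos_pos mult_pos_pos Gamma_real_pos)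
  ultimately show ?thesis using pos by (intro exI[of _ "r * cA * Beta (- A) (- B)"]) auto
qed

text \<open>The limiting case of a purely left-sided kernel, where the incomplete Beta integral of the generic
case diverges; here a scaled Beta integral is already constant.\<close>

lemma nn_integral_riesz_weight_left:
  fixes \<sigma> :: real
  assumes "0 < \<sigma>" "\<sigma> < 1"
  shows "\<exists>C>0. \<forall>x\<in>{0<..<1}.
    riesz_mass \<sigma> 1 0 (- \<sigma>) x = ennreal C"
proof (intro exI[of _ "Beta (1 - \<sigma>) \<sigma>"] conjI ballI)
  show "Beta (1 - \<sigma>) \<sigma> > 0" using assms by (auto simp: Beta_def intro!: divide_pos_pos mult_pos_pos Gamma_real_pos)
  fix x :: real assume x: "x \<in> {0<..<1}"
  have "riesz_mass \<sigma> 1 0 (- \<sigma>) x =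
        (\<integral>\<^sup>+s\<in>{0<..<x}. ennreal (s powr (1 - \<sigma> - 1) * (x - s) powr (\<sigma> - 1)) \<partial>lborel)"
    using x by (subst nn_integral_riesz_split) (auto intro!: nn_integral_cong simp: indicator_def)
  also have "\<dots> = ennreal (x powr (1 - \<sigma> + \<sigma> - 1) * Beta (1 - \<sigma>) \<sigma>)"
    using assms x by (subst nn_integral_Beta_scaled) auto
  finally show "riesz_mass \<sigma> 1 0 (- \<sigma>) x = ennreal (Beta (1 - \<sigma>) \<sigma>)"
    using x by simp
qed

lemma nn_integral_riesz_weight_reflect:
  assumes r: "0 \<le> r" "r \<le> 1"
    and "\<exists>C>0. \<forall>x\<in>{0<..<1}. riesz_mass \<sigma> r A B x = ennreal C"
  shows "\<exists>C>0. \<forall>x\<in>{0<..<1}. riesz_mass \<sigma> (1 - r) B A x = ennreal C"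
proof -
  from assms(3) obtain C where C: "C > 0"
    "\<And>x. x \<in> {0<..<1} \<Longrightarrow> riesz_mass \<sigma> r A B x = ennreal C" by auto
  show ?thesis
  proof (intro exI[of _ C] conjI ballI C(1))
    fix x :: real assume x: "x \<in> {0<..<1}"
    then have x': "1 - x \<in> {0<..<1}" "0 < x" "x < 1" "0 < 1 - x" "1 - x < 1" by auto
    show "riesz_mass \<sigma> (1 - r) B A x = ennreal C"
      using C(2)[OF x'(1)] r x'
      by (simp add: nn_integral_riesz_split add.commute)
  qed
qed

text \<open>The sines are negative for \<open>A\<close> and \<open>B\<close> strictly between \<open>- 1\<close> and \<open>0\<close>; one of them vanishes
exactly when \<open>r\<close> is \<open>0\<close> or \<open>1\<close>, which leads to the one-sided cases.\<close>

lemma nn_integral_riesz_weight_constant: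
  fixes A B \<sigma> r :: real
  assumes AB: "A \<le> 0" "B \<le> 0" "0 < \<sigma>" "\<sigma> < 1" "A + B = - \<sigma>"
    and r: "0 \<le> r" "r \<le> 1" "r = sin (pi * B) / (sin (pi * A) + sin (pi * B))"
  shows "\<exists>C>0. \<forall>x\<in>{0<..<1}.
    riesz_mass \<sigma> r A B x = ennreal C"
proof -
  have neg: "sin (pi * z) < 0" if "- 1 < z" "z < 0" for z
  proof -
    have "sin (pi * (- z)) > 0" using that by (intro sin_gt_zero) (auto simp: mult_less_0_iff intro!: minus_mult_less_pi)
    then show ?thesis by simp
  qed
  consider "A = 0" | "B = 0" | "A < 0" "B < 0" using AB by force
  then show ?thesis
  proof cases
    case 1
    then have "r = 1" "B = - \<sigma>" using r AB neg[of B] by auto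
    then show ?thesis using nn_integral_riesz_weight_left[OF AB(3,4)] 1 by simp
  next
    case 2
    then have "r = 0" "A = - \<sigma>" using r AB neg[of A] by auto
    then show ?thesis using nn_integral_riesz_weight_reflect[OF _ _ nn_integral_riesz_weight_left[OF AB(3,4)]] 2 by simp
  next
    case 3
    then have *: "- 1 < A" "- 1 < B" using AB by auto
    then have "sin (pi * A) + sin (pi * B) < 0" using neg[of A] neg[of B] 3 by simp
    then have "r * sin (pi * A) = (1 - r) * sin (pi * B)" using r(3) by (simp add: field_simps)
    then show ?thesis using nn_integral_riesz_weight_generic[of A B \<sigma> r] 3 * AB r by auto
  qed
qed

section \<open>Weighted inner products on the unit interval\<close>

abbreviation leb01 :: "real measure" where "leb01 \<equiv> lebesgue_on {0<..<1}"

definition inner_w :: "real \<Rightarrow> real \<Rightarrow> (real \<Rightarrow> real) \<Rightarrow> (real \<Rightarrow> real) \<Rightarrow> real" where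
  "inner_w a b f g = (LINT x|leb01. weight a b x * (f x * g x))"

abbreviation dist2_w :: "real \<Rightarrow> real \<Rightarrow> (real \<Rightarrow> real) \<Rightarrow> (real \<Rightarrow> real) \<Rightarrow> real" where
  "dist2_w a b f g \<equiv> inner_w a b (\<lambda>x. f x - g x) (\<lambda>x. f x - g x)"

lemma borel_measurable_lebesgue_onI:
  "f \<in> borel_measurable borel \<Longrightarrow> f \<in> borel_measurable (lebesgue_on S)"
  by (intro measurable_restrict_space1 measurable_completion) simp

lemma weight_measurable_leb01 [measurable]: "weight a b \<in> borel_measurable leb01"
  by (rule borel_measurable_lebesgue_onI) measurable

lemma poly_measurable_borel [measurable]: "poly (p :: real poly) \<in> borel_measurable borel"
  by (intro borel_measurable_continuous_onI continuous_intros)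

lemma poly_measurable_leb01 [measurable]: "poly (p :: real poly) \<in> borel_measurable leb01"
  by (rule borel_measurable_lebesgue_onI) measurable

lemma integrable_weight:
  assumes "- 1 < a" "- 1 < b"
  shows "integrable leb01 (weight a b)"
proof -
  have "(\<lambda>t. t powr (b + 1 - 1) * (1 - t) powr (a + 1 - 1)) integrable_on {0<..<1}"
    using has_integral_Beta_real[of "b + 1" "a + 1"] assms
    by (auto simp: has_integral_Icc_iff_Ioo integrable_on_def)
  then have "weight a b integrable_on {0<..<1}"
    by (rule integrable_eq) (auto simp: weight_def)
  then have "weight a b absolutely_integrable_on {0<..<1}"
    by (rule nonnegative_absolutely_integrable_1) simp
  then show ?thesis by (rule absolutely_integrable_imp_integrable) simp
qed

lemma poly_bounded_unit:
  fixes p :: "real poly"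
  obtains M where "0 < M" "\<And>x. x \<in> {0<..<1} \<Longrightarrow> \<bar>poly p x\<bar> \<le> M"
proof -
  have "bounded (poly p ` {0..1})"
    by (intro compact_imp_bounded compact_continuous_image continuous_intros) auto
  then obtain M where "0 < M" "\<And>x. x \<in> {0..1} \<Longrightarrow> \<bar>poly p x\<bar> \<le> M"
    unfolding bounded_pos by auto
  then show ?thesis by (intro that[of M]) auto
qed

lemma integrable_weight_bounded:
  assumes "- 1 < a" "- 1 < b" and [measurable]: "f \<in> borel_measurable leb01"
    and "\<And>x. x \<in> {0<..<1} \<Longrightarrow> \<bar>f x\<bar> \<le> M"
  shows "integrable leb01 (\<lambda>x. weight a b x * f x)"
proof (rule Bochner_Integration.integrable_bound)
  show "integrable leb01 (\<lambda>x. M * weight a b x)"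
    using integrable_weight[OF assms(1,2)] by simp
  show "AE x in leb01. norm (weight a b x * f x) \<le> norm (M * weight a b x)"
  proof (rule AE_I2)
    fix x assume "x \<in> space leb01"
    then have "\<bar>f x\<bar> \<le> \<bar>M\<bar>" using assms(4)[of x] by simp
    then show "norm (weight a b x * f x) \<le> norm (M * weight a b x)"
      by (simp add: abs_mult mult.commute[of M] mult_left_mono)
  qed
qed measurable

lemma integrable_weight_poly:
  assumes "- 1 < a" "- 1 < b"
  shows "integrable leb01 (\<lambda>x. weight a b x * poly p x)"
proof -
  obtain M where "\<And>x. x \<in> {0<..<1} \<Longrightarrow> \<bar>poly p x\<bar> \<le> M" using poly_bounded_unit[of p] by blast
  then show ?thesis using assms by (intro integrable_weight_bounded[where M = M]) auto
qed

lemma L2w_measurable: "f \<in> L2w a b \<Longrightarrow> f \<in> borel_measurable leb01"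
  by (simp add: L2w_def)

lemma L2w_poly:
  assumes "- 1 < a" "- 1 < b"
  shows "poly p \<in> L2w a b"
  using integrable_weight_poly[OF assms, of "p * p"] by (simp add: L2w_def power2_eq_square)

text \<open>The product is dominated by the sum of the squares.\<close>

lemma integrable_inner_w:
  assumes "f \<in> L2w a b" "g \<in> L2w a b"
  shows "integrable leb01 (\<lambda>x. weight a b x * (f x * g x))"
proof (rule Bochner_Integration.integrable_bound)
  show "integrable leb01 (\<lambda>x. weight a b x * (f x)\<^sup>2 + weight a b x * (g x)\<^sup>2)"
    using assms by (auto simp: L2w_def)
  have [measurable]: "f \<in> borel_measurable leb01" "g \<in> borel_measurable leb01"
    using assms by (auto simp: L2w_def)
  show "(\<lambda>x. weight a b x * (f x * g x)) \<in> borel_measurable leb01" by measurable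
  show "AE x in leb01. norm (weight a b x * (f x * g x)) \<le> norm (weight a b x * (f x)\<^sup>2 + weight a b x * (g x)\<^sup>2)"
  proof (rule AE_I2)
    fix x
    have "\<bar>f x * g x\<bar> \<le> (f x)\<^sup>2 + (g x)\<^sup>2"
      using sum_squares_bound[of "\<bar>f x\<bar>" "\<bar>g x\<bar>"] mult_nonneg_nonneg[of "\<bar>f x\<bar>" "\<bar>g x\<bar>"]
      unfolding abs_mult power2_abs mult.assoc by (smt (verit) abs_ge_zero)
    then have "weight a b x * \<bar>f x * g x\<bar> \<le> weight a b x * ((f x)\<^sup>2 + (g x)\<^sup>2)"
      by (intro mult_left_mono) auto
    then show "norm (weight a b x * (f x * g x)) \<le> norm (weight a b x * (f x)\<^sup>2 + weight a b x * (g x)\<^sup>2)"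
      by (simp add: abs_mult distrib_left)
  qed
qed

lemma L2w_add: assumes "f \<in> L2w a b" "g \<in> L2w a b" shows "(\<lambda>x. f x + g x) \<in> L2w a b"
proof -
  have [measurable]: "f \<in> borel_measurable leb01" "g \<in> borel_measurable leb01"
    using assms by (auto simp: L2w_def)
  have "integrable leb01 (\<lambda>x. weight a b x * (f x * f x) + 2 * (weight a b x * (f x * g x)) + weight a b x * (g x * g x))"
    using assms by (intro Bochner_Integration.integrable_add integrable_inner_w integrable_mult_right) auto
  then show ?thesis by (simp add: L2w_def power2_eq_square algebra_simps)
qed

lemma L2w_cmult: assumes "f \<in> L2w a b" shows "(\<lambda>x. c * f x) \<in> L2w a b"
proof -
  have [measurable]: "f \<in> borel_measurable leb01"
    using assms by (auto simp: L2w_def)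
  have "integrable leb01 (\<lambda>x. c * c * (weight a b x * (f x * f x)))"
    using assms by (intro integrable_inner_w integrable_mult_right) auto
  then show ?thesis by (simp add: L2w_def power2_eq_square mult_ac)
qed

lemma L2w_diff: assumes "f \<in> L2w a b" "g \<in> L2w a b" shows "(\<lambda>x. f x - g x) \<in> L2w a b"
  using L2w_add[OF assms(1) L2w_cmult[OF assms(2), of "- 1"]] by simp

lemma inner_w_commute: "inner_w a b f g = inner_w a b g f"
  by (simp add: inner_w_def mult.commute)

lemma inner_w_add_left: "f \<in> L2w a b \<Longrightarrow> g \<in> L2w a b \<Longrightarrow> h \<in> L2w a b \<Longrightarrow>
    inner_w a b (\<lambda>x. f x + g x) h = inner_w a b f h + inner_w a b g h"
  unfolding inner_w_def
  by (subst Bochner_Integration.integral_add[symmetric], (rule integrable_inner_w; assumption)+)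
     (simp add: algebra_simps)

lemma inner_w_diff_left: "f \<in> L2w a b \<Longrightarrow> g \<in> L2w a b \<Longrightarrow> h \<in> L2w a b \<Longrightarrow>
    inner_w a b (\<lambda>x. f x - g x) h = inner_w a b f h - inner_w a b g h"
  unfolding inner_w_def
  by (subst Bochner_Integration.integral_diff[symmetric], (rule integrable_inner_w; assumption)+)
     (simp add: algebra_simps)

lemma inner_w_cmult_left: "inner_w a b (\<lambda>x. c * f x) h = c * inner_w a b f h"
  unfolding inner_w_def by (subst integral_mult_right_zero[symmetric]) (simp add: mult_ac)

lemma inner_w_nonneg: "0 \<le> inner_w a b f f"
  unfolding inner_w_def by (intro integral_nonneg_AE AE_I2) simp

lemma norm_L2w_eq: "norm_L2w a b f = sqrt (inner_w a b f f)"
  by (simp add: norm_L2w_def inner_w_def power2_eq_square)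

lemma norm_L2w_nonneg: "0 \<le> norm_L2w a b f"
  by (simp add: norm_L2w_eq inner_w_nonneg)

lemma inner_w_add_add:
  assumes "f \<in> L2w a b" "g \<in> L2w a b"
  shows "inner_w a b (\<lambda>x. f x + g x) (\<lambda>x. f x + g x) = inner_w a b f f + 2 * inner_w a b f g + inner_w a b g g"
proof -
  have 1: "inner_w a b (\<lambda>x. f x + g x) h = inner_w a b f h + inner_w a b g h" if "h \<in> L2w a b" for h
    using assms that by (rule inner_w_add_left)
  show ?thesis
    using 1[OF L2w_add[OF assms]] 1[OF assms(1)] 1[OF assms(2)]
    by (simp add: inner_w_commute[of a b f "\<lambda>x. f x + g x"] inner_w_commute[of a b g "\<lambda>x. f x + g x"] inner_w_commute[of a b g f])
qed

text \<open>The quadratic polynomial \<open>t \<mapsto> \<langle>f + t g, f + t g\<rangle>\<close> is nonnegative. If \<open>g\<close> has norm zero it is affine,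
so its slope must vanish.\<close>

lemma inner_w_Cauchy_Schwarz:
  assumes "f \<in> L2w a b" "g \<in> L2w a b"
  shows "\<bar>inner_w a b f g\<bar> \<le> norm_L2w a b f * norm_L2w a b g"
proof -
  let ?F = "inner_w a b f f" and ?G = "inner_w a b g g" and ?H = "inner_w a b f g"
  have q: "0 \<le> ?F + 2 * t * ?H + t\<^sup>2 * ?G" for t
  proof -
    have "inner_w a b (\<lambda>x. f x + t * g x) (\<lambda>x. f x + t * g x) =
          ?F + 2 * inner_w a b f (\<lambda>x. t * g x) + inner_w a b (\<lambda>x. t * g x) (\<lambda>x. t * g x)"
      using assms by (intro inner_w_add_add L2w_cmult)
    also have "inner_w a b f (\<lambda>x. t * g x) = t * ?H"
      by (subst inner_w_commute) (simp add: inner_w_cmult_left inner_w_commute)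
    also have "inner_w a b (\<lambda>x. t * g x) (\<lambda>x. t * g x) = t\<^sup>2 * ?G"
      by (subst inner_w_cmult_left, subst inner_w_commute) (simp add: inner_w_cmult_left power2_eq_square)
    finally show ?thesis using inner_w_nonneg[of a b "\<lambda>x. f x + t * g x"] by (simp add: mult_ac)
  qed
  have "?H\<^sup>2 \<le> ?F * ?G"
  proof (cases "?G = 0")
    case True
    have "?H = 0"
    proof (rule ccontr)
      assume "?H \<noteq> 0"
      then show False using q[of "- (?F + 1) / (2 * ?H)"] True inner_w_nonneg[of a b f] by (simp add: field_simps)
    qed
    then show ?thesis using True by simp
  next
    case False
    then have "?G > 0" using inner_w_nonneg[of a b g] by simp
    moreover have "0 \<le> ?F + 2 * (- ?H / ?G) * ?H + (- ?H / ?G)\<^sup>2 * ?G" by (rule q)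
    ultimately show ?thesis by (simp add: field_simps power2_eq_square)
  qed
  then have "sqrt (?H\<^sup>2) \<le> sqrt (?F * ?G)" by (rule real_sqrt_le_mono)
  then show ?thesis by (simp only: norm_L2w_eq real_sqrt_mult real_sqrt_abs)
qed

lemma inner_w_tendsto:
  assumes "converges_L2w a b X f" "g \<in> L2w a b"
  shows "(\<lambda>N. inner_w a b (X N) g) \<longlonglongrightarrow> inner_w a b f g"
proof -
  have X: "X N \<in> L2w a b" and f: "f \<in> L2w a b" and l: "(\<lambda>N. norm_L2w a b (\<lambda>x. X N x - f x)) \<longlonglongrightarrow> 0" for N
    using assms by (auto simp: converges_L2w_def)
  have "(\<lambda>N. inner_w a b (X N) g - inner_w a b f g) \<longlonglongrightarrow> 0"
  proof (rule Lim_null_comparison)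
    show "\<forall>\<^sub>F N in sequentially. norm (inner_w a b (X N) g - inner_w a b f g) \<le> norm_L2w a b (\<lambda>x. X N x - f x) * norm_L2w a b g"
      using inner_w_Cauchy_Schwarz[OF L2w_diff[OF X f] assms(2)]
      by (intro always_eventually) (simp add: inner_w_diff_left[OF X f assms(2)])
    show "(\<lambda>N. norm_L2w a b (\<lambda>x. X N x - f x) * norm_L2w a b g) \<longlonglongrightarrow> 0"
      using tendsto_mult_right[OF l, of "norm_L2w a b g"] by simp
  qed
  then show ?thesis by (simp add: LIM_zero_iff)
qed

section \<open>Orthogonal polynomials through the raising operator\<close>

text \<open>The raising operator of Jacobi polynomials: conjugate of \<open>d/dx\<close> by the weights, from \<open>(a + 1, b + 1)\<close>
to \<open>(a, b)\<close>. Orthogonality, the differential equation and the derivative formula all come from it.\<close>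

definition raise :: "real \<Rightarrow> real \<Rightarrow> real poly \<Rightarrow> real poly" where
  "raise a b q = [:0, 1, -1:] * pderiv q + [:b + 1, - (a + b + 2):] * q"

lemma weight_add_one:
  "x \<in> {0<..<1} \<Longrightarrow> weight (a + 1) (b + 1) x = weight a b x * (x * (1 - x))"
  by (simp add: weight_def powr_add mult_ac)

lemma weight_poly_has_deriv:
  assumes "x \<in> {0<..<1}"
  shows "((\<lambda>x. weight (a + 1) (b + 1) x * poly q x) has_real_derivative weight a b x * poly (raise a b q) x) (at x)"
proof -
  have p: "(1 - x) powr (a + 1) = (1 - x) * (1 - x) powr a" "x powr (b + 1) = x * x powr b"
    using assms by (auto simp: powr_add)
  have "((\<lambda>x. weight (a + 1) (b + 1) x * poly q x) has_real_derivative
      (- (a + 1) * (1 - x) powr a * x powr (b + 1) + (1 - x) powr (a + 1) * ((b + 1) * x powr b)) * poly q x +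
      weight (a + 1) (b + 1) x * poly (pderiv q) x) (at x)"
  proof -
    have "((\<lambda>x. (1 - x) powr (a + 1)) has_real_derivative - (a + 1) * (1 - x) powr a) (at x)"
      using DERIV_fun_powr[of "\<lambda>x. 1 - x" "- 1" x "a + 1"] assms
      by (auto intro!: derivative_eq_intros simp: algebra_simps)
    moreover have "((\<lambda>x. x powr (b + 1)) has_real_derivative (b + 1) * x powr b) (at x)"
      using has_real_derivative_powr[of x "b + 1"] assms by simp
    ultimately have "((\<lambda>x. (1 - x) powr (a + 1) * x powr (b + 1) * poly q x) has_real_derivative
      (- (a + 1) * (1 - x) powr a * x powr (b + 1) + (b + 1) * x powr b * (1 - x) powr (a + 1)) * poly q x +
      poly (pderiv q) x * ((1 - x) powr (a + 1) * x powr (b + 1))) (at x)"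
      by (intro DERIV_mult poly_DERIV)
    then show ?thesis unfolding weight_def by (simp add: mult_ac)
  qed
  also have "(- (a + 1) * (1 - x) powr a * x powr (b + 1) + (1 - x) powr (a + 1) * ((b + 1) * x powr b)) * poly q x +
      weight (a + 1) (b + 1) x * poly (pderiv q) x = weight a b x * poly (raise a b q) x"
    unfolding weight_def p raise_def by (simp add: algebra_simps)
  finally show ?thesis .
qed

lemma integral_weight_raise:
  assumes "- 1 < a" "- 1 < b"
  shows "(LINT x|leb01. weight a b x * poly (raise a b q) x) = 0"
proof -
  let ?F = "\<lambda>x. weight (a + 1) (b + 1) x * poly q x"
  have "continuous_on {0..1} ?F"
    unfolding weight_def using assms by (intro continuous_intros continuous_on_powr') auto
  then have "((\<lambda>x. weight a b x * poly (raise a b q) x) has_integral (?F 1 - ?F 0)) {0..1}"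
    using weight_poly_has_deriv
    by (intro fundamental_theorem_of_calculus_interior)
       (auto simp flip: has_real_derivative_iff_has_vector_derivative)
  then have "((\<lambda>x. weight a b x * poly (raise a b q) x) has_integral 0) {0<..<1}"
    using assms by (simp add: weight_def has_integral_Icc_iff_Ioo)
  moreover have "((\<lambda>x. weight a b x * poly (raise a b q) x) has_integral
      ((LINT x|leb01. weight a b x * poly (raise a b q) x))) {0<..<1}"
    using assms by (intro has_integral_integral_lebesgue_on integrable_weight_poly) auto
  ultimately show ?thesis by (rule has_integral_unique[symmetric])
qed

lemma inner_w_poly: "inner_w a b (poly p) (poly q) = (LINT x|leb01. weight a b x * poly (p * q) x)"
  by (simp add: inner_w_def)

text \<open>Up to sign, \<open>raise\<close> is adjoint to differentiation: integrate by parts, where the weight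
\<open>(a + 1, b + 1)\<close> kills the boundary terms.\<close>

lemma inner_w_raise:
  assumes "- 1 < a" "- 1 < b"
  shows "inner_w a b (poly (raise a b q)) (poly p) = - inner_w (a + 1) (b + 1) (poly q) (poly (pderiv p))"
proof -
  have "raise a b (q * p) = raise a b q * p + [:0, 1, -1:] * (q * pderiv p)"
    by (simp add: raise_def pderiv_mult algebra_simps)
  then have "0 = (LINT x|leb01. weight a b x * poly (raise a b q * p) x + weight a b x * poly ([:0, 1, -1:] * (q * pderiv p)) x)"
    using integral_weight_raise[OF assms, of "q * p"] by (simp add: distrib_left)
  also have "\<dots> = inner_w a b (poly (raise a b q)) (poly p) + (LINT x|leb01. weight a b x * poly ([:0, 1, -1:] * (q * pderiv p)) x)"
    unfolding inner_w_poly using assms by (intro Bochner_Integration.integral_add integrable_weight_poly)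
  also have "(LINT x|leb01. weight a b x * poly ([:0, 1, -1:] * (q * pderiv p)) x) = inner_w (a + 1) (b + 1) (poly q) (poly (pderiv p))"
    unfolding inner_w_def
    by (intro Bochner_Integration.integral_cong refl) (simp add: weight_add_one ring_distribs mult_ac)
  finally show ?thesis by simp
qed

lemma raise_degree_coeff:
  assumes "degree q \<le> n"
  shows "degree (raise a b q) \<le> Suc n" "coeff (raise a b q) (Suc n) = - (real n + a + b + 2) * coeff q n"
proof -
  have c: "coeff q k = 0" if "k > n" for k using that assms by (intro coeff_eq_0) simp
  show "coeff (raise a b q) (Suc n) = - (real n + a + b + 2) * coeff q n"
    using c[of "Suc n"] c[of "Suc (Suc n)"]
    by (cases n) (simp_all add: raise_def coeff_pderiv algebra_simps)
  show "degree (raise a b q) \<le> Suc n"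
  proof (rule degree_le, intro allI impI)
    fix i assume i: "Suc n < i"
    then obtain m where "i = Suc (Suc m)" "n \<le> m" 
      by (intro that[of "i - 2"]) auto
    then show "coeff (raise a b q) i = 0"
      using c[of "Suc m"] c[of "Suc (Suc m)"] c[of "Suc (Suc (Suc m))"]
      by (simp add: raise_def coeff_pderiv)
  qed
qed

lemma raise_smult: "raise a b (smult c p) = smult c (raise a b p)"
  by (simp only: raise_def pderiv_smult mult_smult_right smult_add_right)

lemma inner_w_poly_add: "- 1 < a \<Longrightarrow> - 1 < b \<Longrightarrow> f \<in> L2w a b \<Longrightarrow>
    inner_w a b f (poly (p + q)) = inner_w a b f (poly p) + inner_w a b f (poly q)"
  using inner_w_add_left[of "poly p" a b "poly q" f]
  by (simp add: L2w_poly inner_w_commute[of a b f] flip: poly_add)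

lemma inner_w_poly_smult: "inner_w a b f (poly (smult c p)) = c * inner_w a b f (poly p)"
  using inner_w_cmult_left[of a b c "poly p" f] by (simp add: inner_w_commute[of a b f] flip: poly_smult)

lemma inner_w_poly_self_eq_0:
  assumes "- 1 < a" "- 1 < b" "inner_w a b (poly p) (poly p) = 0"
  shows "p = 0"
proof (rule ccontr)
  assume p: "p \<noteq> 0"
  have "integrable leb01 (\<lambda>x. weight a b x * (poly p x * poly p x))"
    using assms by (intro integrable_inner_w L2w_poly)
  moreover have "AE x in leb01. 0 \<le> weight a b x * (poly p x * poly p x)" by (intro AE_I2) simp
  ultimately have "AE x in leb01. weight a b x * (poly p x * poly p x) = 0"
    using assms(3) integral_nonneg_eq_0_iff_AE unfolding inner_w_def by blast
  then have "AE x in lebesgue. x \<in> {0<..<1} \<longrightarrow> weight a b x * (poly p x * poly p x) = 0"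
    by (simp add: AE_restrict_space_iff)
  then have 1: "AE x in lebesgue. x \<in> {0<..<1} \<longrightarrow> poly p x = 0"
    by eventually_elim (auto simp: weight_def)
  have "finite {x. poly p x = 0}" using p by (rule poly_roots_finite)
  then have "{x. poly p x = 0} \<in> null_sets lebesgue" by (simp add: finite_imp_null_set_lborel null_sets_completionI)
  then have "AE x in lebesgue. x \<notin> {x. poly p x = 0}" by (rule AE_not_in)
  with 1 have "AE x in lebesgue. x \<notin> {0<..<1::real}" by eventually_elim auto
  then have "{0<..<1::real} \<in> null_sets lebesgue"
    by (simp add: AE_iff_null_sets)
  then show False by (simp add: null_sets_def)
qed

text \<open>Orthogonality to all polynomials of degree below \<open>n\<close>. This determines the \<open>n\<close>-th orthogonal
polynomial up to a factor (\<open>orth_degree_unique\<close>).\<close>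

definition orth_degree :: "real \<Rightarrow> real \<Rightarrow> nat \<Rightarrow> real poly \<Rightarrow> bool" where
  "orth_degree a b n p \<longleftrightarrow> degree p \<le> n \<and> (\<forall>q. degree q < n \<longrightarrow> inner_w a b (poly p) (poly q) = 0)"

text \<open>Without its top coefficient such a polynomial vanishes or has degree below \<open>n\<close>, and in the latter
case it is orthogonal to itself.\<close>

lemma orth_degree_eq_0:
  assumes "- 1 < a" "- 1 < b" "orth_degree a b n p" "coeff p n = 0"
  shows "p = 0"
proof (cases "degree p = n")
  case True
  then show ?thesis using assms by (metis leading_coeff_0_iff)
next
  case False
  then show ?thesis using assms by (auto simp: orth_degree_def intro!: inner_w_poly_self_eq_0[of a b])
qed

lemma orth_degree_lincomb:
  assumes "- 1 < a" "- 1 < b" "orth_degree a b n p" "orth_degree a b n q"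
  shows "orth_degree a b n (smult c p + smult d q)"
proof -
  have "degree (smult c p + smult d q) \<le> n"
    using assms by (auto simp: orth_degree_def intro!: degree_add_le order.trans[OF degree_smult_le])
  moreover have "inner_w a b (poly (smult c p + smult d q)) (poly s) = 0" if "degree s < n" for s
  proof -
    have "inner_w a b (poly s) (poly p) = 0" "inner_w a b (poly s) (poly q) = 0"
      using assms that by (auto simp: orth_degree_def inner_w_commute[of a b "poly s"])
    then show ?thesis
      using assms by (simp add: inner_w_commute[of a b _ "poly s"] inner_w_poly_add L2w_poly inner_w_poly_smult)
  qed
  ultimately show ?thesis by (simp add: orth_degree_def)
qed

lemma orth_degree_unique:
  assumes "- 1 < a" "- 1 < b" "orth_degree a b n p" "orth_degree a b n q" "coeff q n \<noteq> 0"
  shows "p = smult (coeff p n / coeff q n) q"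
proof -
  have "smult 1 p + smult (- (coeff p n / coeff q n)) q = 0"
    using assms by (intro orth_degree_eq_0[OF assms(1,2)] orth_degree_lincomb) auto
  then show ?thesis by (simp add: algebra_simps)
qed

text \<open>A recursion over all weights at once (the Rodrigues formula unfolded): by adjointness, raising an
orthogonal polynomial for \<open>(a + 1, b + 1)\<close> gives one for \<open>(a, b)\<close> of the next degree.\<close>

primrec orth_poly :: "nat \<Rightarrow> real \<Rightarrow> real \<Rightarrow> real poly" where
  "orth_poly 0 a b = 1"
| "orth_poly (Suc n) a b = raise a b (orth_poly n (a + 1) (b + 1))"

lemma degree_pderiv_less: "degree (q :: real poly) < Suc n \<Longrightarrow> pderiv q = 0 \<or> degree (pderiv q) < n"
  by (cases "degree q") (auto simp: degree_pderiv pderiv_eq_0_iff)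

lemma orth_degree_orth_poly: "- 1 < a \<Longrightarrow> - 1 < b \<Longrightarrow> orth_degree a b n (orth_poly n a b) \<and> coeff (orth_poly n a b) n \<noteq> 0"
proof (induction n arbitrary: a b)
  case 0
  then show ?case by (simp add: orth_degree_def)
next
  case (Suc n)
  then have IH: "orth_degree (a + 1) (b + 1) n (orth_poly n (a + 1) (b + 1))" "coeff (orth_poly n (a + 1) (b + 1)) n \<noteq> 0" by auto
  then have d: "degree (orth_poly n (a + 1) (b + 1)) \<le> n" by (simp add: orth_degree_def)
  have "inner_w a b (poly (orth_poly (Suc n) a b)) (poly q) = 0" if "degree q < Suc n" for q
    using degree_pderiv_less[OF that] IH Suc.prems by (auto simp: inner_w_raise orth_degree_def) (simp add: inner_w_def)
  then show ?case using raise_degree_coeff[OF d, of a b] IH(2) Suc.prems by (simp add: orth_degree_def)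
qed

text \<open>Adjointness again: \<open>raise\<close> increases the degree of the test polynomial by one.\<close>

lemma orth_degree_pderiv:
  assumes "- 1 < a" "- 1 < b" "orth_degree a b n p"
  shows "orth_degree (a + 1) (b + 1) (n - 1) (pderiv p)"
proof -
  have "degree (pderiv p) \<le> n - 1" using assms by (auto simp: orth_degree_def degree_pderiv diff_le_mono)
  moreover have "inner_w (a + 1) (b + 1) (poly (pderiv p)) (poly q) = 0" if "degree q < n - 1" for q
  proof -
    have "inner_w a b (poly p) (poly (raise a b q)) = 0"
      using assms(3) raise_degree_coeff(1)[of q "degree q" a b] that by (auto simp: orth_degree_def)
    then show ?thesis using inner_w_raise[OF assms(1,2), of q p] by (simp add: inner_w_commute)
  qed
  ultimately show ?thesis by (simp add: orth_degree_def)
qed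

text \<open>The Jacobi differential equation. The operator on the left is symmetric and does not increase the
degree, so it preserves orthogonality to lower degrees; hence its result is a multiple of \<open>p\<close>, and
the leading coefficient gives the factor.\<close>

lemma orth_degree_eigen:
  assumes "- 1 < a" "- 1 < b" "orth_degree a b n p"
  shows "raise a b (pderiv p) = smult (- (real n * (real n + a + b + 1))) p"
proof (cases n)
  case 0
  then have "pderiv p = 0" using assms by (simp add: orth_degree_def pderiv_eq_0_iff)
  then show ?thesis using 0 by (simp add: raise_def)
next
  case (Suc m)
  have sym: "inner_w a b (poly (raise a b (pderiv p))) (poly q) = inner_w a b (poly p) (poly (raise a b (pderiv q)))" for q
    using inner_w_raise[OF assms(1,2), of "pderiv p" q] inner_w_raise[OF assms(1,2), of "pderiv q" p]
    by (simp add: inner_w_commute)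
  have dp: "degree (pderiv p) \<le> m" using assms Suc by (auto simp: orth_degree_def degree_pderiv)
  have orth: "orth_degree a b n (raise a b (pderiv p))"
    unfolding orth_degree_def
  proof (intro conjI allI impI)
    show "degree (raise a b (pderiv p)) \<le> n" using raise_degree_coeff(1)[OF dp] Suc by simp
    fix q :: "real poly" assume q: "degree q < n"
    show "inner_w a b (poly (raise a b (pderiv p))) (poly q) = 0"
    proof (cases "degree q")
      case 0
      then have "pderiv q = 0" by (simp add: pderiv_eq_0_iff)
      then show ?thesis unfolding sym by (simp add: raise_def inner_w_def)
    next
      case (Suc k)
      then have "degree (raise a b (pderiv q)) \<le> Suc k" by (intro raise_degree_coeff(1)) (simp add: degree_pderiv)
      then show ?thesis unfolding sym using assms(3) q Suc by (auto simp: orth_degree_def)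
    qed
  qed
  have "smult 1 (raise a b (pderiv p)) + smult (real n * (real n + a + b + 1)) p = 0"
  proof (rule orth_degree_eq_0[OF assms(1,2)])
    show "orth_degree a b n (smult 1 (raise a b (pderiv p)) + smult (real n * (real n + a + b + 1)) p)"
      using assms orth by (intro orth_degree_lincomb)
    show "coeff (smult 1 (raise a b (pderiv p)) + smult (real n * (real n + a + b + 1)) p) n = 0"
      using raise_degree_coeff(2)[OF dp, of a b] Suc by (simp add: coeff_pderiv algebra_simps)
  qed
  then show ?thesis by (simp add: eq_neg_iff_add_eq_0)
qed

text \<open>Moving the derivative of \<open>q\<close> to the other factor produces the left side of the differential
equation for \<open>p\<close>.\<close>

lemma inner_w_pderiv_pderiv:
  assumes "- 1 < a" "- 1 < b" "orth_degree a b n p"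
  shows "inner_w (a + 1) (b + 1) (poly (pderiv p)) (poly (pderiv q)) = real n * (real n + a + b + 1) * inner_w a b (poly p) (poly q)"
  using inner_w_raise[OF assms(1,2), of "pderiv p" q] inner_w_poly_smult[of a b "poly q" "- (real n * (real n + a + b + 1))" p]
  by (simp add: orth_degree_eigen[OF assms] inner_w_commute del: poly_smult)

text \<open>For \<open>c = a + b\<close>, the square norm with weight \<open>(a + j, b + j)\<close> of the \<open>j\<close>-th derivative of the \<open>n\<close>-th
orthonormal polynomial for \<open>(a, b)\<close>; the factor with \<open>i = n\<close> makes it vanish for \<open>n < j\<close>.\<close>

definition deriv_factor :: "nat \<Rightarrow> real \<Rightarrow> nat \<Rightarrow> real" where
  "deriv_factor j c n = (\<Prod>i<j. (real n - real i) * (real n + real i + c + 1))"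

lemma deriv_factor_Suc_shift: "deriv_factor (Suc j) c n = real n * (real n + c + 1) * deriv_factor j (c + 2) (n - 1)"
proof (cases n)
  case 0
  then show ?thesis unfolding deriv_factor_def by (subst prod.lessThan_Suc_shift) simp
next
  case (Suc m)
  then show ?thesis unfolding deriv_factor_def
    by (subst prod.lessThan_Suc_shift) (simp add: algebra_simps)
qed

lemma inner_w_higher_pderiv:
  "- 1 < a \<Longrightarrow> - 1 < b \<Longrightarrow> orth_degree a b n p \<Longrightarrow>
   inner_w (a + real j) (b + real j) (poly ((pderiv ^^ j) p)) (poly ((pderiv ^^ j) q)) = deriv_factor j (a + b) n * inner_w a b (poly p) (poly q)"
proof (induction j arbitrary: a b n p q)
  case 0
  then show ?case by (simp add: deriv_factor_def)
next
  case (Suc j)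
  have "inner_w (a + 1 + real j) (b + 1 + real j) (poly ((pderiv ^^ j) (pderiv p))) (poly ((pderiv ^^ j) (pderiv q))) =
        deriv_factor j (a + 1 + (b + 1)) (n - 1) * inner_w (a + 1) (b + 1) (poly (pderiv p)) (poly (pderiv q))"
    using Suc.prems by (intro Suc.IH orth_degree_pderiv) auto
  then show ?case using inner_w_pderiv_pderiv[OF Suc.prems, of q]
    by (simp add: funpow_Suc_right deriv_factor_Suc_shift add_ac del: funpow.simps)
qed

text \<open>The polynomial factor of the \<open>j\<close>-th derivative of the weight \<open>(a + j, b + j)\<close> times \<open>q\<close>.\<close>

primrec raise_iter :: "nat \<Rightarrow> real \<Rightarrow> real \<Rightarrow> real poly \<Rightarrow> real poly" where
  "raise_iter 0 a b q = q"
| "raise_iter (Suc j) a b q = raise a b (raise_iter j (a + 1) (b + 1) q)"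

text \<open>Iterating the differential equation through the weights \<open>(a + i, b + i)\<close>: the \<open>j\<close>-th derivative of
the weight \<open>(a + j, b + j)\<close> times the \<open>j\<close>-th derivative of \<open>p\<close> is a multiple of the weight \<open>(a, b)\<close>
times \<open>p\<close>. This makes these functions the right test functions for weak derivatives.\<close>

lemma raise_iter_higher_pderiv:
  "- 1 < a \<Longrightarrow> - 1 < b \<Longrightarrow> orth_degree a b n p \<Longrightarrow>
   raise_iter j a b ((pderiv ^^ j) p) = smult ((- 1) ^ j * deriv_factor j (a + b) n) p"
proof (induction j arbitrary: a b n p)
  case 0
  then show ?case by (simp add: deriv_factor_def)
next
  case (Suc j)
  have "raise_iter j (a + 1) (b + 1) ((pderiv ^^ j) (pderiv p)) = smult ((- 1) ^ j * deriv_factor j (a + 1 + (b + 1)) (n - 1)) (pderiv p)"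
    using Suc.prems by (intro Suc.IH orth_degree_pderiv) auto
  then show ?case using orth_degree_eigen[OF Suc.prems]
    by (simp add: funpow_Suc_right deriv_factor_Suc_shift raise_smult add_ac mult_ac del: funpow.simps)
qed

lemma deriv_factor_nonneg:
  assumes "- 2 < c"
  shows "0 \<le> deriv_factor j c n"
proof (cases "n < j")
  case True
  then have "deriv_factor j c n = 0" unfolding deriv_factor_def by (intro prod_zero bexI[of _ n]) auto
  then show ?thesis by simp
next
  case False
  then show ?thesis unfolding deriv_factor_def using assms by (intro prod_nonneg mult_nonneg_nonneg) auto
qed

text \<open>The operator shifts the index by one and lowers \<open>a + b\<close> by two; the comparison says that no
smoothness is lost in this shift.\<close>

lemma deriv_factor_shift_le:
  assumes "0 < c"
  shows "deriv_factor j c n \<le> deriv_factor j (c - 2) (Suc n)"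
proof (cases "n < j")
  case True
  then have "deriv_factor j c n = 0" unfolding deriv_factor_def by (intro prod_zero bexI[of _ n]) auto
  then show ?thesis using deriv_factor_nonneg[of "c - 2" j "Suc n"] assms by simp
next
  case False
  show ?thesis unfolding deriv_factor_def
  proof (intro prod_mono conjI)
    fix i assume i: "i \<in> {..<j}"
    show "0 \<le> (real n - real i) * (real n + real i + c + 1)" using i False assms by auto
    show "(real n - real i) * (real n + real i + c + 1) \<le> (real (Suc n) - real i) * (real (Suc n) + real i + (c - 2) + 1)"
      using assms by (simp add: algebra_simps)
  qed
qed

definition orthonormal_poly :: "real \<Rightarrow> real \<Rightarrow> nat \<Rightarrow> real poly" where
  "orthonormal_poly a b n = smult (1 / sqrt (inner_w a b (poly (orth_poly n a b)) (poly (orth_poly n a b)))) (orth_poly n a b)"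

abbreviation coeff_w :: "real \<Rightarrow> real \<Rightarrow> (real \<Rightarrow> real) \<Rightarrow> nat \<Rightarrow> real" where
  "coeff_w a b f n \<equiv> inner_w a b f (poly (orthonormal_poly a b n))"

lemma orthonormal_poly_props:
  assumes "- 1 < a" "- 1 < b"
  shows "orth_degree a b n (orthonormal_poly a b n)" "coeff (orthonormal_poly a b n) n \<noteq> 0"
    "inner_w a b (poly (orthonormal_poly a b n)) (poly (orthonormal_poly a b n)) = 1"
proof -
  let ?n = "inner_w a b (poly (orth_poly n a b)) (poly (orth_poly n a b))"
  have j: "orth_degree a b n (orth_poly n a b)" "coeff (orth_poly n a b) n \<noteq> 0" using orth_degree_orth_poly[OF assms] by auto
  then have "?n \<noteq> 0" using inner_w_poly_self_eq_0[OF assms, of "orth_poly n a b"] by auto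
  then have n: "?n > 0" using inner_w_nonneg[of a b "poly (orth_poly n a b)"] by simp
  show "orth_degree a b n (orthonormal_poly a b n)" using orth_degree_lincomb[OF assms j(1) j(1), of "1 / sqrt ?n" 0] by (simp add: orthonormal_poly_def)
  show "coeff (orthonormal_poly a b n) n \<noteq> 0" using j(2) n by (simp add: orthonormal_poly_def)
  have "inner_w a b (poly (smult c (orth_poly n a b))) (poly (smult c (orth_poly n a b))) = c * c * ?n" for c
    using inner_w_poly_smult[of a b "poly (smult c (orth_poly n a b))" c "orth_poly n a b"] inner_w_poly_smult[of a b "poly (orth_poly n a b)" c "orth_poly n a b"]
    by (simp add: inner_w_commute)
  then show "inner_w a b (poly (orthonormal_poly a b n)) (poly (orthonormal_poly a b n)) = 1"
    using n by (simp add: orthonormal_poly_def divide_simps power2_eq_square[symmetric] del: poly_smult)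
qed

lemma orthonormal_poly_orthogonal:
  assumes "- 1 < a" "- 1 < b" "m \<noteq> n"
  shows "inner_w a b (poly (orthonormal_poly a b n)) (poly (orthonormal_poly a b m)) = 0"
proof -
  have "degree (orthonormal_poly a b k) \<le> k" "orth_degree a b k (orthonormal_poly a b k)" for k
    using orthonormal_poly_props(1)[OF assms(1,2), of k] by (auto simp: orth_degree_def)
  then show ?thesis using assms(3) by (metis orth_degree_def inner_w_commute linorder_neqE_nat order_le_less_trans)
qed

text \<open>Eliminate the top coefficient and use induction on the degree bound.\<close>

lemma poly_orthonormal_expansion:
  assumes "- 1 < a" "- 1 < b" "degree q \<le> N"
  shows "\<exists>c. q = (\<Sum>n\<le>N. smult (c n) (orthonormal_poly a b n))"
  using assms(3)
proof (induction N arbitrary: q)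
  case 0
  then have "degree q = 0" "degree (orthonormal_poly a b 0) = 0" "coeff (orthonormal_poly a b 0) 0 \<noteq> 0"
    using orthonormal_poly_props[OF assms(1,2), of 0] by (auto simp: orth_degree_def)
  then have "q = smult (coeff q 0 / coeff (orthonormal_poly a b 0) 0) (orthonormal_poly a b 0)"
    by (auto elim!: degree_eq_zeroE)
  then show ?case by auto
next
  case (Suc N)
  let ?P = "orthonormal_poly a b (Suc N)"
  define d where "d = coeff q (Suc N) / coeff ?P (Suc N)"
  have P: "degree ?P \<le> Suc N" "coeff ?P (Suc N) \<noteq> 0"
    using orthonormal_poly_props[OF assms(1,2), of "Suc N"] by (auto simp: orth_degree_def)
  have "degree (q - smult d ?P) \<le> N"
  proof (rule degree_le, intro allI impI)
    fix i assume "N < i"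
    then show "coeff (q - smult d ?P) i = 0"
      using P Suc.prems by (cases "i = Suc N") (auto simp: d_def coeff_eq_0)
  qed
  from Suc.IH[OF this] obtain c where c: "q - smult d ?P = (\<Sum>n\<le>N. smult (c n) (orthonormal_poly a b n))" by auto
  have "(\<Sum>n\<le>Suc N. smult ((c(Suc N := d)) n) (orthonormal_poly a b n)) = (\<Sum>n\<le>N. smult (c n) (orthonormal_poly a b n)) + smult d ?P"
    by simp
  then have "q = (\<Sum>n\<le>Suc N. smult ((c(Suc N := d)) n) (orthonormal_poly a b n))" using c by (simp add: algebra_simps)
  then show ?case by blast
qed

section \<open>Potentials of weighted polynomials\<close>

abbreviation lborel01 :: "real measure" where "lborel01 \<equiv> restrict_space lborel {0<..<1}"

lemma integrable_lebesgue_on_borel: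
  fixes f :: "real \<Rightarrow> real"
  assumes "f \<in> borel_measurable borel" and [simp]: "S \<in> sets borel"
  shows "integrable (lebesgue_on S) f \<longleftrightarrow> integrable (restrict_space lborel S) f"
proof -
  have [measurable]: "S \<in> sets borel" "f \<in> borel_measurable borel" by fact+
  show ?thesis by (simp add: integrable_restrict_space integrable_completion)
qed

text \<open>Changes in the order of integration take place on Borel sets; this transfers explicit integrands
from the completed measure.\<close>

lemma integral_lebesgue_on_borel:
  fixes f :: "real \<Rightarrow> real"
  assumes "f \<in> borel_measurable borel" and [simp]: "S \<in> sets borel"
  shows "integral\<^sup>L (lebesgue_on S) f = integral\<^sup>L (restrict_space lborel S) f"
proof -
  have [measurable]: "S \<in> sets borel" "f \<in> borel_measurable borel" by fact+
  show ?thesis by (simp add: integral_restrict_space integral_completion)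
qed

lemma finite_measure_lborel01: "finite_measure lborel01"
  by (intro finite_measureI) (simp add: emeasure_restrict_space space_restrict_space)

lemma borel_measurable_restrict_lborel:
  "f \<in> borel_measurable borel \<Longrightarrow> f \<in> borel_measurable (restrict_space lborel S)"
  by (intro measurable_restrict_space1) simp

definition riesz_pot :: "real \<Rightarrow> real \<Rightarrow> real \<Rightarrow> real \<Rightarrow> (real \<Rightarrow> real) \<Rightarrow> real \<Rightarrow> real" where
  "riesz_pot \<sigma> r A B P x = (LINT s|lborel01. riesz_kernel \<sigma> r (x - s) * (weight A B s * P s))"

lemma riesz_kernel_reflect: "riesz_kernel \<sigma> r (- t) = riesz_kernel \<sigma> (1 - r) t"
  by (auto simp: riesz_kernel_def)

lemma pderiv_antideriv:
  fixes q :: "real poly"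
  obtains Q where "pderiv Q = q" "coeff Q 0 = 0" "\<And>n. coeff Q (Suc n) = coeff q n / real (Suc n)"
proof -
  define Q where "Q = (\<Sum>i\<le>degree q. monom (coeff q i / real (Suc i)) (Suc i))"
  have 1: "coeff Q (Suc n) = coeff q n / real (Suc n)" for n
  proof -
    have "coeff Q (Suc n) = (\<Sum>i\<le>degree q. if i = n then coeff q n / real (Suc n) else 0)"
      by (simp add: Q_def coeff_sum cong: if_cong)
    then show ?thesis by (auto simp: coeff_eq_0)
  qed
  moreover have "coeff Q 0 = 0" by (simp add: Q_def coeff_sum)
  moreover have "pderiv Q = q" by (rule poly_eqI) (simp add: coeff_pderiv 1)
  ultimately show ?thesis by (intro that) auto
qed

lemma integral_poly_upto:
  assumes x: "x \<in> {0<..<1}" and Q: "pderiv Q = q" "coeff Q 0 = 0"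
    and f: "\<And>t. t \<in> {0<..<1} \<Longrightarrow> f t = poly q t"
  shows "(LINT t|lborel01. indicator {0<..<x} t * f t) = poly Q x"
proof -
  have "(poly q has_integral poly Q x - poly Q 0) {0..x}"
    using x poly_DERIV[of Q] Q
    by (intro fundamental_theorem_of_calculus)
       (auto simp flip: has_real_derivative_iff_has_vector_derivative intro: DERIV_subset)
  then have "(poly q has_integral poly Q x) {0<..<x}"
    using Q by (simp add: has_integral_Icc_iff_Ioo poly_0_coeff_0)
  moreover have "(poly q has_integral integral\<^sup>L (lebesgue_on {0<..<x}) (poly q)) {0<..<x}"
  proof (rule has_integral_integral_lebesgue_on)
    have "poly q absolutely_integrable_on {0..x}"
      by (intro absolutely_integrable_continuous_real continuous_intros)
    then have "poly q absolutely_integrable_on {0<..<x}"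
      by (rule set_integrable_subset) auto
    then show "integrable (lebesgue_on {0<..<x}) (poly q)"
      by (rule absolutely_integrable_imp_integrable) simp
  qed simp
  ultimately have "poly Q x = integral\<^sup>L (lebesgue_on {0<..<x}) (poly q)" by (rule has_integral_unique)
  also have "\<dots> = integral\<^sup>L (restrict_space lborel {0<..<x}) (poly q)"
    by (rule integral_lebesgue_on_borel) auto
  also have "\<dots> = (LINT t|lborel01. indicator {0<..<x} t * f t)"
    using x f by (simp add: integral_restrict_space, intro Bochner_Integration.integral_cong) (auto simp: indicator_def)
  finally show ?thesis by simp
qed

text \<open>The kernel and the weight are balanced if the potential of the weight is constant. The class is
closed under exchanging \<open>r\<close> with \<open>1 - r\<close> and \<open>A\<close> with \<open>B\<close>, that is, under passing to the adjoint.\<close>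

locale balanced_kernel =
  fixes \<sigma> r A B C :: real
  assumes \<sigma>: "0 < \<sigma>" "\<sigma> < 1"
    and AB: "- 1 < A" "- 1 < B"
    and r: "0 \<le> r" "r \<le> 1"
    and C: "0 < C"
    and kernel_const: "\<And>x. x \<in> {0<..<1} \<Longrightarrow>
      riesz_mass \<sigma> r A B x = ennreal C"
begin

lemma has_bochner_integral_kernel:
  assumes "x \<in> {0<..<1}"
  shows "has_bochner_integral lborel01 (\<lambda>s. riesz_kernel \<sigma> r (x - s) * weight A B s) C"
proof (rule has_bochner_integral_nn_integral)
  show "(\<lambda>s. riesz_kernel \<sigma> r (x - s) * weight A B s) \<in> borel_measurable lborel01"
    by (rule borel_measurable_restrict_lborel) measurable
  show "AE s in lborel01. 0 \<le> riesz_kernel \<sigma> r (x - s) * weight A B s"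
    using r by (intro AE_I2 mult_nonneg_nonneg riesz_kernel_nonneg) auto
  show "(\<integral>\<^sup>+s. ennreal (riesz_kernel \<sigma> r (x - s) * weight A B s) \<partial>lborel01) = ennreal C"
    using kernel_const[OF assms] by (simp add: nn_integral_restrict_space)
qed (use C in auto)

lemma integrable_kernel:
  "x \<in> {0<..<1} \<Longrightarrow> integrable lborel01 (\<lambda>s. riesz_kernel \<sigma> r (x - s) * weight A B s)"
  using has_bochner_integral_kernel by (simp add: has_bochner_integral_iff)

lemma integral_kernel:
  "x \<in> {0<..<1} \<Longrightarrow> (LINT s|lborel01. riesz_kernel \<sigma> r (x - s) * weight A B s) = C"
  using has_bochner_integral_kernel by (simp add: has_bochner_integral_iff)

text \<open>The kernel and the weight are nonnegative, so the constant potential of the weight controls the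
potential of everything that is bounded.\<close>

lemma integrable_kernel_bounded:
  assumes x: "x \<in> {0<..<1}" and P: "P \<in> borel_measurable borel" "\<And>s. s \<in> {0<..<1} \<Longrightarrow> \<bar>P s\<bar> \<le> M"
  shows "integrable lborel01 (\<lambda>s. riesz_kernel \<sigma> r (x - s) * (weight A B s * P s))"
    and "(LINT s|lborel01. norm (riesz_kernel \<sigma> r (x - s) * (weight A B s * P s))) \<le> M * C"
proof -
  have [measurable]: "P \<in> borel_measurable borel" by fact
  have b: "norm (riesz_kernel \<sigma> r (x - s) * (weight A B s * P s)) \<le> M * (riesz_kernel \<sigma> r (x - s) * weight A B s)"
    if "s \<in> {0<..<1}" for s
  proof -
    have "norm (riesz_kernel \<sigma> r (x - s) * (weight A B s * P s)) = (riesz_kernel \<sigma> r (x - s) * weight A B s) * \<bar>P s\<bar>"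
      using riesz_kernel_nonneg[OF r, of \<sigma> "x - s"] by (simp add: abs_mult)
    also have "\<dots> \<le> (riesz_kernel \<sigma> r (x - s) * weight A B s) * M"
      using riesz_kernel_nonneg[OF r, of \<sigma> "x - s"] P(2)[OF that] by (intro mult_left_mono) auto
    finally show ?thesis by (simp add: mult.commute)
  qed
  have i: "integrable lborel01 (\<lambda>s. M * (riesz_kernel \<sigma> r (x - s) * weight A B s))"
    using integrable_kernel[OF x] by simp
  show 1: "integrable lborel01 (\<lambda>s. riesz_kernel \<sigma> r (x - s) * (weight A B s * P s))"
  proof (rule Bochner_Integration.integrable_bound[OF i])
    show "(\<lambda>s. riesz_kernel \<sigma> r (x - s) * (weight A B s * P s)) \<in> borel_measurable lborel01"
      by (rule borel_measurable_restrict_lborel) measurable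
    show "AE s in lborel01. norm (riesz_kernel \<sigma> r (x - s) * (weight A B s * P s)) \<le>
      norm (M * (riesz_kernel \<sigma> r (x - s) * weight A B s))"
      by (intro AE_I2 order.trans[OF b]) (auto simp: space_restrict_space)
  qed
  have "(LINT s|lborel01. norm (riesz_kernel \<sigma> r (x - s) * (weight A B s * P s))) \<le>
        (LINT s|lborel01. M * (riesz_kernel \<sigma> r (x - s) * weight A B s))"
    by (intro integral_mono integrable_norm 1 i b) (auto simp: space_restrict_space)
  then show "(LINT s|lborel01. norm (riesz_kernel \<sigma> r (x - s) * (weight A B s * P s))) \<le> M * C"
    using integral_kernel[OF x] by simp
qed

lemma integrable_kernel_poly:
  assumes x: "x \<in> {0<..<1}"
  shows "integrable lborel01 (\<lambda>s. riesz_kernel \<sigma> r (x - s) * (weight A B s * poly p s))"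
proof -
  obtain M where "\<And>s. s \<in> {0<..<1} \<Longrightarrow> \<bar>poly p s\<bar> \<le> M" using poly_bounded_unit[of p] by blast
  then show ?thesis using x by (intro integrable_kernel_bounded(1)[where M = M]) auto
qed

text \<open>The inner integral is at most \<open>M * C\<close> uniformly in \<open>t\<close>, which gives absolute integrability on the
square. Used with an indicator \<open>G\<close> for the primitive of a potential and with a weighted polynomial
\<open>G\<close> for the adjoint.\<close>

lemma riesz_pot_Fubini:
  assumes P: "P \<in> borel_measurable borel" "\<And>s. s \<in> {0<..<1} \<Longrightarrow> \<bar>P s\<bar> \<le> M"
    and G: "G \<in> borel_measurable borel" "integrable lborel01 G"
  shows "(LINT t|lborel01. G t * riesz_pot \<sigma> r A B P t) =
         (LINT s|lborel01. weight A B s * P s * (LINT t|lborel01. riesz_kernel \<sigma> r (t - s) * G t))"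
proof -
  interpret finite_measure lborel01 by (rule finite_measure_lborel01)
  interpret pair_sigma_finite lborel01 lborel01 ..
  have sf: "sigma_finite_measure lborel01" ..
  have [measurable]: "P \<in> borel_measurable borel" "G \<in> borel_measurable borel" by fact+
  have sets: "sets (lborel01 \<Otimes>\<^sub>M lborel01) = sets (restrict_space borel {0<..<1} \<Otimes>\<^sub>M restrict_space borel {0<..<1})"
    by (intro sets_pair_measure_cong) (auto simp: sets_restrict_space)
  let ?f = "\<lambda>(t, s). G t * (riesz_kernel \<sigma> r (t - s) * (weight A B s * P s))"
  have m: "?f \<in> borel_measurable (lborel01 \<Otimes>\<^sub>M lborel01)"
  proof -
    have [measurable]: "(\<lambda>x. x) \<in> borel_measurable lborel01" by (rule borel_measurable_restrict_lborel) simp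
    have [measurable]: "fst \<in> borel_measurable (lborel01 \<Otimes>\<^sub>M lborel01)" "snd \<in> borel_measurable (lborel01 \<Otimes>\<^sub>M lborel01)"
      using measurable_compose[OF measurable_fst \<open>(\<lambda>x. x) \<in> borel_measurable lborel01\<close>]
        measurable_compose[OF measurable_snd \<open>(\<lambda>x. x) \<in> borel_measurable lborel01\<close>] by auto
    show ?thesis unfolding case_prod_beta by measurable
  qed
  have "integrable (lborel01 \<Otimes>\<^sub>M lborel01) ?f"
  proof (rule Fubini_integrable[OF m])
    show "AE t in lborel01. integrable lborel01 (\<lambda>s. ?f (t, s))"
      using integrable_kernel_bounded(1)[OF _ P] by (intro AE_I2) (simp add: space_restrict_space)
    show "integrable lborel01 (\<lambda>t. LINT s|lborel01. norm (?f (t, s)))"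
    proof (rule Bochner_Integration.integrable_bound)
      show "integrable lborel01 (\<lambda>t. (M * C) * G t)" using G by simp
      have "(\<lambda>x. norm (?f x)) \<in> borel_measurable (lborel01 \<Otimes>\<^sub>M lborel01)" using m by measurable
      then have "(\<lambda>(t, s). norm (G t * (riesz_kernel \<sigma> r (t - s) * (weight A B s * P s)))) \<in> borel_measurable (lborel01 \<Otimes>\<^sub>M lborel01)"
        by (simp add: case_prod_beta)
      then show "(\<lambda>t. LINT s|lborel01. norm (?f (t, s))) \<in> borel_measurable lborel01"
        unfolding prod.case by (rule sigma_finite_measure.borel_measurable_lebesgue_integral[OF sf])
      show "AE t in lborel01. norm (LINT s|lborel01. norm (?f (t, s))) \<le> norm ((M * C) * G t)"
      proof (rule AE_I2)
        fix t assume "t \<in> space lborel01"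
        then have t: "t \<in> {0<..<1}" by (simp add: space_restrict_space)
        have 0: "0 \<le> (LINT s|lborel01. norm (riesz_kernel \<sigma> r (t - s) * (weight A B s * P s)))" by simp
        have "(LINT s|lborel01. norm (?f (t, s))) = \<bar>G t\<bar> * (LINT s|lborel01. norm (riesz_kernel \<sigma> r (t - s) * (weight A B s * P s)))"
          by (simp add: abs_mult)
        also have "\<dots> \<le> \<bar>G t\<bar> * (M * C)"
          using integrable_kernel_bounded(2)[OF t P] by (intro mult_left_mono) auto
        finally have "(LINT s|lborel01. norm (?f (t, s))) \<le> \<bar>G t\<bar> * (M * C)" .
        moreover have "0 \<le> M * C" using 0 integrable_kernel_bounded(2)[OF t P] by linarith
        then have "norm ((M * C) * G t) = \<bar>G t\<bar> * (M * C)"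
          unfolding real_norm_def abs_mult[of "M * C"] by simp
        ultimately show "norm (LINT s|lborel01. norm (?f (t, s))) \<le> norm ((M * C) * G t)"
          by simp
      qed
    qed
  qed
  then have "(LINT s|lborel01. LINT t|lborel01. G t * (riesz_kernel \<sigma> r (t - s) * (weight A B s * P s))) =
             (LINT t|lborel01. LINT s|lborel01. G t * (riesz_kernel \<sigma> r (t - s) * (weight A B s * P s)))"
    by (intro Fubini_integral) simp
  moreover have "(LINT s|lborel01. G t * (riesz_kernel \<sigma> r (t - s) * (weight A B s * P s))) = G t * riesz_pot \<sigma> r A B P t" for t
    by (simp add: riesz_pot_def)
  moreover have "(LINT t|lborel01. G t * (riesz_kernel \<sigma> r (t - s) * (weight A B s * P s))) =
     weight A B s * P s * (LINT t|lborel01. riesz_kernel \<sigma> r (t - s) * G t)" for s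
    by (subst integral_mult_right_zero[symmetric]) (simp add: mult_ac)
  ultimately show ?thesis by (simp add: riesz_pot_def)
qed

text \<open>Up to the factor \<open>\<sigma>\<close>, \<open>t k(t)\<close> is a primitive of the kernel \<open>k\<close>; it is continuous at the
singularity, which may therefore be crossed.\<close>

lemma kernel_primitive:
  assumes x: "0 < x"
  shows "((\<lambda>t. \<sigma> * riesz_kernel \<sigma> r (t - s)) has_integral
           (riesz_kernel \<sigma> r (x - s) * (x - s) - riesz_kernel \<sigma> r (- s) * (- s))) {0..x}"
proof -
  \<comment> \<open>This form of \<open>t k(t)\<close> is visibly continuous.\<close>
  define \<kappa> where "\<kappa> t = r * (max t 0) powr \<sigma> - (1 - r) * (max (- t) 0) powr \<sigma>" for t
  have eq: "riesz_kernel \<sigma> r t * t = \<kappa> t" for t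
  proof -
    consider "t > 0" | "t = 0" | "t < 0" by linarith
    then show ?thesis
    proof cases
      case 1
      then have "t powr \<sigma> = t powr (\<sigma> - 1) * t" using powr_add[of t "\<sigma> - 1" 1] by simp
      then show ?thesis using 1 by (simp add: riesz_kernel_def \<kappa>_def max_def)
    next
      case 2
      then show ?thesis using \<sigma> by (simp add: riesz_kernel_def \<kappa>_def)
    next
      case 3
      then have "(- t) powr \<sigma> = (- t) powr (\<sigma> - 1) * (- t)" using powr_add[of "- t" "\<sigma> - 1" 1] by simp
      then show ?thesis using 3 by (simp add: riesz_kernel_def \<kappa>_def max_def)
    qed
  qed
  have "((\<lambda>t. \<sigma> * riesz_kernel \<sigma> r (t - s)) has_integral \<kappa> (x - s) - \<kappa> (0 - s)) {0..x}"
  proof (rule fundamental_theorem_of_calculus_interior_strong[of "{s}"])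
    show "continuous_on {0..x} (\<lambda>t. \<kappa> (t - s))"
      unfolding \<kappa>_def using \<sigma> by (intro continuous_intros continuous_on_powr') auto
    fix t assume t: "t \<in> {0<..<x} - {s}"
    show "((\<lambda>t. \<kappa> (t - s)) has_vector_derivative \<sigma> * riesz_kernel \<sigma> r (t - s)) (at t)"
    proof (cases "t > s")
      case True
      have "((\<lambda>t. r * (t - s) powr \<sigma>) has_real_derivative \<sigma> * riesz_kernel \<sigma> r (t - s)) (at t)"
        using DERIV_cmult[OF DERIV_fun_powr[of "\<lambda>t. t - s" 1 t \<sigma>], of r] True
        by (auto simp: riesz_kernel_def mult_ac intro!: derivative_eq_intros)
      moreover have "\<forall>\<^sub>F u in nhds t. \<kappa> (u - s) = r * (u - s) powr \<sigma>"
        using eventually_nhds_in_open[of "{s<..}" t] True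
        by (auto elim!: eventually_mono simp: \<kappa>_def max_def)
      ultimately show ?thesis
        unfolding has_real_derivative_iff_has_vector_derivative[symmetric] by (subst DERIV_cong_ev) auto
    next
      case False
      then have "t < s" using t by auto
      then have "((\<lambda>t. - (1 - r) * (s - t) powr \<sigma>) has_real_derivative \<sigma> * riesz_kernel \<sigma> r (t - s)) (at t)"
        using DERIV_cmult[OF DERIV_fun_powr[of "\<lambda>t. s - t" "- 1" t \<sigma>], of "- (1 - r)"]
        by (auto simp: riesz_kernel_def algebra_simps intro!: derivative_eq_intros)
      moreover have "\<forall>\<^sub>F u in nhds t. \<kappa> (u - s) = - (1 - r) * (s - u) powr \<sigma>"
        using eventually_nhds_in_open[of "{..<s}" t] \<open>t < s\<close>
        by (auto elim!: eventually_mono simp: \<kappa>_def max_def algebra_simps)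
      ultimately show ?thesis
        unfolding has_real_derivative_iff_has_vector_derivative[symmetric] by (subst DERIV_cong_ev) auto
    qed
  qed (use x in auto)
  then show ?thesis unfolding eq by simp
qed

lemma integral_kernel_upto:
  assumes x: "x \<in> {0<..<1}"
  shows "\<sigma> * (LINT t|lborel01. riesz_kernel \<sigma> r (t - s) * indicator {0<..<x} t) =
         riesz_kernel \<sigma> r (x - s) * (x - s) - riesz_kernel \<sigma> r (- s) * (- s)"
proof -
  have "((\<lambda>t. \<sigma> * riesz_kernel \<sigma> r (t - s)) has_integral
           (riesz_kernel \<sigma> r (x - s) * (x - s) - riesz_kernel \<sigma> r (- s) * (- s))) {0<..<x}"
    using kernel_primitive[of x s] x by (simp add: has_integral_Icc_iff_Ioo)
  moreover have "((\<lambda>t. \<sigma> * riesz_kernel \<sigma> r (t - s)) has_integral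
     (LINT t|(lebesgue_on {0<..<x}). \<sigma> * riesz_kernel \<sigma> r (t - s))) {0<..<x}"
  proof (rule has_integral_integral_lebesgue_on)
    have "(\<lambda>t. \<sigma> * riesz_kernel \<sigma> r (t - s)) absolutely_integrable_on {0<..<x}"
      using calculation riesz_kernel_nonneg[OF r, of \<sigma>] \<sigma>
      by (intro nonnegative_absolutely_integrable_1) (auto simp: integrable_on_def)
    then show "integrable (lebesgue_on {0<..<x}) (\<lambda>t. \<sigma> * riesz_kernel \<sigma> r (t - s))"
      by (rule absolutely_integrable_imp_integrable) simp
  qed simp
  ultimately have "riesz_kernel \<sigma> r (x - s) * (x - s) - riesz_kernel \<sigma> r (- s) * (- s) =
     (LINT t|(lebesgue_on {0<..<x}). \<sigma> * riesz_kernel \<sigma> r (t - s))"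
    by (rule has_integral_unique)
  also have "\<dots> = (LINT t|(restrict_space lborel {0<..<x}). \<sigma> * riesz_kernel \<sigma> r (t - s))"
    by (rule integral_lebesgue_on_borel) auto
  also have "\<dots> = \<sigma> * (LINT t|(restrict_space lborel {0<..<x}). riesz_kernel \<sigma> r (t - s))"
    by simp
  also have "(LINT t|(restrict_space lborel {0<..<x}). riesz_kernel \<sigma> r (t - s)) =
     (LINT t|lborel01. riesz_kernel \<sigma> r (t - s) * indicator {0<..<x} t)"
    using x by (simp add: integral_restrict_space, intro Bochner_Integration.integral_cong) (auto simp: indicator_def)
  finally show ?thesis by simp
qed

lemma riesz_pot_pCons:
  assumes "x \<in> {0<..<1}"
  shows "riesz_pot \<sigma> r A B (poly (pCons c p)) x = c * C + riesz_pot \<sigma> r A B (poly (pCons 0 p)) x"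
proof -
  have "riesz_pot \<sigma> r A B (poly (pCons c p)) x =
    (LINT s|lborel01. c * (riesz_kernel \<sigma> r (x - s) * weight A B s) + riesz_kernel \<sigma> r (x - s) * (weight A B s * poly (pCons 0 p) s))"
    unfolding riesz_pot_def by (intro Bochner_Integration.integral_cong) (auto simp: algebra_simps)
  also have "\<dots> = c * C + riesz_pot \<sigma> r A B (poly (pCons 0 p)) x"
    unfolding riesz_pot_def using assms integrable_kernel_poly[OF assms, of "pCons 0 p"] integrable_kernel[OF assms] integral_kernel[OF assms]
    by (subst Bochner_Integration.integral_add) auto
  finally show ?thesis .
qed

text \<open>The difference of \<open>x\<close> times the potential of \<open>p\<close> and the potential of \<open>s p(s)\<close> has the kernel
\<open>t k(t)\<close>, so up to the constant \<open>h\<close> it is \<open>\<sigma>\<close> times the primitive of the potential of \<open>p\<close>.\<close>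

lemma riesz_pot_shift:
  obtains h where "\<And>x. x \<in> {0<..<1} \<Longrightarrow>
    riesz_pot \<sigma> r A B (poly (pCons 0 p)) x =
      x * riesz_pot \<sigma> r A B (poly p) x - \<sigma> * (LINT t|lborel01. indicator {0<..<x} t * riesz_pot \<sigma> r A B (poly p) t) - h"
    and "p = 0 \<Longrightarrow> h = 0"
proof
  define h where "h = (LINT s|lborel01. weight A B s * poly p s * (riesz_kernel \<sigma> r (- s) * (- s)))"
  show "p = 0 \<Longrightarrow> h = 0" by (simp add: h_def)
  fix x :: real assume x: "x \<in> {0<..<1}"
  obtain M where M: "\<And>s. s \<in> {0<..<1} \<Longrightarrow> \<bar>poly p s\<bar> \<le> M" using poly_bounded_unit[of p] by blast
  have hb: "\<bar>riesz_kernel \<sigma> r (- s) * (- s)\<bar> \<le> 1" if "s \<in> {0<..<1}" for s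
  proof -
    have "s powr (\<sigma> - 1) * s = s powr \<sigma>" using that powr_add[of s "\<sigma> - 1" 1] by simp
    moreover have "s powr \<sigma> \<le> 1 powr \<sigma>" using that \<sigma> by (intro powr_mono2) auto
    ultimately have "\<bar>riesz_kernel \<sigma> r (- s) * (- s)\<bar> = (1 - r) * s powr \<sigma>" "s powr \<sigma> \<le> 1"
      using that r by (auto simp: riesz_kernel_def abs_mult mult.assoc)
    then show ?thesis using r mult_mono[of "1 - r" 1 "s powr \<sigma>" 1] by simp
  qed
  have ih: "integrable lborel01 (\<lambda>s. weight A B s * poly p s * (riesz_kernel \<sigma> r (- s) * (- s)))"
  proof -
    have "integrable leb01 (\<lambda>s. weight A B s * (poly p s * (riesz_kernel \<sigma> r (- s) * (- s))))"
    proof (rule integrable_weight_bounded[OF AB])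
      show "(\<lambda>s. poly p s * (riesz_kernel \<sigma> r (- s) * (- s))) \<in> borel_measurable leb01"
        by (rule borel_measurable_lebesgue_onI) measurable
      show "\<bar>poly p s * (riesz_kernel \<sigma> r (- s) * (- s))\<bar> \<le> M * 1" if "s \<in> {0<..<1}" for s
        using M[OF that] hb[OF that] unfolding abs_mult[of "poly p s"] by (intro mult_mono) auto
    qed
    then show ?thesis by (subst (asm) integrable_lebesgue_on_borel) (auto simp: mult.assoc)
  qed
  have i1: "integrable lborel01 (\<lambda>s. x * (riesz_kernel \<sigma> r (x - s) * (weight A B s * poly p s)))"
    and i2: "integrable lborel01 (\<lambda>s. riesz_kernel \<sigma> r (x - s) * (weight A B s * poly (pCons 0 p) s))"
    using integrable_kernel_poly[OF x, of p] integrable_kernel_poly[OF x, of "pCons 0 p"] by auto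
  have "\<sigma> * (LINT t|lborel01. indicator {0<..<x} t * riesz_pot \<sigma> r A B (poly p) t) =
        \<sigma> * (LINT s|lborel01. weight A B s * poly p s * (LINT t|lborel01. riesz_kernel \<sigma> r (t - s) * indicator {0<..<x} t))"
  proof (subst riesz_pot_Fubini[OF _ M])
    interpret finite_measure lborel01 by (rule finite_measure_lborel01)
    show "integrable lborel01 (indicator {0<..<x} :: real \<Rightarrow> real)"
      using x by (intro integrable_const_bound[of _ 1] borel_measurable_restrict_lborel) auto
  qed auto
  also have "\<dots> = (LINT s|lborel01. weight A B s * poly p s * (riesz_kernel \<sigma> r (x - s) * (x - s) - riesz_kernel \<sigma> r (- s) * (- s)))"
    unfolding integral_kernel_upto[OF x, symmetric]
    by (subst integral_mult_right_zero[symmetric]) (simp add: mult_ac)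
  also have "\<dots> = (LINT s|lborel01. x * (riesz_kernel \<sigma> r (x - s) * (weight A B s * poly p s)) -
      riesz_kernel \<sigma> r (x - s) * (weight A B s * poly (pCons 0 p) s) - weight A B s * poly p s * (riesz_kernel \<sigma> r (- s) * (- s)))"
    by (intro Bochner_Integration.integral_cong refl) (simp add: algebra_simps)
  also have "\<dots> = x * riesz_pot \<sigma> r A B (poly p) x - riesz_pot \<sigma> r A B (poly (pCons 0 p)) x - h"
    unfolding h_def riesz_pot_def integral_mult_right_zero[symmetric]
    using i1 i2 ih by (simp only: Bochner_Integration.integral_diff Bochner_Integration.integrable_diff)
  finally show "riesz_pot \<sigma> r A B (poly (pCons 0 p)) x =
      x * riesz_pot \<sigma> r A B (poly p) x - \<sigma> * (LINT t|lborel01. indicator {0<..<x} t * riesz_pot \<sigma> r A B (poly p) t) - h"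
    by simp
qed

definition pot_factor :: "nat \<Rightarrow> real" where
  "pot_factor n = C * pochhammer (1 - \<sigma>) n / fact n"

lemma pot_factor_Suc: "pot_factor (Suc n) = pot_factor n * (1 - \<sigma> / real (Suc n))"
  by (simp add: pot_factor_def pochhammer_Suc divide_simps algebra_simps)

text \<open>Induction on the polynomial through \<open>riesz_pot_shift\<close>. In degree \<open>n + 1\<close> the multiplication
contributes the old leading coefficient and the integration subtracts \<open>\<sigma> / (n + 1)\<close> times it, which
is the recursion of \<open>pot_factor\<close>.\<close>

lemma riesz_pot_poly:
  "\<exists>q. (\<forall>x\<in>{0<..<1}. riesz_pot \<sigma> r A B (poly p) x = poly q x) \<and>
       (\<forall>n. degree p \<le> n \<longrightarrow> degree q \<le> n \<and> coeff q n = pot_factor n * coeff p n)"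
proof (induction p)
  case 0
  show ?case by (intro exI[of _ 0]) (simp add: riesz_pot_def)
next
  case (pCons c p)
  then obtain q where q: "\<And>x. x \<in> {0<..<1} \<Longrightarrow> riesz_pot \<sigma> r A B (poly p) x = poly q x"
    and qd: "\<And>n. degree p \<le> n \<Longrightarrow> degree q \<le> n \<and> coeff q n = pot_factor n * coeff p n" by auto
  obtain Q where Q: "pderiv Q = q" "coeff Q 0 = 0" "\<And>n. coeff Q (Suc n) = coeff q n / real (Suc n)"
    using pderiv_antideriv[of q] by blast
  obtain h where h: "\<And>x. x \<in> {0<..<1} \<Longrightarrow>
    riesz_pot \<sigma> r A B (poly (pCons 0 p)) x =
      x * riesz_pot \<sigma> r A B (poly p) x - \<sigma> * (LINT t|lborel01. indicator {0<..<x} t * riesz_pot \<sigma> r A B (poly p) t) - h"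
    and h0: "p = 0 \<Longrightarrow> h = 0" using riesz_pot_shift[of p] by blast
  \<comment> \<open>The recursion \<open>x q - \<sigma> \<integral>q\<close> of \<open>riesz_pot_shift\<close>, written on coefficients.\<close>
  define s where "s = pCons (c * C - h) q - smult \<sigma> Q"
  have "riesz_pot \<sigma> r A B (poly (pCons c p)) x = poly s x" if x: "x \<in> {0<..<1}" for x
    using riesz_pot_pCons[OF x, of c p] h[OF x] q[OF x] integral_poly_upto[OF x Q(1,2) q]
    by (simp add: s_def algebra_simps)
  moreover have "degree s \<le> n \<and> coeff s n = pot_factor n * coeff (pCons c p) n" if n: "degree (pCons c p) \<le> n" for n
  proof (cases n)
    case 0
    then have p: "p = 0" using n by (auto split: if_splits)
    then have "q = 0" using qd[of 0] by (auto intro: poly_eqI elim!: degree_eq_zeroE)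
    moreover have "Q = 0" using Q \<open>q = 0\<close> by (intro poly_eqI) (metis coeff_0 div_0 not0_implies_Suc)
    ultimately show ?thesis using 0 h0[OF p] by (simp add: s_def pot_factor_def p)
  next
    case (Suc m)
    have dp: "degree p \<le> m" using n Suc by (auto split: if_splits)
    have z: "coeff q i = 0" if "i > m" for i using qd[OF dp] that by (simp add: coeff_eq_0)
    have "degree s \<le> n"
    proof (rule degree_le, intro allI impI)
      fix i assume "n < i"
      then show "coeff s i = 0" using z Q(3) Suc by (cases i) (auto simp: s_def)
    qed
    moreover have "coeff s n = pot_factor n * coeff (pCons c p) n"
      using qd[OF dp] Q(3)[of m] unfolding Suc pot_factor_Suc
      by (simp add: s_def algebra_simps)
    ultimately show ?thesis by simp
  qed
  ultimately show ?case by blast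
qed

definition pot_poly :: "real poly \<Rightarrow> real poly" where
  "pot_poly p = (SOME q. (\<forall>x\<in>{0<..<1}. riesz_pot \<sigma> r A B (poly p) x = poly q x) \<and>
       (\<forall>n. degree p \<le> n \<longrightarrow> degree q \<le> n \<and> coeff q n = pot_factor n * coeff p n))"

lemma pot_poly:
  "x \<in> {0<..<1} \<Longrightarrow> riesz_pot \<sigma> r A B (poly p) x = poly (pot_poly p) x"
  "degree p \<le> n \<Longrightarrow> degree (pot_poly p) \<le> n"
  "degree p \<le> n \<Longrightarrow> coeff (pot_poly p) n = pot_factor n * coeff p n"
  using someI_ex[OF riesz_pot_poly[of p]] unfolding pot_poly_def by blast+

text \<open>The factor behaves like \<open>n powr (- \<sigma>)\<close>; the elementary bound of order \<open>1 / n\<close> suffices, because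
the operator contains one more derivative.\<close>

lemma pot_factor_lower: "C * (1 - \<sigma>) \<le> real (Suc n) * pot_factor (Suc n)"
proof (induction n)
  case 0
  then show ?case by (simp add: pot_factor_def)
next
  case (Suc n)
  have "real (Suc (Suc n)) * pot_factor (Suc (Suc n)) = pot_factor (Suc n) * (real (Suc (Suc n)) - \<sigma>)"
    by (subst pot_factor_Suc) (simp add: field_simps)
  also have "\<dots> \<ge> pot_factor (Suc n) * real (Suc n)"
    using \<sigma> C by (intro mult_left_mono) (auto simp: pot_factor_def intro!: divide_nonneg_nonneg mult_nonneg_nonneg pochhammer_nonneg)
  finally show ?case using Suc by (simp add: mult.commute)
qed

end

text \<open>Exchange the order of integration and use the reflection of the kernel.\<close>

lemma riesz_pot_adjoint:
  assumes "balanced_kernel \<sigma> r A B C" "balanced_kernel \<sigma> (1 - r) B A C'"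
  shows "inner_w B A (poly (balanced_kernel.pot_poly \<sigma> r A B C p)) (poly q) = inner_w A B (poly p) (poly (balanced_kernel.pot_poly \<sigma> (1 - r) B A C' q))"
proof -
  interpret R: balanced_kernel \<sigma> r A B C by fact
  interpret D: balanced_kernel \<sigma> "1 - r" B A C' by fact
  obtain M where M: "\<And>s. s \<in> {0<..<1} \<Longrightarrow> \<bar>poly p s\<bar> \<le> M" using poly_bounded_unit[of p] by blast
  have "inner_w B A (poly (R.pot_poly p)) (poly q) = (LINT x|lborel01. weight B A x * (poly (R.pot_poly p) x * poly q x))"
    unfolding inner_w_def by (rule integral_lebesgue_on_borel) auto
  also have "\<dots> = (LINT x|lborel01. (weight B A x * poly q x) * riesz_pot \<sigma> r A B (poly p) x)"
    by (intro Bochner_Integration.integral_cong refl) (simp add: space_restrict_space R.pot_poly(1) mult_ac)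
  also have "\<dots> = (LINT s|lborel01. weight A B s * poly p s * (LINT t|lborel01. riesz_kernel \<sigma> r (t - s) * (weight B A t * poly q t)))"
  proof (rule R.riesz_pot_Fubini[OF _ M])
    show "integrable lborel01 (\<lambda>x. weight B A x * poly q x)"
      using integrable_weight_poly[of B A q] R.AB by (simp add: integrable_lebesgue_on_borel)
  qed auto
  also have "\<dots> = (LINT s|lborel01. weight A B s * (poly p s * poly (D.pot_poly q) s))"
  proof (intro Bochner_Integration.integral_cong refl)
    fix s assume "s \<in> space lborel01"
    then have s: "s \<in> {0<..<1}" by (simp add: space_restrict_space)
    have "riesz_kernel \<sigma> r (t - s) = riesz_kernel \<sigma> (1 - r) (s - t)" for t
      using riesz_kernel_reflect[of \<sigma> r "s - t"] by simp
    then have "(LINT t|lborel01. riesz_kernel \<sigma> r (t - s) * (weight B A t * poly q t)) = poly (D.pot_poly q) s"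
      using D.pot_poly(1)[OF s, of q] by (simp add: riesz_pot_def)
    then show "weight A B s * poly p s * (LINT t|lborel01. riesz_kernel \<sigma> r (t - s) * (weight B A t * poly q t)) =
      weight A B s * (poly p s * poly (D.pot_poly q) s)" by (simp add: mult.assoc)
  qed
  also have "\<dots> = inner_w A B (poly p) (poly (D.pot_poly q))"
    unfolding inner_w_def by (rule integral_lebesgue_on_borel[symmetric]) auto
  finally show ?thesis .
qed

text \<open>By \<open>weight_poly_has_deriv\<close> the derivative of \<open>u\<close> is a weighted polynomial. The two one-sided integrals
join to one potential; the factors \<open>r\<close> and \<open>1 - r\<close> are absorbed before splitting, since a one-sided
integral is only known to converge with its factor.\<close>

lemma L_op_weight_poly:
  assumes "balanced_kernel \<sigma> r A B C" "\<alpha> = 2 - \<sigma>" and x: "x \<in> {0<..<1}"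
    and u: "u = (\<lambda>x. weight (A + 1) (B + 1) x * poly p x)"
  shows "L_op \<alpha> r u x = poly (smult (- 1 / Gamma \<sigma>) (balanced_kernel.pot_poly \<sigma> r A B C (raise A B p))) x"
proof -
  interpret R: balanced_kernel \<sigma> r A B C by fact
  let ?w = "\<lambda>s. weight A B s * poly (raise A B p) s"
  have d: "deriv u s = ?w s" if "s \<in> {0<..<1}" for s
    unfolding u by (intro DERIV_imp_deriv weight_poly_has_deriv that)
  let ?k = "\<lambda>s. riesz_kernel \<sigma> r (x - s) * ?w s"
  have i: "integrable lborel (\<lambda>s. indicator {0<..<1} s * ?k s)"
    using R.integrable_kernel_poly[OF x, of "raise A B p"] by (simp add: integrable_restrict_space)
  have i1: "integrable lborel (\<lambda>s. indicator {0<..<x} s * ?k s)" and i2: "integrable lborel (\<lambda>s. indicator {x<..<1} s * ?k s)"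
    using x by (auto intro!: Bochner_Integration.integrable_bound[OF i] simp: indicator_def)
  have l: "r * (LINT s|(lebesgue_on {0<..<x}). deriv u s * (x - s) powr (\<sigma> - 1)) = (LINT s|lborel. indicator {0<..<x} s * ?k s)"
  proof -
    have "r * (LINT s|(lebesgue_on {0<..<x}). deriv u s * (x - s) powr (\<sigma> - 1)) = integral\<^sup>L (lebesgue_on {0<..<x}) ?k"
      using x by (subst integral_mult_right_zero[symmetric], intro Bochner_Integration.integral_cong refl)
         (auto simp: d riesz_kernel_def mult_ac)
    also have "\<dots> = integral\<^sup>L (restrict_space lborel {0<..<x}) ?k" by (rule integral_lebesgue_on_borel) auto
    finally show ?thesis by (simp add: integral_restrict_space)
  qed
  have rr: "(1 - r) * (LINT s|(lebesgue_on {x<..<1}). deriv u s * (s - x) powr (\<sigma> - 1)) = (LINT s|lborel. indicator {x<..<1} s * ?k s)"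
  proof -
    have "(1 - r) * (LINT s|(lebesgue_on {x<..<1}). deriv u s * (s - x) powr (\<sigma> - 1)) = integral\<^sup>L (lebesgue_on {x<..<1}) ?k"
      using x by (subst integral_mult_right_zero[symmetric], intro Bochner_Integration.integral_cong refl)
         (auto simp: d riesz_kernel_def mult_ac)
    also have "\<dots> = integral\<^sup>L (restrict_space lborel {x<..<1}) ?k" by (rule integral_lebesgue_on_borel) auto
    finally show ?thesis by (simp add: integral_restrict_space)
  qed
  have "L_op \<alpha> r u x = - (1 / Gamma \<sigma>) * (r * (LINT s|(lebesgue_on {0<..<x}). deriv u s * (x - s) powr (\<sigma> - 1)) +
     (1 - r) * (LINT s|(lebesgue_on {x<..<1}). deriv u s * (s - x) powr (\<sigma> - 1)))"
    unfolding L_op_def frac_int_left_def frac_int_right_def assms(2) by (simp add: divide_simps algebra_simps)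
  also have "\<dots> = - (1 / Gamma \<sigma>) * (LINT s|lborel. indicator {0<..<x} s * ?k s + indicator {x<..<1} s * ?k s)"
    unfolding l rr using i1 i2 by simp
  also have "(LINT s|lborel. indicator {0<..<x} s * ?k s + indicator {x<..<1} s * ?k s) = (LINT s|lborel. indicator {0<..<1} s * ?k s)"
  proof (rule integral_cong_AE)
    show "AE s in lborel. indicator {0<..<x} s * ?k s + indicator {x<..<1} s * ?k s = indicator {0<..<1} s * ?k s"
      using AE_lborel_singleton[of x] by eventually_elim (use x in \<open>auto simp: indicator_def\<close>)
  qed auto
  also have "\<dots> = riesz_pot \<sigma> r A B (poly (raise A B p)) x"
    by (simp add: riesz_pot_def integral_restrict_space)
  also have "\<dots> = poly (R.pot_poly (raise A B p)) x" using x by (rule R.pot_poly(1))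
  finally show ?thesis by simp
qed

section \<open>The fractional operator between two orthonormal systems\<close>

text \<open>On polynomials, the operator has the form \<open>\<Lambda>\<close>, which raises the degree by one, and its adjoint
between the two weighted spaces is \<open>U\<close>, which lowers the degree by one. Hence \<open>\<Lambda>\<close> maps the
orthonormal polynomial \<open>P n\<close> to a multiple of \<open>Q (Suc n)\<close>, and \<open>U\<close> maps \<open>Q (Suc n)\<close> to the same
multiple of \<open>P n\<close>. In the product of the two multipliers, computed from leading coefficients, the
unknown leading coefficients of \<open>P n\<close> and \<open>Q (Suc n)\<close> cancel.\<close>

lemma riesz_spectral_bound:
  assumes T: "balanced_kernel \<sigma> r A B C" and D: "balanced_kernel \<sigma> (1 - r) B A C'" and \<alpha>: "\<alpha> = 2 - \<sigma>" and AB: "A + B = - \<sigma>"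
  shows "\<exists>\<Lambda> lam c0. 0 < c0 \<and> (\<forall>n. c0 \<le> (lam n)\<^sup>2) \<and>
    (\<forall>p x. x \<in> {0<..<1} \<longrightarrow> L_op \<alpha> r (\<lambda>x. weight (A + 1) (B + 1) x * poly p x) x = poly (\<Lambda> p) x) \<and>
    (\<forall>p n. inner_w B A (poly (\<Lambda> p)) (poly (orthonormal_poly B A (Suc n))) = lam n * inner_w (A + 1) (B + 1) (poly p) (poly (orthonormal_poly (A + 1) (B + 1) n)))"
proof -
  interpret T: balanced_kernel \<sigma> r A B C by fact
  interpret D: balanced_kernel \<sigma> "1 - r" B A C' by fact
  note ab = T.AB
  have a1: "- 1 < A + 1" "- 1 < B + 1" using ab by auto
  have G: "0 < Gamma \<sigma>" using T.\<sigma> by (intro Gamma_real_pos)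
  define \<Lambda> where "\<Lambda> p = smult (- 1 / Gamma \<sigma>) (T.pot_poly (raise A B p))" for p
  define U where "U q = smult (1 / Gamma \<sigma>) (pderiv (D.pot_poly q))" for q
  define P where "P = orthonormal_poly (A + 1) (B + 1)"
  define Q where "Q = orthonormal_poly B A"
  have P: "orth_degree (A + 1) (B + 1) n (P n)" "degree (P n) \<le> n" "coeff (P n) n \<noteq> 0" for n
    using orthonormal_poly_props[OF a1, of n] by (auto simp: P_def orth_degree_def)
  have Q: "orth_degree B A n (Q n)" "degree (Q n) \<le> n" "coeff (Q n) n \<noteq> 0" for n
    using orthonormal_poly_props[OF ab(2,1), of n] by (auto simp: Q_def orth_degree_def)
  have adj: "inner_w B A (poly (\<Lambda> p)) (poly q) = inner_w (A + 1) (B + 1) (poly p) (poly (U q))" for p q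
  proof -
    have "inner_w B A (poly (\<Lambda> p)) (poly q) = - 1 / Gamma \<sigma> * inner_w B A (poly (T.pot_poly (raise A B p))) (poly q)"
      unfolding \<Lambda>_def by (subst (1 2) inner_w_commute) (rule inner_w_poly_smult)
    also have "inner_w B A (poly (T.pot_poly (raise A B p))) (poly q) = inner_w A B (poly (raise A B p)) (poly (D.pot_poly q))"
      by (rule riesz_pot_adjoint[OF T D])
    also have "\<dots> = - inner_w (A + 1) (B + 1) (poly p) (poly (pderiv (D.pot_poly q)))" by (rule inner_w_raise[OF ab])
    finally show ?thesis unfolding U_def inner_w_poly_smult by simp
  qed
  have Ldeg: "degree (\<Lambda> p) \<le> Suc n" and Lc: "coeff (\<Lambda> p) (Suc n) = (real n + \<alpha>) * T.pot_factor (Suc n) / Gamma \<sigma> * coeff p n"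
    if "degree p \<le> n" for p n
  proof -
    have "real n + A + B + 2 = real n + \<alpha>" using \<alpha> AB by simp
    then have R: "degree (raise A B p) \<le> Suc n" "coeff (raise A B p) (Suc n) = - (real n + \<alpha>) * coeff p n"
      using raise_degree_coeff[OF that, of A B] by (simp_all only:)
    show "degree (\<Lambda> p) \<le> Suc n" unfolding \<Lambda>_def using T.pot_poly(2)[OF R(1)] by (intro order.trans[OF degree_smult_le])
    show "coeff (\<Lambda> p) (Suc n) = (real n + \<alpha>) * T.pot_factor (Suc n) / Gamma \<sigma> * coeff p n"
      unfolding \<Lambda>_def using G T.pot_poly(3)[OF R(1)] R(2) by (simp add: field_simps)
  qed
  have Udeg: "degree (U q) \<le> n" and Uc: "coeff (U q) n = real (Suc n) * D.pot_factor (Suc n) / Gamma \<sigma> * coeff q (Suc n)"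
    if "degree q \<le> Suc n" for q n
  proof -
    show "degree (U q) \<le> n" unfolding U_def using D.pot_poly(2)[OF that]
      by (intro order.trans[OF degree_smult_le]) (auto simp: degree_pderiv)
    show "coeff (U q) n = real (Suc n) * D.pot_factor (Suc n) / Gamma \<sigma> * coeff q (Suc n)"
      unfolding U_def using D.pot_poly(3)[OF that] by (simp add: coeff_pderiv)
  qed
  have U0: "U q = 0" if "degree q = 0" for q
  proof -
    have "degree (D.pot_poly q) \<le> 0" using that by (intro D.pot_poly(2)) simp
    then show ?thesis by (simp add: U_def pderiv_eq_0_iff)
  qed
  define lam where "lam n = coeff (U (Q (Suc n))) n / coeff (P n) n" for n
  define mu where "mu n = coeff (\<Lambda> (P n)) (Suc n) / coeff (Q (Suc n)) (Suc n)" for n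
  have UQ: "U (Q (Suc n)) = smult (lam n) (P n)" for n
    unfolding lam_def
  proof (rule orth_degree_unique[OF a1 _ P(1) P(3)])
    show "orth_degree (A + 1) (B + 1) n (U (Q (Suc n)))"
      unfolding orth_degree_def
    proof (intro conjI allI impI)
      show "degree (U (Q (Suc n))) \<le> n" by (rule Udeg[OF Q(2)])
      fix p :: "real poly" assume p: "degree p < n"
      then have "degree (\<Lambda> p) < Suc n" using Ldeg[of p "degree p"] by simp
      then have "inner_w B A (poly (Q (Suc n))) (poly (\<Lambda> p)) = 0" using Q(1)[of "Suc n"] by (simp add: orth_degree_def)
      then show "inner_w (A + 1) (B + 1) (poly (U (Q (Suc n)))) (poly p) = 0"
        using adj[of p "Q (Suc n)"] by (simp add: inner_w_commute)
    qed
  qed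
  have LP: "\<Lambda> (P n) = smult (mu n) (Q (Suc n))" for n
    unfolding mu_def
  proof (rule orth_degree_unique[OF ab(2,1) _ Q(1) Q(3)])
    show "orth_degree B A (Suc n) (\<Lambda> (P n))"
      unfolding orth_degree_def
    proof (intro conjI allI impI)
      show "degree (\<Lambda> (P n)) \<le> Suc n" by (rule Ldeg[OF P(2)])
      fix q :: "real poly" assume q: "degree q < Suc n"
      show "inner_w B A (poly (\<Lambda> (P n))) (poly q) = 0"
      proof (cases "degree q")
        case 0
        then show ?thesis unfolding adj U0[OF 0] by (simp add: inner_w_def)
      next
        case (Suc k)
        then have "degree (U q) < n" using Udeg[of q k] q by simp
        then show ?thesis unfolding adj using P(1)[of n] by (simp add: orth_degree_def)
      qed
    qed
  qed
  have PP: "inner_w (A + 1) (B + 1) (poly (P n)) (poly (P n)) = 1" and QQ: "inner_w B A (poly (Q n)) (poly (Q n)) = 1" for n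
    using orthonormal_poly_props(3)[OF a1] orthonormal_poly_props(3)[OF ab(2,1)] by (auto simp: P_def Q_def)
  have eq: "lam n = mu n" for n
  proof -
    have "inner_w B A (poly (\<Lambda> (P n))) (poly (Q (Suc n))) = mu n"
      unfolding LP by (subst inner_w_commute) (simp add: inner_w_poly_smult QQ del: poly_smult)
    moreover have "inner_w (A + 1) (B + 1) (poly (P n)) (poly (U (Q (Suc n)))) = lam n"
      unfolding UQ by (simp add: inner_w_poly_smult PP del: poly_smult)
    ultimately show ?thesis using adj[of "P n" "Q (Suc n)"] by simp
  qed
  define c0 where "c0 = (C * (1 - \<sigma>)) * (C' * (1 - \<sigma>)) / (Gamma \<sigma>)\<^sup>2"
  have c0: "0 < c0" unfolding c0_def using T.C D.C T.\<sigma> G by (intro divide_pos_pos mult_pos_pos zero_less_power) auto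
  have "c0 \<le> (lam n)\<^sup>2" for n
  proof -
    have "lam n * mu n = ((real n + \<alpha>) * T.pot_factor (Suc n)) * (real (Suc n) * D.pot_factor (Suc n)) / (Gamma \<sigma>)\<^sup>2"
      using Lc[OF P(2), of n] Uc[OF Q(2), of n] P(3)[of n] Q(3)[of "Suc n"] G
      unfolding lam_def mu_def by (simp add: power2_eq_square)
    then have sq: "(lam n)\<^sup>2 = ((real n + \<alpha>) * T.pot_factor (Suc n)) * (real (Suc n) * D.pot_factor (Suc n)) / (Gamma \<sigma>)\<^sup>2"
      by (simp add: eq power2_eq_square)
    have pos: "0 < C * (1 - \<sigma>)" "0 < C' * (1 - \<sigma>)" using T.C D.C T.\<sigma> by auto
    have "0 < real (Suc n) * T.pot_factor (Suc n)" using T.pot_factor_lower[of n] pos by linarith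
    then have tp: "0 < T.pot_factor (Suc n)" by (simp add: zero_less_mult_iff)
    have "C * (1 - \<sigma>) \<le> real (Suc n) * T.pot_factor (Suc n)" by (rule T.pot_factor_lower)
    also have "\<dots> \<le> (real n + \<alpha>) * T.pot_factor (Suc n)" using tp \<alpha> T.\<sigma> by (intro mult_right_mono) auto
    finally have 1: "C * (1 - \<sigma>) \<le> (real n + \<alpha>) * T.pot_factor (Suc n)" .
    have "(C * (1 - \<sigma>)) * (C' * (1 - \<sigma>)) \<le> ((real n + \<alpha>) * T.pot_factor (Suc n)) * (real (Suc n) * D.pot_factor (Suc n))"
      by (rule mult_mono[OF 1 D.pot_factor_lower]) (use pos 1 in linarith)+
    then show ?thesis unfolding sq c0_def by (intro divide_right_mono) auto
  qed
  moreover have "L_op \<alpha> r (\<lambda>x. weight (A + 1) (B + 1) x * poly p x) x = poly (\<Lambda> p) x" if "x \<in> {0<..<1}" for p x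
    unfolding \<Lambda>_def by (rule L_op_weight_poly[OF T \<alpha> that refl])
  moreover have "inner_w B A (poly (\<Lambda> p)) (poly (Q (Suc n))) = lam n * inner_w (A + 1) (B + 1) (poly p) (poly (P n))" for p n
    unfolding adj UQ by (rule inner_w_poly_smult)
  ultimately show ?thesis using c0 unfolding P_def Q_def by blast
qed

section \<open>Completeness and orthogonal expansions\<close>

lemma nn_integral_L2w:
  assumes "f \<in> L2w a b"
  shows "(\<integral>\<^sup>+x. ennreal (weight a b x * (f x)\<^sup>2) \<partial>leb01) = ennreal (inner_w a b f f)"
proof -
  have "integrable leb01 (\<lambda>x. weight a b x * (f x)\<^sup>2)" using assms by (simp add: L2w_def)
  then have "(\<integral>\<^sup>+x. ennreal (weight a b x * (f x)\<^sup>2) \<partial>leb01) = ennreal ((LINT x|leb01. weight a b x * (f x)\<^sup>2))"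
    by (intro nn_integral_eq_integral) auto
  then show ?thesis by (simp add: inner_w_def power2_eq_square)
qed

text \<open>Boundedness of the terms of the series already forces geometric decay of \<open>e\<close>.\<close>

lemma summable_of_weighted_squares:
  fixes e :: "nat \<Rightarrow> real"
  assumes w: "0 < w" and fin: "(\<Sum>k. ennreal (2 ^ k * (w * (e k)\<^sup>2))) \<noteq> \<infinity>"
  shows "summable e"
proof -
  obtain S where S: "0 \<le> S" "(\<Sum>k. ennreal (2 ^ k * (w * (e k)\<^sup>2))) = ennreal S"
    using fin by (cases "\<Sum>k. ennreal (2 ^ k * (w * (e k)\<^sup>2))") auto
  have b: "\<bar>e k\<bar> \<le> sqrt (S / w) * (1 / sqrt 2) ^ k" for k
  proof -
    have "sum (\<lambda>k. ennreal (2 ^ k * (w * (e k)\<^sup>2))) {k} \<le> (\<Sum>k. ennreal (2 ^ k * (w * (e k)\<^sup>2)))"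
      by (rule sum_le_suminf) auto
    then have "2 ^ k * (w * (e k)\<^sup>2) \<le> S" using S by simp
    then have "(e k)\<^sup>2 \<le> S / w / 2 ^ k" using w by (simp add: field_simps)
    then have "sqrt ((e k)\<^sup>2) \<le> sqrt (S / w / 2 ^ k)" by (rule real_sqrt_le_mono)
    then show ?thesis unfolding real_sqrt_abs by (simp add: real_sqrt_divide real_sqrt_power real_sqrt_mult power_divide)
  qed
  have "summable (\<lambda>k. sqrt (S / w) * (1 / sqrt 2) ^ k)"
    by (intro summable_mult summable_geometric) simp
  then show ?thesis by (rule summable_comparison_test') (use b in simp)
qed

text \<open>The argument of Riesz and Fischer: a subsequence with square distances below \<open>(1 / 4) ^ k\<close> converges almost
everywhere, and Fatou's lemma transfers the Cauchy estimates to the limit.\<close>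

lemma L2w_complete:
  assumes X: "\<And>n. X n \<in> L2w a b"
    and cauchy: "\<And>\<epsilon>. 0 < \<epsilon> \<Longrightarrow> \<exists>N. \<forall>m\<ge>N. \<forall>n\<ge>N. dist2_w a b (X m) (X n) < \<epsilon>"
  shows "\<exists>h. converges_L2w a b X h"
proof -
  let ?d = "\<lambda>m n. dist2_w a b (X m) (X n)"
  have [measurable]: "X n \<in> borel_measurable leb01" for n using X by (rule L2w_measurable)
  have "\<exists>N. \<forall>m\<ge>N. \<forall>n\<ge>N. ?d m n < (1 / 4) ^ k" for k by (rule cauchy) simp
  then obtain f where f: "\<And>k m n. f k \<le> m \<Longrightarrow> f k \<le> n \<Longrightarrow> ?d m n < (1 / 4) ^ k" by metis
  \<comment> \<open>Summing the thresholds makes \<open>N (Suc k)\<close> lie beyond the threshold for \<open>k\<close> as well.\<close>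
  define N where "N k = (\<Sum>i\<le>k. f i) + k" for k :: nat
  have N: "f k \<le> N k" "f k \<le> N (Suc k)" "k \<le> N k" for k
  proof -
    have "f k \<le> (\<Sum>i\<le>k. f i)" by (rule member_le_sum) auto
    then show "f k \<le> N k" "f k \<le> N (Suc k)" "k \<le> N k" by (auto simp: N_def)
  qed
  define e where "e k x = X (N (Suc k)) x - X (N k) x" for k x
  have em [measurable]: "e k \<in> borel_measurable leb01" for k unfolding e_def by measurable
  have "(\<integral>\<^sup>+x. (\<Sum>k. ennreal (2 ^ k * (weight a b x * (e k x)\<^sup>2))) \<partial>leb01) =
        (\<Sum>k. \<integral>\<^sup>+x. ennreal (2 ^ k * (weight a b x * (e k x)\<^sup>2)) \<partial>leb01)"
    by (rule nn_integral_suminf) measurable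
  also have "\<dots> \<le> (\<Sum>k. ennreal ((1 / 2) ^ k))"
  proof (intro suminf_le allI)
    fix k
    have "(\<integral>\<^sup>+x. ennreal (2 ^ k * (weight a b x * (e k x)\<^sup>2)) \<partial>leb01) =
          ennreal (2 ^ k) * (\<integral>\<^sup>+x. ennreal (weight a b x * (e k x)\<^sup>2) \<partial>leb01)"
      by (simp add: ennreal_mult' nn_integral_cmult)
    also have "(\<integral>\<^sup>+x. ennreal (weight a b x * (e k x)\<^sup>2) \<partial>leb01) = ennreal (?d (N (Suc k)) (N k))"
      unfolding e_def by (rule nn_integral_L2w) (intro L2w_diff X)
    also have "ennreal (2 ^ k) * \<dots> \<le> ennreal (2 ^ k) * ennreal ((1 / 4) ^ k)"
      using f[OF N(2) N(1), of k] by (intro mult_left_mono ennreal_leI) auto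
    also have "\<dots> = ennreal ((1 / 2) ^ k)"
      by (simp add: ennreal_mult'[symmetric] power_mult_distrib[symmetric])
    finally show "(\<integral>\<^sup>+x. ennreal (2 ^ k * (weight a b x * (e k x)\<^sup>2)) \<partial>leb01) \<le> ennreal ((1 / 2) ^ k)" .
  qed auto
  also have "\<dots> = ennreal 2"
    using geometric_sums[of "1 / 2 :: real"] by (intro suminf_ennreal_eq) auto
  finally have "(\<integral>\<^sup>+x. (\<Sum>k. ennreal (2 ^ k * (weight a b x * (e k x)\<^sup>2))) \<partial>leb01) \<noteq> \<infinity>"
    by (auto simp: top_unique)
  then have "AE x in leb01. (\<Sum>k. ennreal (2 ^ k * (weight a b x * (e k x)\<^sup>2))) \<noteq> \<infinity>"
    by (intro nn_integral_PInf_AE) measurable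
  then have conv: "AE x in leb01. convergent (\<lambda>k. X (N k) x)"
  proof (rule AE_mp, intro AE_I2 impI)
    fix x assume x: "x \<in> space leb01" and "(\<Sum>k. ennreal (2 ^ k * (weight a b x * (e k x)\<^sup>2))) \<noteq> \<infinity>"
    moreover have "0 < weight a b x" using x by (auto simp: weight_def)
    ultimately have "summable (\<lambda>k. e k x)" by (intro summable_of_weighted_squares)
    then have "convergent (\<lambda>n. \<Sum>k<n. e k x)" by (simp add: summable_iff_convergent)
    moreover have "(\<Sum>k<n. e k x) = X (N n) x - X (N 0) x" for n
      unfolding e_def by (rule sum_lessThan_telescope)
    ultimately have "convergent (\<lambda>n. X (N n) x - X (N 0) x)" by simp
    then have "convergent (\<lambda>n. (X (N n) x - X (N 0) x) + X (N 0) x)"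
      by (intro convergent_add convergent_const)
    then show "convergent (\<lambda>k. X (N k) x)" by simp
  qed
  define h where "h x = lim (\<lambda>k. X (N k) x)" for x
  have hm [measurable]: "h \<in> borel_measurable leb01" unfolding h_def by measurable
  have lim: "AE x in leb01. (\<lambda>k. X (N k) x) \<longlonglongrightarrow> h x"
    using conv by eventually_elim (simp add: h_def convergent_LIMSEQ_iff)
  have bnd: "(\<integral>\<^sup>+x. ennreal (weight a b x * (X n x - h x)\<^sup>2) \<partial>leb01) \<le> ennreal \<epsilon>"
    if M: "\<And>m n. M \<le> m \<Longrightarrow> M \<le> n \<Longrightarrow> ?d m n < \<epsilon>" and n: "M \<le> n" for n M \<epsilon>
  proof -
    have "(\<integral>\<^sup>+x. ennreal (weight a b x * (X n x - h x)\<^sup>2) \<partial>leb01) =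
          (\<integral>\<^sup>+x. liminf (\<lambda>k. ennreal (weight a b x * (X n x - X (N k) x)\<^sup>2)) \<partial>leb01)"
      using lim
    proof (intro nn_integral_cong_AE, eventually_elim)
      fix x assume "(\<lambda>k. X (N k) x) \<longlonglongrightarrow> h x"
      then have "(\<lambda>k. ennreal (weight a b x * (X n x - X (N k) x)\<^sup>2)) \<longlonglongrightarrow> ennreal (weight a b x * (X n x - h x)\<^sup>2)"
        by (intro tendsto_intros)
      then show "ennreal (weight a b x * (X n x - h x)\<^sup>2) = liminf (\<lambda>k. ennreal (weight a b x * (X n x - X (N k) x)\<^sup>2))"
        by (intro lim_imp_Liminf[symmetric]) auto
    qed
    also have "\<dots> \<le> liminf (\<lambda>k. \<integral>\<^sup>+x. ennreal (weight a b x * (X n x - X (N k) x)\<^sup>2) \<partial>leb01)"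
      by (rule nn_integral_liminf) measurable
    also have "\<dots> = liminf (\<lambda>k. ennreal (?d n (N k)))"
      by (intro arg_cong[where f = liminf] ext nn_integral_L2w L2w_diff X)
    also have "\<dots> \<le> ennreal \<epsilon>"
    proof (rule Liminf_le)
      show "\<forall>\<^sub>F k in sequentially. ennreal (?d n (N k)) \<le> ennreal \<epsilon>"
        using eventually_ge_at_top[of M]
      proof eventually_elim
        case (elim k)
        then have "M \<le> N k" using N(3)[of k] by simp
        then show ?case using M[OF n] by (intro ennreal_leI) (simp add: less_imp_le)
      qed
    qed simp
    finally show ?thesis .
  qed
  have dL2: "(\<lambda>x. X n x - h x) \<in> L2w a b" if "(\<integral>\<^sup>+x. ennreal (weight a b x * (X n x - h x)\<^sup>2) \<partial>leb01) \<le> ennreal \<epsilon>" for n \<epsilon>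
  proof -
    have "(\<integral>\<^sup>+x. ennreal (weight a b x * (X n x - h x)\<^sup>2) \<partial>leb01) < \<infinity>"
      using that by (rule le_less_trans) simp
    then show ?thesis unfolding L2w_def by (auto intro!: integrableI_bounded)
  qed
  obtain M1 where M1: "\<And>m n. M1 \<le> m \<Longrightarrow> M1 \<le> n \<Longrightarrow> ?d m n < 1" using cauchy[of 1] by auto
  have "(\<lambda>x. X M1 x - h x) \<in> L2w a b" using bnd[OF M1, of M1] by (intro dL2[of _ 1]) auto
  from L2w_diff[OF X this, of M1] have "(\<lambda>x. X M1 x - (X M1 x - h x)) \<in> L2w a b" .
  moreover have "(\<lambda>x. X M1 x - (X M1 x - h x)) = h" by auto
  ultimately have h: "h \<in> L2w a b" by (simp only:)
  have "(\<lambda>n. norm_L2w a b (\<lambda>x. X n x - h x)) \<longlonglongrightarrow> 0"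
  proof (rule LIMSEQ_I)
    fix e :: real assume e: "0 < e"
    then obtain M where M: "\<And>m n. M \<le> m \<Longrightarrow> M \<le> n \<Longrightarrow> ?d m n < (e / 2)\<^sup>2" using cauchy[of "(e / 2)\<^sup>2"] by auto
    have "norm (norm_L2w a b (\<lambda>x. X n x - h x) - 0) < e" if "M \<le> n" for n
    proof -
      have "ennreal (dist2_w a b (X n) h) \<le> ennreal ((e / 2)\<^sup>2)"
        using bnd[OF M that] nn_integral_L2w[OF L2w_diff[OF X h], of n] by simp
      then have "dist2_w a b (X n) h \<le> (e / 2)\<^sup>2" by simp
      then have "norm_L2w a b (\<lambda>x. X n x - h x) \<le> sqrt ((e / 2)\<^sup>2)"
        unfolding norm_L2w_eq by (rule real_sqrt_le_mono)
      moreover have "0 \<le> norm_L2w a b (\<lambda>x. X n x - h x)" unfolding norm_L2w_eq by (simp add: inner_w_nonneg)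
      ultimately show ?thesis using e by simp
    qed
    then show "\<exists>no. \<forall>n\<ge>no. norm (norm_L2w a b (\<lambda>x. X n x - h x) - 0) < e" by blast
  qed
  then show ?thesis using X h unfolding converges_L2w_def by blast
qed


lemma inner_w_poly_sum:
  assumes "- 1 < a" "- 1 < b" "f \<in> L2w a b" "finite I"
  shows "inner_w a b f (poly (\<Sum>n\<in>I. smult (c n) (e n))) = (\<Sum>n\<in>I. c n * inner_w a b f (poly (e n)))"
  using assms(4)
proof (induction I rule: finite_induct)
  case empty
  show ?case by (simp add: inner_w_def)
next
  case (insert n I)
  then show ?case using assms(1-3) by (simp add: inner_w_poly_add inner_w_poly_smult del: poly_add poly_smult)
qed

lemma inner_w_orthogonal_sum:
  assumes ab: "- 1 < a" "- 1 < b" and I: "finite I"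
    and e: "\<And>m n. inner_w a b (poly (e m)) (poly (e n)) = (if m = n then G n else 0)"
  shows "inner_w a b (poly (\<Sum>n\<in>I. smult (c n) (e n))) (poly (\<Sum>n\<in>I. smult (c n) (e n))) = (\<Sum>n\<in>I. (c n)\<^sup>2 * G n)"
proof -
  let ?s = "\<Sum>n\<in>I. smult (c n) (e n)"
  have "inner_w a b (poly ?s) (poly (e m)) = c m * G m" if "m \<in> I" for m
  proof -
    have "inner_w a b (poly ?s) (poly (e m)) = inner_w a b (poly (e m)) (poly ?s)" by (rule inner_w_commute)
    also have "\<dots> = (\<Sum>n\<in>I. c n * (if m = n then G n else 0))"
      using inner_w_poly_sum[OF ab L2w_poly[OF ab] I, of "e m" c e] by (simp only: e)
    also have "\<dots> = c m * G m" using I that by (simp add: if_distrib cong: if_cong)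
    finally show ?thesis .
  qed
  then show ?thesis
    using inner_w_poly_sum[OF ab L2w_poly[OF ab] I, of ?s c e] by (simp add: power2_eq_square mult.assoc)
qed

lemma Bessel_inequality:
  assumes ab: "- 1 < a" "- 1 < b" and h: "h \<in> L2w a b" and I: "finite I"
    and e: "\<And>m n. inner_w a b (poly (e m)) (poly (e n)) = (if m = n then G n else 0)"
    and c: "\<And>n. inner_w a b h (poly (e n)) = G n * c n"
  shows "(\<Sum>n\<in>I. (c n)\<^sup>2 * G n) \<le> inner_w a b h h"
proof -
  let ?s = "\<Sum>n\<in>I. smult (- c n) (e n)"
  have "0 \<le> inner_w a b (\<lambda>x. h x + poly ?s x) (\<lambda>x. h x + poly ?s x)" by (rule inner_w_nonneg)
  also have "\<dots> = inner_w a b h h + 2 * inner_w a b h (poly ?s) + inner_w a b (poly ?s) (poly ?s)"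
    by (intro inner_w_add_add h L2w_poly ab)
  also have "inner_w a b h (poly ?s) = (\<Sum>n\<in>I. - c n * (G n * c n))"
    using inner_w_poly_sum[OF ab h I, of "\<lambda>n. - c n" e] by (simp only: c)
  also have "\<dots> = - (\<Sum>n\<in>I. (c n)\<^sup>2 * G n)" by (simp add: sum_negf power2_eq_square mult_ac)
  also have "inner_w a b (poly ?s) (poly ?s) = (\<Sum>n\<in>I. (- c n)\<^sup>2 * G n)" by (rule inner_w_orthogonal_sum[OF ab I e])
  finally show ?thesis by simp
qed

lemma inner_w_orthonormal_poly: "- 1 < a \<Longrightarrow> - 1 < b \<Longrightarrow> inner_w a b (poly (orthonormal_poly a b m)) (poly (orthonormal_poly a b n)) = (if m = n then 1 else 0)"
  using orthonormal_poly_props(3)[of a b n] orthonormal_poly_orthogonal[of a b n m] by auto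

definition partial_sum :: "real \<Rightarrow> real \<Rightarrow> (real \<Rightarrow> real) \<Rightarrow> nat \<Rightarrow> real poly" where
  "partial_sum a b v M = (\<Sum>n<M. smult (coeff_w a b v n) (orthonormal_poly a b n))"

text \<open>The error of the partial sum is orthogonal to all polynomials of degree below \<open>M\<close>, so Pythagoras
applies to any competitor \<open>q\<close>.\<close>

lemma partial_sum_best_approx:
  assumes ab: "- 1 < a" "- 1 < b" and v: "v \<in> L2w a b" and q: "degree q < M"
  shows "norm_L2w a b (\<lambda>x. poly (partial_sum a b v M) x - v x) \<le> norm_L2w a b (\<lambda>x. poly q x - v x)"
proof -
  let ?S = "partial_sum a b v M" and ?P = "orthonormal_poly a b"
  obtain N where N: "M = Suc N" using q by (cases M) auto
  then obtain c where c: "q = (\<Sum>n<M. smult (c n) (?P n))"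
    using poly_orthonormal_expansion[OF ab, of q N] q by (auto simp: lessThan_Suc_atMost)
  define d where "d n = c n - inner_w a b v (poly (?P n))" for n
  have qS: "q - ?S = (\<Sum>n<M. smult (d n) (?P n))"
    by (simp add: c partial_sum_def d_def smult_diff_left sum_subtractf)
  have w: "(\<lambda>x. poly ?S x - v x) \<in> L2w a b" by (intro L2w_diff L2w_poly ab v)
  have orth: "inner_w a b (\<lambda>x. poly ?S x - v x) (poly (?P m)) = 0" if "m < M" for m
  proof -
    have "inner_w a b (poly ?S) (poly (?P m)) = inner_w a b v (poly (?P m))"
    proof -
      have "inner_w a b (poly ?S) (poly (?P m)) = inner_w a b (poly (?P m)) (poly ?S)" by (rule inner_w_commute)
      also have "\<dots> = (\<Sum>n<M. inner_w a b v (poly (?P n)) * (if m = n then 1 else 0))"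
        unfolding partial_sum_def using inner_w_poly_sum[OF ab L2w_poly[OF ab] finite_lessThan[of M], of "?P m"] by (simp only: inner_w_orthonormal_poly[OF ab])
      also have "\<dots> = inner_w a b v (poly (?P m))" using that by (simp add: if_distrib cong: if_cong)
      finally show ?thesis .
    qed
    then show ?thesis by (simp add: inner_w_diff_left L2w_poly ab v)
  qed
  have "inner_w a b (\<lambda>x. (poly ?S x - v x) + poly (q - ?S) x) (\<lambda>x. (poly ?S x - v x) + poly (q - ?S) x) =
     dist2_w a b (poly ?S) v + 2 * inner_w a b (\<lambda>x. poly ?S x - v x) (poly (q - ?S)) +
     inner_w a b (poly (q - ?S)) (poly (q - ?S))"
    by (intro inner_w_add_add w L2w_poly ab)
  moreover have "inner_w a b (\<lambda>x. poly ?S x - v x) (poly (q - ?S)) = 0"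
    unfolding qS inner_w_poly_sum[OF ab w finite_lessThan] using orth by simp
  moreover have "0 \<le> inner_w a b (poly (q - ?S)) (poly (q - ?S))" by (rule inner_w_nonneg)
  ultimately have "dist2_w a b (poly ?S) v \<le> dist2_w a b (poly q) v"
    by simp
  then show ?thesis unfolding norm_L2w_eq by (rule real_sqrt_le_mono)
qed

text \<open>Compare the partial sums, from the degree of \<open>p N\<close> on, with the competitor \<open>p N\<close>.\<close>

lemma partial_sum_converges:
  assumes ab: "- 1 < a" "- 1 < b" and p: "converges_L2w a b (\<lambda>N. poly (p N)) v"
  shows "converges_L2w a b (\<lambda>M. poly (partial_sum a b v M)) v"
proof -
  have v: "v \<in> L2w a b" and l: "(\<lambda>N. norm_L2w a b (\<lambda>x. poly (p N) x - v x)) \<longlonglongrightarrow> 0"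
    using p by (auto simp: converges_L2w_def)
  have "(\<lambda>M. norm_L2w a b (\<lambda>x. poly (partial_sum a b v M) x - v x)) \<longlonglongrightarrow> 0"
  proof (rule LIMSEQ_I)
    fix e :: real assume "0 < e"
    then obtain N where N: "norm (norm_L2w a b (\<lambda>x. poly (p N) x - v x) - 0) < e"
      using LIMSEQ_D[OF l] by blast
    have "norm (norm_L2w a b (\<lambda>x. poly (partial_sum a b v M) x - v x) - 0) < e" if "Suc (degree (p N)) \<le> M" for M
      using N partial_sum_best_approx[OF ab v, of "p N" M] that by (simp add: norm_L2w_nonneg)
    then show "\<exists>no. \<forall>M\<ge>no. norm (norm_L2w a b (\<lambda>x. poly (partial_sum a b v M) x - v x) - 0) < e" by blast
  qed
  then show ?thesis using v by (simp add: converges_L2w_def L2w_poly ab)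
qed

section \<open>Smooth functions and cutoffs\<close>

definition smooth_on :: "real set \<Rightarrow> (real \<Rightarrow> real) \<Rightarrow> bool" where
  "smooth_on S f \<longleftrightarrow> (\<forall>k. \<forall>x\<in>S. (deriv ^^ k) f field_differentiable at x)"

lemma smooth_onD: "smooth_on S f \<Longrightarrow> x \<in> S \<Longrightarrow> ((deriv ^^ k) f has_real_derivative (deriv ^^ Suc k) f x) (at x)"
  unfolding smooth_on_def using DERIV_deriv_iff_field_differentiable by fastforce

lemma higher_deriv_cong_open:
  fixes f g :: "real \<Rightarrow> real"
  assumes "open S" "x \<in> S" "\<And>y. y \<in> S \<Longrightarrow> f y = g y"
  shows "(deriv ^^ k) f x = (deriv ^^ k) g x"
  using assms by (intro higher_deriv_cong_ev) (auto simp: eventually_nhds)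

lemma field_differentiable_cong_open:
  fixes f g :: "real \<Rightarrow> real"
  assumes "open S" "x \<in> S" "\<And>y. y \<in> S \<Longrightarrow> f y = g y" "g field_differentiable at x"
  shows "f field_differentiable at x"
proof -
  from assms(4) obtain D where "(g has_field_derivative D) (at x)" by (auto simp: field_differentiable_def)
  moreover have "\<forall>\<^sub>F y in nhds x. f y = g y" using assms by (auto simp: eventually_nhds)
  ultimately have "(f has_field_derivative D) (at x)" by (subst DERIV_cong_ev) auto
  then show ?thesis by (auto simp: field_differentiable_def)
qed

lemma smooth_on_cong:
  assumes "open S" "\<And>y. y \<in> S \<Longrightarrow> f y = g y" "smooth_on S g"
  shows "smooth_on S f"
  unfolding smooth_on_def
proof (intro allI ballI)
  fix k x assume x: "x \<in> S"
  show "(deriv ^^ k) f field_differentiable at x"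
  proof (rule field_differentiable_cong_open[OF assms(1) x])
    show "(deriv ^^ k) f y = (deriv ^^ k) g y" if "y \<in> S" for y
      using assms that by (intro higher_deriv_cong_open)
    show "(deriv ^^ k) g field_differentiable at x" using assms(3) x by (simp add: smooth_on_def)
  qed
qed

text \<open>A family that starts with \<open>f\<close> and is closed under differentiation consists of the derivatives of \<open>f\<close>.
The explicit functions below are shown to be smooth by exhibiting such a family.\<close>

lemma higher_derivs_eqI:
  fixes F :: "nat \<Rightarrow> real \<Rightarrow> real"
  assumes "open S" "\<And>x. x \<in> S \<Longrightarrow> f x = F 0 x"
    and "\<And>k x. x \<in> S \<Longrightarrow> (F k has_real_derivative F (Suc k) x) (at x)"
  shows "smooth_on S f" "\<And>k x. x \<in> S \<Longrightarrow> (deriv ^^ k) f x = F k x"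
proof -
  show 1: "(deriv ^^ k) f x = F k x" if "x \<in> S" for k x
    using that
  proof (induction k arbitrary: x)
    case (Suc k)
    have "deriv ((deriv ^^ k) f) x = deriv (F k) x"
      using Suc higher_deriv_cong_open[OF assms(1) Suc.prems, of "(deriv ^^ k) f" "F k" 1] by simp
    then show ?case using assms(3)[OF Suc.prems] by (simp add: DERIV_imp_deriv)
  qed (use assms in simp)
  show "smooth_on S f"
    unfolding smooth_on_def
  proof (intro allI ballI)
    fix k x assume x: "x \<in> S"
    show "(deriv ^^ k) f field_differentiable at x"
    proof (rule field_differentiable_cong_open[OF assms(1) x])
      show "(deriv ^^ k) f y = F k y" if "y \<in> S" for y using that by (rule 1)
      show "F k field_differentiable at x" using assms(3)[OF x] unfolding field_differentiable_def by blast
    qed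
  qed
qed

lemma binomial_Leibniz_sum:
  fixes a b :: "nat \<Rightarrow> real"
  shows "(\<Sum>i\<le>n. real (n choose i) * (a (Suc i) * b (n - i) + a i * b (Suc (n - i)))) =
         (\<Sum>i\<le>Suc n. real (Suc n choose i) * (a i * b (Suc n - i)))"
proof -
  have "(\<Sum>i\<le>Suc n. real (Suc n choose i) * (a i * b (Suc n - i))) =
        a 0 * b (Suc n) + (\<Sum>i\<le>n. real (Suc n choose Suc i) * (a (Suc i) * b (n - i)))"
    by (subst sum.atMost_Suc_shift) simp
  also have "(\<Sum>i\<le>n. real (Suc n choose Suc i) * (a (Suc i) * b (n - i))) =
        (\<Sum>i\<le>n. real (n choose i) * (a (Suc i) * b (n - i))) + (\<Sum>i\<le>n. real (n choose Suc i) * (a (Suc i) * b (n - i)))"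
    by (simp add: sum.distrib[symmetric] algebra_simps)
  also have "a 0 * b (Suc n) + ((\<Sum>i\<le>n. real (n choose i) * (a (Suc i) * b (n - i))) + (\<Sum>i\<le>n. real (n choose Suc i) * (a (Suc i) * b (n - i)))) =
        (\<Sum>i\<le>n. real (n choose i) * (a (Suc i) * b (n - i))) + (\<Sum>i\<le>Suc n. real (n choose i) * (a i * b (Suc n - i)))"
  proof -
    have "(\<Sum>i\<le>Suc n. real (n choose i) * (a i * b (Suc n - i))) =
       a 0 * b (Suc n) + (\<Sum>i\<le>n. real (n choose Suc i) * (a (Suc i) * b (n - i)))"
      by (subst sum.atMost_Suc_shift) simp
    then show ?thesis by simp
  qed
  also have "(\<Sum>i\<le>Suc n. real (n choose i) * (a i * b (Suc n - i))) = (\<Sum>i\<le>n. real (n choose i) * (a i * b (Suc (n - i))))"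
    by (simp add: Suc_diff_le)
  finally show ?thesis by (simp add: sum.distrib[symmetric] distrib_left)
qed

text \<open>The Leibniz sums form a family that is closed under differentiation.\<close>

lemma
  assumes S: "open S" and f: "smooth_on S f" and g: "smooth_on S g"
  shows smooth_on_mult: "smooth_on S (\<lambda>x. f x * g x)"
    and higher_deriv_mult_real: "\<And>k x. x \<in> S \<Longrightarrow> (deriv ^^ k) (\<lambda>x. f x * g x) x =
      (\<Sum>i\<le>k. real (k choose i) * ((deriv ^^ i) f x * (deriv ^^ (k - i)) g x))"
proof -
  let ?F = "\<lambda>k x. \<Sum>i\<le>k. real (k choose i) * ((deriv ^^ i) f x * (deriv ^^ (k - i)) g x)"
  have d: "(?F k has_real_derivative ?F (Suc k) x) (at x)" if x: "x \<in> S" for k x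
  proof -
    have "(?F k has_real_derivative (\<Sum>i\<le>k. real (k choose i) *
        ((deriv ^^ Suc i) f x * (deriv ^^ (k - i)) g x + (deriv ^^ i) f x * (deriv ^^ Suc (k - i)) g x))) (at x)"
    proof (intro DERIV_sum)
      fix i
      have "((\<lambda>x. (deriv ^^ i) f x * (deriv ^^ (k - i)) g x) has_real_derivative
         (deriv ^^ Suc i) f x * (deriv ^^ (k - i)) g x + (deriv ^^ Suc (k - i)) g x * (deriv ^^ i) f x) (at x)"
        by (intro DERIV_mult smooth_onD[OF f x] smooth_onD[OF g x])
      then show "((\<lambda>x. real (k choose i) * ((deriv ^^ i) f x * (deriv ^^ (k - i)) g x)) has_real_derivative
        real (k choose i) * ((deriv ^^ Suc i) f x * (deriv ^^ (k - i)) g x + (deriv ^^ i) f x * (deriv ^^ Suc (k - i)) g x)) (at x)"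
        by (intro DERIV_cmult) (simp only: mult.commute[of "(deriv ^^ i) f x"])
    qed
    then show ?thesis
      unfolding binomial_Leibniz_sum[of k "\<lambda>i. (deriv ^^ i) f x" "\<lambda>i. (deriv ^^ i) g x"] .
  qed
  have 0: "f x * g x = ?F 0 x" for x by simp
  show "smooth_on S (\<lambda>x. f x * g x)" by (rule higher_derivs_eqI(1)[where F = ?F, OF S 0 d])
  show "(deriv ^^ k) (\<lambda>x. f x * g x) x = ?F k x" if "x \<in> S" for k x
    by (rule higher_derivs_eqI(2)[where F = ?F, OF S 0 d that])
qed

lemma
  assumes f: "smooth_on UNIV f"
  shows smooth_on_affine: "smooth_on S (\<lambda>x. f (c * x + d))"
    and higher_deriv_affine: "\<And>k. (deriv ^^ k) (\<lambda>x. f (c * x + d)) x = c ^ k * (deriv ^^ k) f (c * x + d)"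
proof -
  let ?F = "\<lambda>k x. c ^ k * (deriv ^^ k) f (c * x + d)"
  have d: "(?F k has_real_derivative ?F (Suc k) x) (at x)" for k x
  proof -
    have "((\<lambda>x. (deriv ^^ k) f (c * x + d)) has_real_derivative (deriv ^^ Suc k) f (c * x + d) * c) (at x)"
      by (rule DERIV_chain2[OF smooth_onD[OF f]]) (auto intro!: derivative_eq_intros)
    from DERIV_cmult[OF this, of "c ^ k"] show ?thesis by (simp add: mult_ac)
  qed
  have 0: "f (c * x + d) = ?F 0 x" for x by simp
  have "smooth_on UNIV (\<lambda>x. f (c * x + d))" by (rule higher_derivs_eqI(1)[where F = ?F, OF open_UNIV 0 d])
  then show "smooth_on S (\<lambda>x. f (c * x + d))" by (simp add: smooth_on_def)
  show "(deriv ^^ k) (\<lambda>x. f (c * x + d)) x = ?F k x" for k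
    by (rule higher_derivs_eqI(2)[where F = ?F, OF open_UNIV 0 d]) simp
qed

lemma
  shows smooth_on_const: "smooth_on S (\<lambda>_. c)"
    and higher_deriv_const_real: "(deriv ^^ k) (\<lambda>_. c :: real) (x :: real) = (if k = 0 then c else 0)"
proof -
  let ?F = "\<lambda>k (x::real). if k = 0 then c else (0::real)"
  have d: "(?F k has_real_derivative ?F (Suc k) x) (at x)" for k x by auto
  have 0: "c = ?F 0 x" for x by simp
  have "smooth_on UNIV (\<lambda>_. c)" by (rule higher_derivs_eqI(1)[where F = ?F, OF open_UNIV 0 d])
  then show "smooth_on S (\<lambda>_. c)" by (simp add: smooth_on_def)
  show "(deriv ^^ k) (\<lambda>_. c) x = ?F k x"
    by (rule higher_derivs_eqI(2)[where F = ?F, OF open_UNIV 0 d]) simp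
qed

text \<open>Each derivative of a weighted polynomial lowers both exponents of the weight by one and applies
\<open>raise\<close> to the polynomial.\<close>

lemma
  shows smooth_on_weight_poly: "smooth_on {0<..<1} (\<lambda>x. weight c d x * poly q x)"
    and higher_deriv_weight_poly: "\<And>x. x \<in> {0<..<1} \<Longrightarrow> (deriv ^^ k) (\<lambda>x. weight c d x * poly q x) x =
      weight (c - real k) (d - real k) x * poly (raise_iter k (c - real k) (d - real k) q) x"
proof -
  let ?F = "\<lambda>k x. weight (c - real k) (d - real k) x * poly (raise_iter k (c - real k) (d - real k) q) x"
  have d: "(?F k has_real_derivative ?F (Suc k) x) (at x)" if "x \<in> {0<..<1}" for k x
    using weight_poly_has_deriv[OF that, of "c - real (Suc k)" "d - real (Suc k)" "raise_iter k (c - real k) (d - real k) q"]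
    by (simp add: algebra_simps)
  have 0: "weight c d x * poly q x = ?F 0 x" for x by simp
  have S: "open {0<..<1::real}" by simp
  show "smooth_on {0<..<1} (\<lambda>x. weight c d x * poly q x)"
    by (rule higher_derivs_eqI(1)[where F = ?F, OF S 0 d])
  show "(deriv ^^ k) (\<lambda>x. weight c d x * poly q x) x = ?F k x" if "x \<in> {0<..<1}" for x
    by (rule higher_derivs_eqI(2)[where F = ?F, OF S 0 d that])
qed

lemma continuous_on_Icc_bounded:
  fixes f :: "real \<Rightarrow> real"
  assumes "continuous_on {c..d} f"
  shows "\<exists>M. \<forall>x\<in>{c..d}. \<bar>f x\<bar> \<le> M"
proof -
  have "bounded (f ` {c..d})" using assms by (intro compact_imp_bounded compact_continuous_image) auto
  then show ?thesis by (auto simp: bounded_iff)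
qed

text \<open>The functions obtained from the flat function \<open>exp (- 1 / x)\<close> by differentiation, with a polynomial
in \<open>1 / x\<close> as factor; this class is closed under differentiation, including at the origin.\<close>

definition flat_exp :: "real poly \<Rightarrow> real \<Rightarrow> real" where
  "flat_exp p x = (if 0 < x then poly p (1 / x) * exp (- (1 / x)) else 0)"

lemma poly_times_exp_minus_tendsto_0: "((\<lambda>t. poly p t * exp (- t)) \<longlongrightarrow> (0::real)) at_top"
proof -
  have "((\<lambda>t. \<Sum>i\<le>degree p. coeff p i * (t ^ i / exp t)) \<longlongrightarrow> (\<Sum>i\<le>degree p. coeff p i * 0)) at_top"
    by (intro tendsto_intros tendsto_power_div_exp_0)
  then show ?thesis by (simp add: poly_altdef sum_distrib_right exp_minus divide_inverse mult.assoc)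
qed

lemma flat_exp_has_derivative:
  "(flat_exp p has_real_derivative flat_exp ([:0, 0, 1:] * (p - pderiv p)) x) (at x)"
proof -
  consider "x > 0" | "x < 0" | "x = 0" by linarith
  then show ?thesis
  proof cases
    case 1
    have i: "((\<lambda>x. 1 / x) has_real_derivative - (1 / x\<^sup>2)) (at x)"
      using 1 by (auto intro!: derivative_eq_intros simp: power2_eq_square)
    have "((\<lambda>x. poly p (1 / x) * exp (- (1 / x))) has_real_derivative
       poly (pderiv p) (1 / x) * (- (1 / x\<^sup>2)) * exp (- (1 / x)) + exp (- (1 / x)) * (- (- (1 / x\<^sup>2))) * poly p (1 / x)) (at x)"
      by (intro DERIV_mult DERIV_chain2[OF poly_DERIV i] DERIV_chain2[OF DERIV_exp] DERIV_minus i)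
    also have "poly (pderiv p) (1 / x) * (- (1 / x\<^sup>2)) * exp (- (1 / x)) + exp (- (1 / x)) * (- (- (1 / x\<^sup>2))) * poly p (1 / x) =
       flat_exp ([:0, 0, 1:] * (p - pderiv p)) x"
      using 1 by (simp add: flat_exp_def algebra_simps power2_eq_square)
    finally have *: "((\<lambda>x. poly p (1 / x) * exp (- (1 / x))) has_real_derivative flat_exp ([:0, 0, 1:] * (p - pderiv p)) x) (at x)" .
    have "\<forall>\<^sub>F y in nhds x. flat_exp p y = poly p (1 / y) * exp (- (1 / y))"
      using eventually_nhds_in_open[of "{0<..}" x] 1 by (auto elim!: eventually_mono simp: flat_exp_def)
    then show ?thesis using * by (subst DERIV_cong_ev) auto
  next
    case 2
    have "\<forall>\<^sub>F y in nhds x. flat_exp p y = 0"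
      using eventually_nhds_in_open[of "{..<0}" x] 2 by (auto elim!: eventually_mono simp: flat_exp_def)
    moreover have "flat_exp ([:0, 0, 1:] * (p - pderiv p)) x = 0" using 2 by (simp add: flat_exp_def)
    ultimately show ?thesis by (subst DERIV_cong_ev[of x x _ "\<lambda>_. 0"]) auto
  next
    case 3
    have "((\<lambda>t. poly ([:0, 1:] * p) t * exp (- t)) \<longlongrightarrow> 0) at_top" by (rule poly_times_exp_minus_tendsto_0)
    moreover have "filterlim (\<lambda>h::real. 1 / h) at_top (at_right 0)"
      using filterlim_inverse_at_top_right by (simp add: inverse_eq_divide)
    ultimately have "((\<lambda>h. poly ([:0, 1:] * p) (1 / h) * exp (- (1 / h))) \<longlongrightarrow> 0) (at_right 0)"
      by (rule filterlim_compose)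
    then have r: "((\<lambda>h. flat_exp p h / h) \<longlongrightarrow> 0) (at_right 0)"
      by (rule Lim_transform_eventually) (auto simp: eventually_at_right_field flat_exp_def intro!: exI[of _ 1])
    have l: "((\<lambda>h. flat_exp p h / h) \<longlongrightarrow> 0) (at_left 0)"
      by (rule tendsto_eventually) (auto simp: eventually_at_left_field flat_exp_def intro!: exI[of _ "- 1"])
    have "((\<lambda>h. (flat_exp p (0 + h) - flat_exp p 0) / h) \<longlongrightarrow> 0) (at 0)"
      using filterlim_split_at[OF l r] by (simp add: flat_exp_def)
    then show ?thesis using 3 by (simp add: DERIV_def flat_exp_def)
  qed
qed

lemma smooth_on_flat_exp: "smooth_on UNIV (flat_exp p)"
  by (rule higher_derivs_eqI(1)[where F = "\<lambda>k. flat_exp (((\<lambda>p. [:0, 0, 1:] * (p - pderiv p)) ^^ k) p)"])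
     (auto simp del: mult_pCons_left intro: flat_exp_has_derivative)

text \<open>Positive exactly on \<open>(1, 2)\<close>; its normalized primitive is the smooth step.\<close>

definition bump :: "real \<Rightarrow> real" where
  "bump x = flat_exp 1 (x - 1) * flat_exp 1 (2 - x)"

lemma bump_smooth: "smooth_on UNIV bump"
proof -
  have "smooth_on UNIV (\<lambda>x. flat_exp 1 (1 * x + - 1) * flat_exp 1 (- 1 * x + 2))"
    by (intro smooth_on_mult smooth_on_affine smooth_on_flat_exp open_UNIV)
  moreover have "(\<lambda>x. flat_exp 1 (1 * x + - 1) * flat_exp 1 (- 1 * x + 2)) = bump" by (auto simp: bump_def)
  ultimately show ?thesis by (simp only:)
qed

lemma bump_cases: "0 \<le> bump x" "x \<le> 1 \<Longrightarrow> bump x = 0" "2 \<le> x \<Longrightarrow> bump x = 0" "1 < x \<Longrightarrow> x < 2 \<Longrightarrow> 0 < bump x"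
  by (auto simp: bump_def flat_exp_def)

lemma smooth_on_primitive:
  assumes "\<And>x. (f has_real_derivative g x) (at x)" "smooth_on UNIV g"
  shows "smooth_on UNIV f"
proof -
  have "deriv f = g" using assms(1) by (intro ext DERIV_imp_deriv)
  then have "(deriv ^^ Suc k) f = (deriv ^^ k) g" for k by (simp add: funpow_Suc_right del: funpow.simps)
  then show ?thesis unfolding smooth_on_def
  proof (intro allI ballI)
    fix k x assume *: "\<And>k. (deriv ^^ Suc k) f = (deriv ^^ k) g"
    show "(deriv ^^ k) f field_differentiable at x"
      using assms * by (cases k) (auto simp: field_differentiable_def smooth_on_def simp del: funpow.simps(2))
  qed
qed

definition smooth_step :: "(real \<Rightarrow> real) \<Rightarrow> bool" where
  "smooth_step \<eta> \<longleftrightarrow> smooth_on UNIV \<eta> \<and> (\<forall>x\<le>1. \<eta> x = 0) \<and> (\<forall>x\<ge>2. \<eta> x = 1)"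

lemma smooth_stepD:
  assumes "smooth_step \<eta>"
  shows "smooth_on UNIV \<eta>" "\<And>x. x \<le> 1 \<Longrightarrow> \<eta> x = 0" "\<And>x. 2 \<le> x \<Longrightarrow> \<eta> x = 1"
  using assms by (auto simp: smooth_step_def)

text \<open>The primitive of the bump is constant on both sides of \<open>(1, 2)\<close> and strictly larger on the right.\<close>

lemma smooth_step_exists: "\<exists>\<eta>. smooth_step \<eta>"
proof -
  define F where "F x = integral {0..x} bump" for x
  have cont: "continuous_on S bump" for S
    using smooth_onD[OF bump_smooth, of _ 0] by (auto intro!: continuous_at_imp_continuous_on DERIV_isCont)
  have F0: "F x = 0" if "x \<le> 1" for x
  proof -
    have "F x = integral {0..x} (\<lambda>_. 0)" unfolding F_def by (intro integral_cong) (use that in \<open>auto simp: bump_cases\<close>)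
    then show ?thesis by simp
  qed
  have DF: "(F has_real_derivative bump x) (at x)" for x
  proof (cases "x < 1")
    case True
    have "\<forall>\<^sub>F y in nhds x. F y = 0"
      using eventually_nhds_in_open[of "{..<1}" x] True by (auto elim!: eventually_mono simp: F0)
    then show ?thesis using True by (subst DERIV_cong_ev[of x x _ "\<lambda>_. 0"]) (auto simp: bump_cases)
  next
    case False
    have "(F has_real_derivative bump x) (at x within {0..x + 1})"
      unfolding F_def using False by (intro integral_has_real_derivative cont) auto
    then have "(F has_real_derivative bump x) (at x within {0<..<x + 1})"
      by (rule DERIV_subset) auto
    then show ?thesis using False by (subst (asm) at_within_open) auto
  qed
  have "F 1 < F 2"
  proof (rule DERIV_pos_imp_increasing_open[of 1 2 F])
    fix x :: real assume "1 < x" "x < 2"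
    then show "\<exists>y. (F has_real_derivative y) (at x) \<and> 0 < y" using DF[of x] bump_cases(4)[of x] by blast
  next
    show "continuous_on {1..2} F" using DF by (auto intro!: continuous_at_imp_continuous_on DERIV_isCont)
  qed simp
  then have pos: "0 < F 2" by (simp add: F0)
  have F2: "F x = F 2" if "2 \<le> x" for x
  proof (rule DERIV_isconst2[of 2 "x + 1" F x])
    show "continuous_on {2..x + 1} F" using DF by (auto intro!: continuous_at_imp_continuous_on DERIV_isCont)
    show "(F has_real_derivative 0) (at y)" if "2 < y" "y < x + 1" for y using DF[of y] that by (simp add: bump_cases)
  qed (use that in auto)
  have "smooth_on UNIV F" using DF bump_smooth by (rule smooth_on_primitive)
  then have "smooth_on UNIV (\<lambda>x. 1 / F 2 * F x)" by (intro smooth_on_mult smooth_on_const open_UNIV)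
  then have "smooth_step (\<lambda>x. 1 / F 2 * F x)"
    unfolding smooth_step_def
  proof (intro conjI allI impI)
    show "1 / F 2 * F x = 0" if "x \<le> 1" for x using F0[OF that] by simp
    show "1 / F 2 * F x = 1" if "2 \<le> x" for x using F2[OF that] pos by simp
  qed
  then show ?thesis by blast
qed

text \<open>Outside \<open>[1, 2]\<close> the step is locally constant, and on this compact interval the derivatives are
continuous, hence bounded.\<close>

lemma smooth_step_deriv:
  assumes step: "smooth_step \<eta>"
  shows "\<And>x. x < 1 \<Longrightarrow> (deriv ^^ k) \<eta> x = 0" "\<And>x. 2 < x \<Longrightarrow> (deriv ^^ k) \<eta> x = (if k = 0 then 1 else 0)"
    "\<exists>C. \<forall>x. \<bar>(deriv ^^ k) \<eta> x\<bar> \<le> C"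
proof -
  note \<eta> = smooth_stepD[OF step]
  show 1: "(deriv ^^ k) \<eta> x = 0" if "x < 1" for x
    using higher_deriv_cong_open[of "{..<1}" x \<eta> "\<lambda>_. 0" k] that \<eta> by (simp add: higher_deriv_const_real)
  show 2: "(deriv ^^ k) \<eta> x = (if k = 0 then 1 else 0)" if "2 < x" for x
    using higher_deriv_cong_open[of "{2<..}" x \<eta> "\<lambda>_. 1" k] that \<eta> by (simp add: higher_deriv_const_real)
  have "continuous_on {1..2} ((deriv ^^ k) \<eta>)"
    using smooth_onD[OF \<eta>(1)] by (auto intro!: continuous_at_imp_continuous_on DERIV_isCont simp del: funpow.simps)
  from continuous_on_Icc_bounded[OF this]
  obtain C where C: "\<And>x. x \<in> {1..2} \<Longrightarrow> \<bar>(deriv ^^ k) \<eta> x\<bar> \<le> C" by blast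
  have "\<bar>(deriv ^^ k) \<eta> x\<bar> \<le> max C 1" for x
  proof -
    consider "x < 1" | "x \<in> {1..2}" | "2 < x" by fastforce
    then show ?thesis by cases (use 1 2 C in \<open>auto simp: le_max_iff_disj\<close>)
  qed
  then show "\<exists>C. \<forall>x. \<bar>(deriv ^^ k) \<eta> x\<bar> \<le> C" by blast
qed

text \<open>Families with the derivative bounds of the weight \<open>(c, d)\<close>, uniformly in the index: each derivative
may cost one power of the distance to either end point. Weighted polynomials and shrinking cutoffs
satisfy such bounds, and products inherit them.\<close>

definition symbol_class :: "(nat \<Rightarrow> real \<Rightarrow> real) \<Rightarrow> real \<Rightarrow> real \<Rightarrow> bool" where
  "symbol_class F c d \<longleftrightarrow> (\<forall>n. smooth_on {0<..<1} (F n)) \<and>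
     (\<forall>k. \<exists>C. \<forall>n. \<forall>x\<in>{0<..<1}. \<bar>(deriv ^^ k) (F n) x\<bar> \<le> C * weight (c - real k) (d - real k) x)"

lemma weight_mult: "x \<in> {0<..<1} \<Longrightarrow> weight a b x * weight c d x = weight (a + c) (b + d) x"
  by (simp add: weight_def powr_add)

text \<open>Apply the Leibniz rule; the exponents of the weights add up.\<close>

lemma symbol_class_mult:
  assumes F: "symbol_class F c d" and G: "symbol_class G c' d'"
  shows "symbol_class (\<lambda>n x. F n x * G n x) (c + c') (d + d')"
proof -
  have sF: "smooth_on {0<..<1} (F n)" and sG: "smooth_on {0<..<1} (G n)" for n
    using F G by (auto simp: symbol_class_def)
  have op: "open {0<..<1::real}" by simp
  from F obtain C where C: "\<And>k n x. x \<in> {0<..<1} \<Longrightarrow> \<bar>(deriv ^^ k) (F n) x\<bar> \<le> C k * weight (c - real k) (d - real k) x"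
    unfolding symbol_class_def by metis
  from G obtain D where D: "\<And>k n x. x \<in> {0<..<1} \<Longrightarrow> \<bar>(deriv ^^ k) (G n) x\<bar> \<le> D k * weight (c' - real k) (d' - real k) x"
    unfolding symbol_class_def by metis
  have "\<bar>(deriv ^^ k) (\<lambda>x. F n x * G n x) x\<bar> \<le>
      (\<Sum>i\<le>k. real (k choose i) * (C i * D (k - i))) * weight (c + c' - real k) (d + d' - real k) x"
    if x: "x \<in> {0<..<1}" for k n x
  proof -
    have "\<bar>(deriv ^^ k) (\<lambda>x. F n x * G n x) x\<bar> \<le> (\<Sum>i\<le>k. \<bar>real (k choose i) * ((deriv ^^ i) (F n) x * (deriv ^^ (k - i)) (G n) x)\<bar>)"
      unfolding higher_deriv_mult_real[OF op sF sG x] by (rule sum_abs)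
    also have "\<dots> \<le> (\<Sum>i\<le>k. real (k choose i) * (C i * D (k - i)) * weight (c + c' - real k) (d + d' - real k) x)"
    proof (intro sum_mono)
      fix i assume "i \<in> {..k}"
      then have w: "weight (c - real i) (d - real i) x * weight (c' - real (k - i)) (d' - real (k - i)) x = weight (c + c' - real k) (d + d' - real k) x"
        using x by (subst weight_mult) (auto simp: of_nat_diff algebra_simps)
      have "\<bar>(deriv ^^ i) (F n) x\<bar> * \<bar>(deriv ^^ (k - i)) (G n) x\<bar> \<le>
        (C i * weight (c - real i) (d - real i) x) * (D (k - i) * weight (c' - real (k - i)) (d' - real (k - i)) x)"
        using C[OF x, of i n] D[OF x, of "k - i" n] order.trans[OF abs_ge_zero C[OF x, of i n]] by (intro mult_mono) auto
      also have "\<dots> = C i * D (k - i) * weight (c + c' - real k) (d + d' - real k) x"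
        unfolding w[symmetric] by simp
      finally have "real (k choose i) * (\<bar>(deriv ^^ i) (F n) x\<bar> * \<bar>(deriv ^^ (k - i)) (G n) x\<bar>) \<le>
         real (k choose i) * (C i * D (k - i) * weight (c + c' - real k) (d + d' - real k) x)"
        by (intro mult_left_mono) auto
      then show "\<bar>real (k choose i) * ((deriv ^^ i) (F n) x * (deriv ^^ (k - i)) (G n) x)\<bar> \<le>
         real (k choose i) * (C i * D (k - i)) * weight (c + c' - real k) (d + d' - real k) x"
        by (simp add: abs_mult mult.assoc)
    qed
    also have "\<dots> = (\<Sum>i\<le>k. real (k choose i) * (C i * D (k - i))) * weight (c + c' - real k) (d + d' - real k) x"
      by (simp add: sum_distrib_right)
    finally show ?thesis .
  qed
  then show ?thesis unfolding symbol_class_def using smooth_on_mult[OF op sF sG] by blast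
qed

lemma symbol_class_weight_poly: "symbol_class (\<lambda>n x. weight c d x * poly q x) c d"
  unfolding symbol_class_def
proof (intro conjI allI)
  show "smooth_on {0<..<1} (\<lambda>x. weight c d x * poly q x)"
    by (rule smooth_on_weight_poly)
  fix k
  obtain M where M: "\<And>x. x \<in> {0<..<1} \<Longrightarrow> \<bar>poly (raise_iter k (c - real k) (d - real k) q) x\<bar> \<le> M"
    using poly_bounded_unit[of "raise_iter k (c - real k) (d - real k) q"] by blast
  have "\<bar>(deriv ^^ k) (\<lambda>x. weight c d x * poly q x) x\<bar> \<le> M * weight (c - real k) (d - real k) x"
    if "x \<in> {0<..<1}" for x
    unfolding higher_deriv_weight_poly[OF that] abs_mult
    using M[OF that] by (simp add: mult.commute[of M] mult_left_mono)
  then show "\<exists>C. \<forall>n. \<forall>x\<in>{0<..<1}. \<bar>(deriv ^^ k) (\<lambda>x. weight c d x * poly q x) x\<bar> \<le> C * weight (c - real k) (d - real k) x"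
    by blast
qed

text \<open>The \<open>k\<close>-th derivative of the step with scale \<open>1 / m\<close> is of order \<open>m ^ k\<close>, but for \<open>0 < k\<close> it lives
where \<open>m * y \<le> 2\<close>, so that \<open>m\<close> may be traded for \<open>2 / y\<close>.\<close>

lemma scaled_step_bound:
  assumes step: "smooth_step \<eta>"
  shows "\<exists>C\<ge>0. \<forall>m>0. \<forall>y>0. \<bar>m ^ k * (deriv ^^ k) \<eta> (m * y)\<bar> \<le> C * y powr (- real k)"
proof -
  obtain C where C: "\<And>x. \<bar>(deriv ^^ k) \<eta> x\<bar> \<le> C" using smooth_step_deriv(3)[OF step] by blast
  then have C0: "0 \<le> C" using order.trans[OF abs_ge_zero C] by blast
  have "\<bar>m ^ k * (deriv ^^ k) \<eta> (m * y)\<bar> \<le> (C * 2 ^ k) * y powr (- real k)" if "0 < m" "0 < y" for m y :: real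
  proof (cases "k > 0 \<and> m * y > 2")
    case True
    then show ?thesis using smooth_step_deriv(2)[OF step, of "m * y" k] C0 by simp
  next
    case False
    then have "m ^ k \<le> 2 ^ k * (1 / y) ^ k"
    proof (cases "k = 0")
      case False
      then have "m \<le> 2 * (1 / y)" using \<open>\<not> (k > 0 \<and> m * y > 2)\<close> that by (simp add: field_simps)
      then have "m ^ k \<le> (2 * (1 / y)) ^ k" using that by (intro power_mono) auto
      then show ?thesis by (simp only: power_mult_distrib)
    qed simp
    then have "m ^ k * \<bar>(deriv ^^ k) \<eta> (m * y)\<bar> \<le> 2 ^ k * (1 / y) ^ k * C"
      using C that by (intro mult_mono) auto
    moreover have "(1 / y) ^ k = y powr (- real k)" using that by (simp add: powr_minus powr_realpow power_one_over inverse_eq_divide)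
    ultimately show ?thesis using that by (simp add: abs_mult mult_ac)
  qed
  then show ?thesis using C0 by (intro exI[of _ "C * 2 ^ k"]) auto
qed

lemma powr_neg_ge_1: "0 < y \<Longrightarrow> y < 1 \<Longrightarrow> 1 \<le> y powr (- real k)"
  using powr_mono'[of "- real k" 0 y] by simp

text \<open>The cases \<open>(1, 0)\<close> and \<open>(- 1, 1)\<close> of \<open>(s, t)\<close> are the cutoffs at the left and the right end point.\<close>

lemma symbol_class_step:
  assumes step: "smooth_step \<eta>" and m: "\<And>n. 0 < m n"
    and st: "s = 1 \<and> t = 0 \<or> s = - 1 \<and> t = (1::real)"
  shows "symbol_class (\<lambda>n x. \<eta> (s * m n * x + t * m n)) 0 0"
  unfolding symbol_class_def
proof (intro conjI allI)
  note sm = smooth_stepD(1)[OF step]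
  show "smooth_on {0<..<1} (\<lambda>x. \<eta> (s * m n * x + t * m n))" for n by (rule smooth_on_affine[OF sm])
  fix k
  obtain C where C: "0 \<le> C" "\<And>m y. 0 < m \<Longrightarrow> 0 < y \<Longrightarrow> \<bar>m ^ k * (deriv ^^ k) \<eta> (m * y)\<bar> \<le> C * y powr (- real k)"
    using scaled_step_bound[OF step] by metis
  have "\<bar>(deriv ^^ k) (\<lambda>x. \<eta> (s * m n * x + t * m n)) x\<bar> \<le> C * weight (0 - real k) (0 - real k) x" if x: "x \<in> {0<..<1}" for n x
  proof -
    define y where "y = s * x + t"
    have y: "0 < y" using x st by (auto simp: y_def)
    have e: "s * m n * x + t * m n = m n * y" by (simp add: y_def algebra_simps)
    have "\<bar>s\<bar> = 1" using st by auto
    then have "\<bar>(deriv ^^ k) (\<lambda>x. \<eta> (s * m n * x + t * m n)) x\<bar> = \<bar>m n ^ k * (deriv ^^ k) \<eta> (m n * y)\<bar>"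
      unfolding higher_deriv_affine[OF sm] e by (simp add: abs_mult power_abs power_mult_distrib)
    also have "\<dots> \<le> C * y powr (- real k)" by (rule C(2)[OF m y])
    also have "y powr (- real k) \<le> (1 - x) powr (- real k) * x powr (- real k)"
      using powr_neg_ge_1[of "1 - x" k] powr_neg_ge_1[of x k] x st
        mult_right_mono[of 1 "(1 - x) powr (- real k)" "x powr (- real k)"]
        mult_left_mono[of 1 "x powr (- real k)" "(1 - x) powr (- real k)"]
      by (auto simp: y_def)
    finally show ?thesis using C(1) by (simp add: weight_def mult_left_mono)
  qed
  then show "\<exists>C. \<forall>n. \<forall>x\<in>{0<..<1}. \<bar>(deriv ^^ k) (\<lambda>x. \<eta> (s * m n * x + t * m n)) x\<bar> \<le> C * weight (0 - real k) (0 - real k) x" by blast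
qed

text \<open>The weighted polynomial is multiplied by smooth steps that vanish near the end points. The resulting
test functions satisfy derivative bounds independent of \<open>n\<close> and agree with the weighted polynomial
near any given point eventually, which is what dominated convergence needs.\<close>

lemma cutoff_test_functions:
  fixes c d :: real and q :: "real poly"
  obtains \<Phi> :: "nat \<Rightarrow> real \<Rightarrow> real" where
    "\<And>n. test_function (\<Phi> n)" "symbol_class \<Phi> c d"
    "\<And>k x. x \<in> {0<..<1} \<Longrightarrow> \<forall>\<^sub>F n in sequentially. (deriv ^^ k) (\<Phi> n) x =
        weight (c - real k) (d - real k) x * poly (raise_iter k (c - real k) (d - real k) q) x"
proof -
  obtain \<eta> where step: "smooth_step \<eta>" using smooth_step_exists by blast
  note \<eta> = smooth_stepD[OF step]
  \<comment> \<open>The reciprocal of \<open>m n\<close> is the distance from the end points at which the cutoff begins.\<close>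
  define m where "m n = real n + 1" for n
  have m: "0 < m n" for n by (simp add: m_def)
  define \<Phi> where "\<Phi> n x = (weight c d x * poly q x) * (\<eta> (1 * m n * x + 0 * m n) * \<eta> (- 1 * m n * x + 1 * m n))" for n x
  have "symbol_class \<Phi> (c + (0 + 0)) (d + (0 + 0))"
    unfolding \<Phi>_def
    by (intro symbol_class_mult symbol_class_weight_poly symbol_class_step[OF step m]) auto
  then have sc: "symbol_class \<Phi> c d" by simp
  have zero: "\<Phi> n x = 0" if "x < 1 / m n \<or> 1 - 1 / m n < x" for n x
  proof -
    have "1 * m n * x + 0 * m n \<le> 1 \<or> - 1 * m n * x + 1 * m n \<le> 1" using that m[of n] by (auto simp: field_simps)
    then have "\<eta> (1 * m n * x + 0 * m n) = 0 \<or> \<eta> (- 1 * m n * x + 1 * m n) = 0" using \<eta>(2) by blast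
    then show ?thesis unfolding \<Phi>_def by (elim disjE) (simp_all only: mult_zero_left mult_zero_right)
  qed
  have "test_function (\<Phi> n)" for n
    unfolding test_function_def
  proof (intro conjI allI)
    fix k x
    show "(deriv ^^ k) (\<Phi> n) field_differentiable at x"
    proof (cases "x \<in> {0<..<1}")
      case True
      then show ?thesis using sc by (simp add: symbol_class_def smooth_on_def)
    next
      case False
      have "smooth_on ({..<1 / m n} \<union> {1 - 1 / m n<..}) (\<Phi> n)"
        by (rule smooth_on_cong[OF _ _ smooth_on_const[of _ 0]]) (auto simp: zero)
      moreover have "x < 1 / m n \<or> 1 - 1 / m n < x"
      proof -
        have "0 < 1 / m n" using m[of n] by simp
        moreover have "x \<le> 0 \<or> 1 \<le> x" using False by auto
        ultimately show ?thesis by linarith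
      qed
      ultimately show ?thesis by (auto simp: smooth_on_def)
    qed
  next
    show "\<exists>c d. 0 < c \<and> d < 1 \<and> (\<forall>x. x \<notin> {c..d} \<longrightarrow> \<Phi> n x = 0)"
      using m[of n] zero by (intro exI[of _ "1 / m n"] exI[of _ "1 - 1 / m n"]) auto
  qed
  moreover have "\<forall>\<^sub>F n in sequentially. (deriv ^^ k) (\<Phi> n) x =
        weight (c - real k) (d - real k) x * poly (raise_iter k (c - real k) (d - real k) q) x" if x: "x \<in> {0<..<1}" for k x
  proof -
    have "\<forall>\<^sub>F n in sequentially. 2 / x < real n" "\<forall>\<^sub>F n in sequentially. 2 / (1 - x) < real n"
      using filterlim_real_sequentially unfolding filterlim_at_top_dense by auto
    then show ?thesis
    proof eventually_elim
      case (elim n)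
      have "2 < m n * x" "2 < m n * (1 - x)"
        using elim x by (auto simp: m_def field_simps)
      then have "x \<in> {2 / m n<..<1 - 2 / m n}" using m[of n] by (auto simp: field_simps)
      moreover have "\<Phi> n y = weight c d y * poly q y" if "y \<in> {2 / m n<..<1 - 2 / m n}" for y
      proof -
        have "2 \<le> 1 * m n * y + 0 * m n" "2 \<le> - 1 * m n * y + 1 * m n" using that m[of n] by (auto simp: field_simps)
        then show ?thesis unfolding \<Phi>_def by (simp only: \<eta>(3) mult_1_right)
      qed
      ultimately have "(deriv ^^ k) (\<Phi> n) x = (deriv ^^ k) (\<lambda>x. weight c d x * poly q x) x"
        by (intro higher_deriv_cong_open[of "{2 / m n<..<1 - 2 / m n}"]) auto
      then show ?case using higher_deriv_weight_poly[OF x] by simp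
    qed
  qed
  ultimately show ?thesis using sc that by blast
qed

section \<open>Weak derivatives of expansions\<close>

lemma test_function_higher_continuous:
  assumes "test_function \<phi>"
  shows "continuous_on S ((deriv ^^ k) \<phi>)"
  using assms unfolding test_function_def
  by (intro continuous_at_imp_continuous_on ballI field_differentiable_imp_continuous_at) blast

lemma test_function_deriv:
  assumes "test_function \<phi>"
  shows "test_function (deriv \<phi>)"
proof -
  from assms obtain c d where cd: "0 < c" "d < 1" "\<And>x. x \<notin> {c..d} \<Longrightarrow> \<phi> x = 0" by (auto simp: test_function_def)
  have "deriv \<phi> x = 0" if "x \<notin> {c..d}" for x
    using higher_deriv_cong_open[of "- {c..d}" x \<phi> "\<lambda>_. 0" 1] that cd(3) by (simp add: open_Compl)
  moreover have "(deriv ^^ k) (deriv \<phi>) field_differentiable at x" for k x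
  proof -
    have "(deriv ^^ Suc k) \<phi> field_differentiable at x" using assms unfolding test_function_def by blast
    then show ?thesis by (simp add: funpow_Suc_right del: funpow.simps)
  qed
  ultimately show ?thesis using cd unfolding test_function_def by blast
qed

lemma test_function_higher_deriv: "test_function \<phi> \<Longrightarrow> test_function ((deriv ^^ k) \<phi>)"
  by (induction k) (auto intro: test_function_deriv)

lemma integrable_test_locally_integrable:
  assumes f: "locally_integrable f" and \<phi>: "test_function \<phi>"
  shows "integrable leb01 (\<lambda>x. f x * \<phi> x)"
proof -
  from \<phi> obtain c d where cd: "0 < c" "d < 1" "\<And>x. x \<notin> {c..d} \<Longrightarrow> \<phi> x = 0" by (auto simp: test_function_def)
  have cont: "continuous_on S \<phi>" for S using test_function_higher_continuous[OF \<phi>, of S 0] by simp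
  obtain M where M: "\<And>x. x \<in> {c..d} \<Longrightarrow> \<bar>\<phi> x\<bar> \<le> M" using continuous_on_Icc_bounded[OF cont] by blast
  have i: "integrable lebesgue (\<lambda>x. indicator {c..d} x * f x)"
    using f cd(1,2) by (simp add: locally_integrable_def set_integrable_def)
  have "integrable lebesgue (\<lambda>x. (indicator {c..d} x * f x) * \<phi> x)"
  proof (rule Bochner_Integration.integrable_bound)
    show "integrable lebesgue (\<lambda>x. M * (indicator {c..d} x * f x))" using i by simp
    have "\<phi> \<in> borel_measurable borel" by (rule borel_measurable_continuous_onI) (rule cont)
    then have "\<phi> \<in> borel_measurable lebesgue" by (intro measurable_completion) simp
    then show "(\<lambda>x. (indicator {c..d} x * f x) * \<phi> x) \<in> borel_measurable lebesgue"
      by (rule borel_measurable_times[OF borel_measurable_integrable[OF i]])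
    show "AE x in lebesgue. norm (indicator {c..d} x * f x * \<phi> x) \<le> norm (M * (indicator {c..d} x * f x))"
    proof (rule AE_I2)
      fix x
      show "norm (indicator {c..d} x * f x * \<phi> x) \<le> norm (M * (indicator {c..d} x * f x))"
      proof (cases "x \<in> {c..d}")
        case True
        then have "\<bar>\<phi> x\<bar> \<le> \<bar>M\<bar>" using M[of x] by simp
        then show ?thesis using True by (simp add: abs_mult mult.commute[of "\<bar>M\<bar>"] mult_left_mono)
      qed simp
    qed
  qed
  moreover have "(\<lambda>x. (indicator {c..d} x * f x) * \<phi> x) = (\<lambda>x. indicator {0<..<1} x *\<^sub>R (f x * \<phi> x))"
    using cd by (force simp: indicator_def fun_eq_iff)
  ultimately show ?thesis by (simp add: integrable_restrict_space)
qed

lemma weight_continuous_on: "continuous_on {0<..<1} (weight a b)"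
  unfolding weight_def by (intro continuous_intros) auto

lemma weight_pos: "x \<in> {0<..<1} \<Longrightarrow> 0 < weight a b x"
  by (auto simp: weight_def)

text \<open>On a compact subinterval the weight is bounded below, and \<open>\<bar>f x\<bar> \<le> 1 + (f x)\<^sup>2\<close>.\<close>

lemma L2w_locally_integrable:
  assumes f: "f \<in> L2w a b"
  shows "locally_integrable f"
  unfolding locally_integrable_def
proof (intro allI impI)
  fix c d :: real assume cd: "0 < c \<and> d < 1"
  show "f absolutely_integrable_on {c..d}"
  proof (cases "c \<le> d")
    case False
    then show ?thesis by (simp add: set_integrable_def)
  next
    case True
    have "continuous_on {c..d} (weight a b)" using cd by (intro continuous_on_subset[OF weight_continuous_on]) auto
    then obtain z where z: "z \<in> {c..d}" "\<And>y. y \<in> {c..d} \<Longrightarrow> weight a b z \<le> weight a b y"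
      using continuous_attains_inf[of "{c..d}" "weight a b"] True by auto
    define \<delta> where "\<delta> = weight a b z"
    have \<delta>: "0 < \<delta>" unfolding \<delta>_def using z cd by (intro weight_pos) auto
    have i1: "integrable lebesgue (\<lambda>x. indicator {0<..<1} x * (weight a b x * (f x)\<^sup>2))"
      using f by (simp add: L2w_def integrable_restrict_space)
    have "integrable lebesgue (indicator {c..d} :: real \<Rightarrow> real)"
      by (rule integrable_real_indicator) (auto simp: emeasure_lborel_Icc_eq)
    then have i2: "integrable lebesgue (\<lambda>x. indicator {c..d} x + 1 / \<delta> * (indicator {0<..<1} x * (weight a b x * (f x)\<^sup>2)))"
      using i1 by (intro Bochner_Integration.integrable_add integrable_mult_right) auto
    have "(\<lambda>x. indicator {0<..<1} x *\<^sub>R f x) \<in> borel_measurable lebesgue"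
      using L2w_measurable[OF f] by (subst borel_measurable_restrict_space_iff[symmetric]) auto
    then have "(\<lambda>x. indicator {c..d} x * (indicator {0<..<1} x * f x)) \<in> borel_measurable lebesgue"
      by (intro borel_measurable_times[of "indicator {c..d}"] borel_measurable_indicator) auto
    moreover have "(\<lambda>x. indicator {c..d} x * (indicator {0<..<1} x * f x)) = (\<lambda>x. indicator {c..d} x *\<^sub>R f x)"
      using cd by (auto simp: indicator_def fun_eq_iff)
    ultimately have m: "(\<lambda>x. indicator {c..d} x *\<^sub>R f x) \<in> borel_measurable lebesgue" by simp
    show ?thesis unfolding set_integrable_def
    proof (rule Bochner_Integration.integrable_bound[OF i2 m], rule AE_I2)
      fix x
      show "norm (indicator {c..d} x *\<^sub>R f x) \<le> norm (indicator {c..d} x + 1 / \<delta> * (indicator {0<..<1} x * (weight a b x * (f x)\<^sup>2)))"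
      proof (cases "x \<in> {c..d}")
        case True
        have "\<bar>f x\<bar> \<le> 1 + (f x)\<^sup>2" using sum_squares_bound[of 1 "\<bar>f x\<bar>"] by (simp add: power2_eq_square)
        also have "(f x)\<^sup>2 \<le> 1 / \<delta> * (weight a b x * (f x)\<^sup>2)"
          using z(2)[OF True] \<delta> by (simp add: \<delta>_def[symmetric] pos_le_divide_eq mult.commute[of "(f x)\<^sup>2"] mult_right_mono)
        finally show ?thesis using True cd by (simp add: indicator_def)
      qed simp
    qed
  qed
qed

text \<open>Dividing by the weight turns integration against a test function into an inner product, so that
convergence in a weighted space implies convergence of the integrals.\<close>

lemma L2w_test_div_weight:
  assumes \<phi>: "test_function \<phi>"
  shows "(\<lambda>x. \<phi> x / weight a b x) \<in> L2w a b"
proof -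
  from \<phi> obtain c d where cd: "0 < c" "d < 1" "\<And>x. x \<notin> {c..d} \<Longrightarrow> \<phi> x = 0" by (auto simp: test_function_def)
  have cont: "continuous_on S \<phi>" for S using test_function_higher_continuous[OF \<phi>, of S 0] by simp
  have [measurable]: "\<phi> \<in> borel_measurable leb01"
    by (intro borel_measurable_lebesgue_onI borel_measurable_continuous_onI cont)
  have "continuous_on {c..d} (\<lambda>x. (\<phi> x)\<^sup>2 / weight a b x)"
  proof (intro continuous_intros cont)
    show "continuous_on {c..d} (weight a b)"
      using cd by (intro continuous_on_subset[OF weight_continuous_on]) auto
    show "\<forall>x\<in>{c..d}. weight a b x \<noteq> 0"
    proof
      fix x assume "x \<in> {c..d}"
      then have "0 < weight a b x" using cd by (intro weight_pos) auto
      then show "weight a b x \<noteq> 0" by simp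
    qed
  qed
  from continuous_on_Icc_bounded[OF this]
  obtain M where M: "\<And>x. x \<in> {c..d} \<Longrightarrow> \<bar>(\<phi> x)\<^sup>2 / weight a b x\<bar> \<le> M" by blast
  have "integrable leb01 (\<lambda>x. (\<phi> x)\<^sup>2 / weight a b x)"
  proof (rule Bochner_Integration.integrable_bound)
    show "integrable leb01 (\<lambda>x. \<bar>M\<bar>)"
      using finite_measure.integrable_const[OF finite_measure_lebesgue_on[of "{0<..<1::real}"]] by simp
    show "AE x in leb01. norm ((\<phi> x)\<^sup>2 / weight a b x) \<le> norm \<bar>M\<bar>"
    proof (rule AE_I2)
      fix x
      show "norm ((\<phi> x)\<^sup>2 / weight a b x) \<le> norm \<bar>M\<bar>"
        using M[of x] cd(3)[of x] by (cases "x \<in> {c..d}") auto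
    qed
  qed measurable
  moreover have "weight a b x * (\<phi> x / weight a b x)\<^sup>2 = (\<phi> x)\<^sup>2 / weight a b x" for x
    by (simp add: power2_eq_square divide_simps)
  ultimately show ?thesis by (simp add: L2w_def)
qed

lemma inner_w_test_div_weight: "inner_w a b f (\<lambda>x. \<phi> x / weight a b x) = (LINT x|leb01. f x * \<phi> x)"
  unfolding inner_w_def
proof (intro Bochner_Integration.integral_cong refl)
  fix x assume "x \<in> space leb01"
  then have "0 < weight a b x" by (intro weight_pos) simp
  then show "weight a b x * (f x * (\<phi> x / weight a b x)) = f x * \<phi> x" by simp
qed

lemma integral_poly_deriv_test:
  assumes \<phi>: "test_function \<phi>"
  shows "(LINT x|leb01. poly p x * deriv \<phi> x) = - (LINT x|leb01. poly (pderiv p) x * \<phi> x)"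
proof -
  from \<phi> obtain c d where cd: "0 < c" "d < 1" "\<And>x. x \<notin> {c..d} \<Longrightarrow> \<phi> x = 0" by (auto simp: test_function_def)
  have li: "locally_integrable (poly p)" for p :: "real poly" by (rule L2w_locally_integrable[of _ 0 0]) (simp add: L2w_poly)
  have i: "integrable leb01 (\<lambda>x. poly p x * deriv \<phi> x)" "integrable leb01 (\<lambda>x. poly (pderiv p) x * \<phi> x)"
    by (intro integrable_test_locally_integrable li test_function_deriv \<phi>)+
  have D: "(\<phi> has_real_derivative deriv \<phi> x) (at x)" for x
  proof -
    have "(deriv ^^ 0) \<phi> field_differentiable at x" using \<phi> unfolding test_function_def by blast
    then show ?thesis by (simp add: DERIV_deriv_iff_field_differentiable)
  qed
  have "((\<lambda>x. poly (pderiv p) x * \<phi> x + deriv \<phi> x * poly p x) has_integral (poly p 1 * \<phi> 1 - poly p 0 * \<phi> 0)) {0..1}"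
  proof (rule fundamental_theorem_of_calculus)
    fix x :: real
    have "((\<lambda>x. poly p x * \<phi> x) has_real_derivative poly (pderiv p) x * \<phi> x + deriv \<phi> x * poly p x) (at x)"
      by (intro DERIV_mult poly_DERIV D)
    then show "((\<lambda>x. poly p x * \<phi> x) has_vector_derivative poly (pderiv p) x * \<phi> x + deriv \<phi> x * poly p x) (at x within {0..1})"
      unfolding has_real_derivative_iff_has_vector_derivative[symmetric] by (rule has_field_derivative_at_within)
  qed simp
  moreover have "\<phi> 0 = 0" "\<phi> 1 = 0" using cd by auto
  ultimately have "((\<lambda>x. poly p x * deriv \<phi> x + poly (pderiv p) x * \<phi> x) has_integral 0) {0<..<1}"
    by (simp add: has_integral_Icc_iff_Ioo algebra_simps)
  moreover have "((\<lambda>x. poly p x * deriv \<phi> x + poly (pderiv p) x * \<phi> x) has_integral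
      (LINT x|leb01. poly p x * deriv \<phi> x + poly (pderiv p) x * \<phi> x)) {0<..<1}"
    by (intro has_integral_integral_lebesgue_on Bochner_Integration.integrable_add i) auto
  ultimately have "(LINT x|leb01. poly p x * deriv \<phi> x + poly (pderiv p) x * \<phi> x) = 0"
    by (rule has_integral_unique[symmetric])
  then show ?thesis using i by simp
qed

lemma integral_poly_higher_deriv_test:
  "test_function \<phi> \<Longrightarrow> (LINT x|leb01. poly p x * (deriv ^^ j) \<phi> x) =
     (- 1) ^ j * (LINT x|leb01. poly ((pderiv ^^ j) p) x * \<phi> x)"
proof (induction j arbitrary: p)
  case (Suc j)
  have "(LINT x|leb01. poly p x * (deriv ^^ Suc j) \<phi> x) = - (LINT x|leb01. poly (pderiv p) x * (deriv ^^ j) \<phi> x)"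
    using integral_poly_deriv_test[OF test_function_higher_deriv[OF Suc.prems, of j], of p] by simp
  then show ?case using Suc by (simp add: funpow_Suc_right del: funpow.simps)
qed simp

text \<open>The weight \<open>(a + j, b + j)\<close> times \<open>q\<close> is in general not a test function. It is approximated by
\<open>cutoff_test_functions\<close>: the integrands on both sides are dominated by \<open>g\<close> and \<open>h\<close> times the weights
of their own spaces, and these products are integrable.\<close>

lemma weak_deriv_test_weight_poly:
  assumes ab: "- 1 < a" "- 1 < b" and gh: "has_weak_deriv j g h"
    and g: "g \<in> L2w a b" and h: "h \<in> L2w (a + real j) (b + real j)"
  shows "inner_w a b g (poly (raise_iter j a b q)) = (- 1) ^ j * inner_w (a + real j) (b + real j) h (poly q)"
proof -
  let ?c = "a + real j" and ?d = "b + real j"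
  obtain \<Phi> where \<Phi>: "\<And>n. test_function (\<Phi> n)" "symbol_class \<Phi> ?c ?d"
    "\<And>k x. x \<in> {0<..<1} \<Longrightarrow> \<forall>\<^sub>F n in sequentially. (deriv ^^ k) (\<Phi> n) x =
        weight (?c - real k) (?d - real k) x * poly (raise_iter k (?c - real k) (?d - real k) q) x"
    using cutoff_test_functions[of ?c ?d q] by blast
  have key: "(\<lambda>n. (LINT x|leb01. f x * (deriv ^^ k) (\<Phi> n) x)) \<longlonglongrightarrow>
      inner_w (?c - real k) (?d - real k) f (poly (raise_iter k (?c - real k) (?d - real k) q))"
    if f: "f \<in> L2w (?c - real k) (?d - real k)" and e: "- 1 < ?c - real k" "- 1 < ?d - real k" for f k
  proof -
    obtain C where C: "\<And>n x. x \<in> {0<..<1} \<Longrightarrow> \<bar>(deriv ^^ k) (\<Phi> n) x\<bar> \<le> C * weight (?c - real k) (?d - real k) x"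
      using \<Phi>(2) unfolding symbol_class_def by meson
    have fm [measurable]: "f \<in> borel_measurable leb01" using f by (rule L2w_measurable)
    have dm [measurable]: "(deriv ^^ k) (\<Phi> n) \<in> borel_measurable leb01" for n
      by (intro borel_measurable_lebesgue_onI borel_measurable_continuous_onI test_function_higher_continuous \<Phi>(1))
    show ?thesis unfolding inner_w_def
    proof (rule integral_dominated_convergence[where w = "\<lambda>x. C * \<bar>weight (?c - real k) (?d - real k) x * (f x * poly 1 x)\<bar>"])
      show "integrable leb01 (\<lambda>x. C * \<bar>weight (?c - real k) (?d - real k) x * (f x * poly 1 x)\<bar>)"
        using f e by (intro integrable_mult_right integrable_abs integrable_inner_w L2w_poly)
      show "AE x in leb01. (\<lambda>n. f x * (deriv ^^ k) (\<Phi> n) x) \<longlonglongrightarrow>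
        weight (?c - real k) (?d - real k) x * (f x * poly (raise_iter k (?c - real k) (?d - real k) q) x)"
      proof (rule AE_I2)
        fix x assume "x \<in> space leb01"
        then have x: "x \<in> {0<..<1}" by simp
        show "(\<lambda>n. f x * (deriv ^^ k) (\<Phi> n) x) \<longlonglongrightarrow>
          weight (?c - real k) (?d - real k) x * (f x * poly (raise_iter k (?c - real k) (?d - real k) q) x)"
          using \<Phi>(3)[OF x, of k] by (intro tendsto_eventually) (auto elim: eventually_mono)
      qed
      show "AE x in leb01. norm (f x * (deriv ^^ k) (\<Phi> n) x) \<le> C * \<bar>weight (?c - real k) (?d - real k) x * (f x * poly 1 x)\<bar>" for n
      proof (rule AE_I2)
        fix x assume "x \<in> space leb01"
        then have x: "x \<in> {0<..<1}" by simp
        show "norm (f x * (deriv ^^ k) (\<Phi> n) x) \<le> C * \<bar>weight (?c - real k) (?d - real k) x * (f x * poly 1 x)\<bar>"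
          using mult_left_mono[OF C[OF x, of n], of "\<bar>f x\<bar>"] by (simp add: abs_mult mult_ac)
      qed
    qed measurable
  qed
  have "(\<lambda>n. (LINT x|leb01. g x * (deriv ^^ j) (\<Phi> n) x)) \<longlonglongrightarrow> inner_w a b g (poly (raise_iter j a b q))"
    using key[of g j] g ab by simp
  moreover have "(\<lambda>n. (- 1) ^ j * (LINT x|leb01. h x * \<Phi> n x)) \<longlonglongrightarrow> (- 1) ^ j * inner_w ?c ?d h (poly q)"
    using key[of h 0] h ab by (intro tendsto_mult_left) simp
  moreover have "(LINT x|leb01. g x * (deriv ^^ j) (\<Phi> n) x) = (- 1) ^ j * (LINT x|leb01. h x * \<Phi> n x)" for n
    using gh \<Phi>(1) unfolding has_weak_deriv_def by blast
  ultimately show ?thesis by (simp add: LIMSEQ_unique)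
qed

lemma has_weak_deriv_lincomb:
  assumes "has_weak_deriv j f1 h1" "has_weak_deriv j f2 h2"
  shows "has_weak_deriv j (\<lambda>x. f1 x - A * f2 x) (\<lambda>x. h1 x - A * h2 x)"
proof -
  have li: "locally_integrable (\<lambda>x. f x - A * g x)" if "locally_integrable f" "locally_integrable g" for f g
    unfolding locally_integrable_def
  proof (intro allI impI)
    fix c d :: real assume "0 < c \<and> d < 1"
    then have "f absolutely_integrable_on {c..d}" "g absolutely_integrable_on {c..d}"
      using that by (auto simp: locally_integrable_def)
    then show "(\<lambda>x. f x - A * g x) absolutely_integrable_on {c..d}"
      by (intro set_integral_diff(1) set_integrable_mult_right) auto
  qed
  have l: "locally_integrable f1" "locally_integrable f2" "locally_integrable h1" "locally_integrable h2"
    using assms by (auto simp: has_weak_deriv_def)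
  have "(LINT x|leb01. (f1 x - A * f2 x) * (deriv ^^ j) \<phi> x) = (- 1) ^ j * (LINT x|leb01. (h1 x - A * h2 x) * \<phi> x)"
    if \<phi>: "test_function \<phi>" for \<phi>
  proof -
    have s: "(LINT x|leb01. (f x - A * g x) * \<psi> x) = (LINT x|leb01. f x * \<psi> x) - A * (LINT x|leb01. g x * \<psi> x)"
      if "locally_integrable f" "locally_integrable g" "test_function \<psi>" for f g \<psi>
    proof -
      have "(LINT x|leb01. (f x - A * g x) * \<psi> x) = (LINT x|leb01. f x * \<psi> x - A * (g x * \<psi> x))"
        by (simp add: algebra_simps)
      then show ?thesis using integrable_test_locally_integrable that by simp
    qed
    show ?thesis
      using assms \<phi> unfolding s[OF l(1,2) test_function_higher_deriv[OF \<phi>]] s[OF l(3,4) \<phi>] has_weak_deriv_def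
      by (simp add: algebra_simps)
  qed
  then show ?thesis using li l unfolding has_weak_deriv_def by blast
qed

text \<open>The \<open>j\<close>-th derivatives of the partial sums are orthogonal sums, so the summability hypothesis makes
them a Cauchy sequence. Its limit is the weak derivative, because the definition passes to the limit
on both sides.\<close>

lemma weak_deriv_of_expansion:
  assumes ab: "- 1 < a" "- 1 < b" and p: "converges_L2w a b (\<lambda>N. poly (p N)) v"
    and sm: "summable (\<lambda>n. (coeff_w a b v n)\<^sup>2 * deriv_factor j (a + b) n)"
  shows "weak_deriv_in_L2w j v (a + real j) (b + real j)"
proof -
  let ?S = "partial_sum a b v" and ?e = "\<lambda>n. (pderiv ^^ j) (orthonormal_poly a b n)" and ?c = "\<lambda>n. coeff_w a b v n"
  let ?a = "a + real j" and ?b = "b + real j"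
  have ab': "- 1 < ?a" "- 1 < ?b" using ab by auto
  have S: "converges_L2w a b (\<lambda>M. poly (?S M)) v" using ab p by (rule partial_sum_converges)
  have v: "v \<in> L2w a b" using p by (simp add: converges_L2w_def)
  have e: "inner_w ?a ?b (poly (?e m)) (poly (?e n)) = (if m = n then deriv_factor j (a + b) n else 0)" for m n
    using inner_w_higher_pderiv[OF ab orthonormal_poly_props(1)[OF ab]] by (simp add: inner_w_orthonormal_poly[OF ab])
  define X where "X M = (pderiv ^^ j) (?S M)" for M
  have X: "X M = (\<Sum>n<M. smult (?c n) (?e n))" for M
    unfolding X_def partial_sum_def by (simp add: higher_pderiv_sum higher_pderiv_smult)
  have d: "dist2_w ?a ?b (poly (X m)) (poly (X n)) =
      (\<Sum>k\<in>{n..<m}. (?c k)\<^sup>2 * deriv_factor j (a + b) k)" if "n \<le> m" for m n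
  proof -
    have "X m - X n = (\<Sum>k\<in>{n..<m}. smult (?c k) (?e k))"
      unfolding X using that by (simp add: sum_diff_nat_ivl lessThan_atLeast0)
    then have "(\<lambda>x. poly (X m) x - poly (X n) x) = poly (\<Sum>k\<in>{n..<m}. smult (?c k) (?e k))"
      by (simp add: fun_eq_iff flip: poly_diff)
    then show ?thesis using inner_w_orthogonal_sum[OF ab' _ e, of "{n..<m}" ?c] by simp
  qed
  have "\<exists>h. converges_L2w ?a ?b (\<lambda>M. poly (X M)) h"
  proof (rule L2w_complete)
    show "poly (X n) \<in> L2w ?a ?b" for n by (rule L2w_poly[OF ab'])
    fix \<epsilon> :: real assume "0 < \<epsilon>"
    then obtain N where N: "\<And>m n. N \<le> m \<Longrightarrow> norm (\<Sum>k\<in>{m..<n}. (?c k)\<^sup>2 * deriv_factor j (a + b) k) < \<epsilon>"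
      using sm unfolding summable_Cauchy by meson
    have sym: "dist2_w ?a ?b (poly (X m)) (poly (X n)) =
       dist2_w ?a ?b (poly (X n)) (poly (X m))" for m n
      unfolding inner_w_def by (intro Bochner_Integration.integral_cong refl) (simp add: algebra_simps)
    have 1: "dist2_w ?a ?b (poly (X m)) (poly (X n)) < \<epsilon>"
      if "n \<le> m" "N \<le> n" for m n
      using N[OF that(2), of m] unfolding d[OF that(1)] by (simp add: abs_less_iff)
    have "dist2_w ?a ?b (poly (X m)) (poly (X n)) < \<epsilon>"
      if "N \<le> m" "N \<le> n" for m n
      using 1[of n m] 1[of m n] sym[of m n] that by (cases "n \<le> m") auto
    then show "\<exists>N. \<forall>m\<ge>N. \<forall>n\<ge>N. dist2_w ?a ?b (poly (X m)) (poly (X n)) < \<epsilon>"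
      by blast
  qed
  then obtain h where Xh: "converges_L2w ?a ?b (\<lambda>M. poly (X M)) h" by blast
  then have h: "h \<in> L2w ?a ?b" by (simp add: converges_L2w_def)
  have "(LINT x|leb01. v x * (deriv ^^ j) \<phi> x) = (- 1) ^ j * (LINT x|leb01. h x * \<phi> x)"
    if \<phi>: "test_function \<phi>" for \<phi>
  proof -
    have "(\<lambda>M. (LINT x|leb01. poly (?S M) x * (deriv ^^ j) \<phi> x)) \<longlonglongrightarrow> (LINT x|leb01. v x * (deriv ^^ j) \<phi> x)"
      using inner_w_tendsto[OF S L2w_test_div_weight[OF test_function_higher_deriv[OF \<phi>, of j]]] by (simp add: inner_w_test_div_weight)
    moreover have "(\<lambda>M. (- 1) ^ j * (LINT x|leb01. poly (X M) x * \<phi> x)) \<longlonglongrightarrow> (- 1) ^ j * (LINT x|leb01. h x * \<phi> x)"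
      using inner_w_tendsto[OF Xh L2w_test_div_weight[OF \<phi>]] by (intro tendsto_mult_left) (simp add: inner_w_test_div_weight)
    moreover have "(LINT x|leb01. poly (?S M) x * (deriv ^^ j) \<phi> x) = (- 1) ^ j * (LINT x|leb01. poly (X M) x * \<phi> x)" for M
      unfolding X_def by (rule integral_poly_higher_deriv_test[OF \<phi>])
    ultimately show ?thesis by (simp add: LIMSEQ_unique)
  qed
  then have "has_weak_deriv j v h"
    using L2w_locally_integrable[OF v] L2w_locally_integrable[OF h] by (simp add: has_weak_deriv_def)
  then show ?thesis using h by (auto simp: weak_deriv_in_L2w_def)
qed

text \<open>Testing with weighted \<open>j\<close>-th derivatives shows that \<open>h\<close> has the formally differentiated
coefficients; Bessel's inequality does the rest.\<close>

lemma weak_deriv_coefficients_bounded: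
  assumes ab: "- 1 < a" "- 1 < b" and gh: "has_weak_deriv j g h"
    and g: "g \<in> L2w a b" and h: "h \<in> L2w (a + real j) (b + real j)"
    and I: "finite I"
  shows "(\<Sum>n\<in>I. (coeff_w a b g n)\<^sup>2 * deriv_factor j (a + b) n) \<le> inner_w (a + real j) (b + real j) h h"
proof -
  let ?e = "\<lambda>n. (pderiv ^^ j) (orthonormal_poly a b n)"
  let ?a = "a + real j" and ?b = "b + real j"
  have ab': "- 1 < ?a" "- 1 < ?b" using ab by auto
  have e: "inner_w ?a ?b (poly (?e m)) (poly (?e n)) = (if m = n then deriv_factor j (a + b) n else 0)" for m n
    using inner_w_higher_pderiv[OF ab orthonormal_poly_props(1)[OF ab]] by (simp add: inner_w_orthonormal_poly[OF ab])
  have "inner_w ?a ?b h (poly (?e n)) = deriv_factor j (a + b) n * coeff_w a b g n" for n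
  proof -
    have "(- 1) ^ j * inner_w ?a ?b h (poly (?e n)) = (- 1) ^ j * deriv_factor j (a + b) n * coeff_w a b g n"
      using weak_deriv_test_weight_poly[OF ab gh g h, of "?e n"]
      unfolding raise_iter_higher_pderiv[OF ab orthonormal_poly_props(1)[OF ab]] inner_w_poly_smult by simp
    then show ?thesis by simp
  qed
  then show ?thesis by (intro Bessel_inequality[OF ab' h I e])
qed

section \<open>Regularity of the solution\<close>

text \<open>Brings the truncations into the form in which the operator is computed in \<open>riesz_spectral_bound\<close>.\<close>

lemma truncation_poly:
  "\<exists>p. \<forall>x. truncation \<alpha> \<beta> c N x = weight (\<alpha> - \<beta>) \<beta> x * poly p x"
proof (intro exI allI)
  fix x :: real
  let ?G = "\<lambda>n. \<Sum>s\<le>n. smult (((real n + (\<alpha> - \<beta>)) gchoose (n - s)) * ((real n + \<beta>) gchoose s)) ([:- 1, 1:] ^ s * [:0, 1:] ^ (n - s))"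
  have "(2 * x - 1 - 1) / 2 = x - 1" "(2 * x - 1 + 1) / 2 = x" by auto
  then show "truncation \<alpha> \<beta> c N x = weight (\<alpha> - \<beta>) \<beta> x * poly (\<Sum>n\<le>N. smult (c n) (?G n)) x"
    unfolding truncation_def jacobi_G_def jacobi_P_def
    by (simp only:) (simp add: poly_sum poly_power mult.assoc)
qed

theorem theorem3p3:
  fixes \<alpha> \<beta> r K\<^sub>m K\<^sub>M A :: real
    and K f f1 f2 u :: "real \<Rightarrow> real"
    and j :: nat
  assumes "1 < \<alpha>" "\<alpha> < 2"
    and "0 \<le> r" "r \<le> 1"
    and "\<alpha> - 1 \<le> \<beta>" "\<beta> \<le> 1"
    and "r = sin (pi * \<beta>) / (sin (pi * (\<alpha> - \<beta>)) + sin (pi * \<beta>))"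
    and "0 < K\<^sub>m"
    and "\<And>x. 0 < x \<Longrightarrow> x < 1 \<Longrightarrow> K\<^sub>m \<le> K x \<and> K x \<le> K\<^sub>M"
    and "f \<in> L2w \<beta> (\<alpha> - \<beta>)"
    and "f1 = (\<lambda>x. 1 / K x * integral\<^sup>L (lebesgue_on {0<..<x}) f)"
    and "f2 = (\<lambda>x. 1 / K x)"
    and "solution_pair \<alpha> \<beta> r f1 f2 u A"
    and "weak_deriv_in_L2w j f1 (\<beta> + real j - 1) (\<alpha> - \<beta> + real j - 1)"
    and "weak_deriv_in_L2w j f2 (\<beta> + real j - 1) (\<alpha> - \<beta> + real j - 1)"
  shows "weak_deriv_in_L2w j (\<lambda>x. u x / weight (\<alpha> - \<beta>) \<beta> x) (\<alpha> - \<beta> + real j) (\<beta> + real j)"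
proof -
  define \<sigma> A' B' where "\<sigma> = 2 - \<alpha>" and "A' = \<alpha> - \<beta> - 1" and "B' = \<beta> - 1"
  define a b where "a = \<alpha> - \<beta>" and "b = \<beta>"
  have ab: "a = A' + 1" "b = B' + 1" by (auto simp: a_def b_def A'_def B'_def)
  have \<sigma>: "0 < \<sigma>" "\<sigma> < 1" "\<alpha> = 2 - \<sigma>" "A' + B' = - \<sigma>" and AB: "A' \<le> 0" "B' \<le> 0" "- 1 < A'" "- 1 < B'"
    using assms(1-6) by (auto simp: \<sigma>_def A'_def B'_def)
  have ab1: "- 1 < a" "- 1 < b" using AB by (auto simp: ab)
  have "sin (pi * B') = - sin (pi * \<beta>)" "sin (pi * A') = - sin (pi * (\<alpha> - \<beta>))"
    by (auto simp: A'_def B'_def algebra_simps sin_diff)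
  then have "r = sin (pi * B') / (sin (pi * A') + sin (pi * B'))"
    using assms(7) minus_divide_divide[of "sin (pi * \<beta>)" "sin (pi * (\<alpha> - \<beta>)) + sin (pi * \<beta>)"] by simp
  note const = nn_integral_riesz_weight_constant[OF AB(1,2) \<sigma>(1,2,4) assms(3,4) this]
  obtain C where C: "balanced_kernel \<sigma> r A' B' C"
    using const \<sigma> AB assms(3,4) unfolding balanced_kernel_def by blast
  have r': "0 \<le> 1 - r" "1 - r \<le> 1" using assms(3,4) by auto
  obtain C' where C': "balanced_kernel \<sigma> (1 - r) B' A' C'"
    using nn_integral_riesz_weight_reflect[OF assms(3,4) const] \<sigma> AB r' unfolding balanced_kernel_def by blast
  obtain \<Lambda> lam c0 where c0: "0 < c0" "\<And>n. c0 \<le> (lam n)\<^sup>2"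
    and \<Lambda>: "\<And>p x. x \<in> {0<..<1} \<Longrightarrow> L_op \<alpha> r (\<lambda>x. weight a b x * poly p x) x = poly (\<Lambda> p) x"
    and adj: "\<And>p n. inner_w B' A' (poly (\<Lambda> p)) (poly (orthonormal_poly B' A' (Suc n))) = lam n * inner_w a b (poly p) (poly (orthonormal_poly a b n))"
    using riesz_spectral_bound[OF C C' \<sigma>(3,4)] unfolding ab by blast
  define g where "g = (\<lambda>x. f1 x - A * f2 x)"
  define v where "v x = u x / weight a b x" for x
  from assms(13) obtain c where
    c: "converges_L2w (- a) (- b) (truncation \<alpha> \<beta> c) u"
      "converges_L2w B' A' (\<lambda>N. L_op \<alpha> r (truncation \<alpha> \<beta> c N)) g"
    unfolding solution_pair_def solves_bvp_def a_def b_def A'_def B'_def g_def by auto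
  obtain p where p: "\<And>N x. truncation \<alpha> \<beta> c N x = weight a b x * poly (p N) x"
    using truncation_poly[of \<alpha> \<beta> c] unfolding a_def b_def by metis
  then have tr: "truncation \<alpha> \<beta> c N = (\<lambda>x. weight a b x * poly (p N) x)" for N by blast
  have g: "g \<in> L2w B' A'" using c(2) by (simp add: converges_L2w_def)
  \<comment> \<open>Multiplication by the weight identifies the space of \<open>u\<close> isometrically with the space of \<open>v\<close>.\<close>
  have w: "weight (- a) (- b) x * (weight a b x * y)\<^sup>2 = weight a b x * y\<^sup>2" if "x \<in> {0<..<1}" for x y
    using weight_mult[OF that, of "- a" "- b" a b] that by (simp add: power2_eq_square mult_ac weight_def powr_minus field_simps)
  have uv: "u x = weight a b x * v x" if "x \<in> {0<..<1}" for x
    using weight_pos[OF that, of a b] by (simp add: v_def)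
  have u: "u \<in> L2w (- a) (- b)" using c(1) by (simp add: converges_L2w_def)
  have v: "v \<in> L2w a b"
  proof -
    have [measurable]: "u \<in> borel_measurable leb01" using u by (rule L2w_measurable)
    have "v \<in> borel_measurable leb01" unfolding v_def by measurable
    moreover have "integrable leb01 (\<lambda>x. weight (- a) (- b) x * (u x)\<^sup>2) \<longleftrightarrow> integrable leb01 (\<lambda>x. weight a b x * (v x)\<^sup>2)"
      by (intro Bochner_Integration.integrable_cong refl) (simp add: uv w)
    ultimately show ?thesis using u by (simp add: L2w_def)
  qed
  have pv: "converges_L2w a b (\<lambda>N. poly (p N)) v"
  proof -
    have "norm_L2w (- a) (- b) (\<lambda>x. truncation \<alpha> \<beta> c N x - u x) = norm_L2w a b (\<lambda>x. poly (p N) x - v x)" for N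
      unfolding norm_L2w_def
      by (intro arg_cong[where f = sqrt] Bochner_Integration.integral_cong refl)
         (simp add: p uv w flip: right_diff_distrib)
    then show ?thesis using c(1) v by (simp add: converges_L2w_def L2w_poly ab1)
  qed
  have coef: "coeff_w B' A' g (Suc n) = lam n * coeff_w a b v n" for n
  proof -
    have "(\<lambda>N. inner_w B' A' (L_op \<alpha> r (truncation \<alpha> \<beta> c N)) (poly (orthonormal_poly B' A' (Suc n)))) \<longlonglongrightarrow> coeff_w B' A' g (Suc n)"
      by (intro inner_w_tendsto[OF c(2)] L2w_poly AB)
    moreover have "inner_w B' A' (L_op \<alpha> r (truncation \<alpha> \<beta> c N)) (poly (orthonormal_poly B' A' (Suc n))) = lam n * inner_w a b (poly (p N)) (poly (orthonormal_poly a b n))" for N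
    proof -
      have "inner_w B' A' (L_op \<alpha> r (truncation \<alpha> \<beta> c N)) (poly (orthonormal_poly B' A' (Suc n))) = inner_w B' A' (poly (\<Lambda> (p N))) (poly (orthonormal_poly B' A' (Suc n)))"
        unfolding inner_w_def by (intro Bochner_Integration.integral_cong refl) (simp add: tr \<Lambda>)
      then show ?thesis by (simp add: adj)
    qed
    moreover have "(\<lambda>N. lam n * inner_w a b (poly (p N)) (poly (orthonormal_poly a b n))) \<longlonglongrightarrow> lam n * coeff_w a b v n"
      by (intro tendsto_mult_left inner_w_tendsto[OF pv] L2w_poly ab1)
    ultimately show ?thesis by (simp add: LIMSEQ_unique)
  qed
  have ex: "\<beta> + real j - 1 = B' + real j" "\<alpha> - \<beta> + real j - 1 = A' + real j" by (auto simp: A'_def B'_def)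
  obtain h1 h2 where h1: "has_weak_deriv j f1 h1" "h1 \<in> L2w (B' + real j) (A' + real j)"
    and h2: "has_weak_deriv j f2 h2" "h2 \<in> L2w (B' + real j) (A' + real j)"
    using assms(14,15) unfolding ex weak_deriv_in_L2w_def by blast
  define h where "h = (\<lambda>x. h1 x - A * h2 x)"
  have gh: "has_weak_deriv j g h" unfolding g_def h_def by (rule has_weak_deriv_lincomb[OF h1(1) h2(1)])
  have h: "h \<in> L2w (B' + real j) (A' + real j)" unfolding h_def by (intro L2w_diff L2w_cmult h1 h2)
  let ?t = "\<lambda>n. (coeff_w a b v n)\<^sup>2 * deriv_factor j (a + b) n"
  have c2: "a + b = \<alpha>" "B' + A' = \<alpha> - 2" by (auto simp: a_def b_def A'_def B'_def)
  have nn: "0 \<le> ?t n" for n using deriv_factor_nonneg[of "a + b" j n] assms(1) c2 by simp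
  have "summable ?t"
  proof (rule summableI_nonneg_bounded[OF nn])
    fix N
    have "c0 * (\<Sum>n<N. ?t n) = (\<Sum>n<N. c0 * ?t n)" by (simp add: sum_distrib_left)
    also have "\<dots> \<le> (\<Sum>n<N. (coeff_w B' A' g (Suc n))\<^sup>2 * deriv_factor j (B' + A') (Suc n))"
    proof (intro sum_mono)
      fix n
      have "c0 * ?t n \<le> (lam n)\<^sup>2 * ?t n" using c0(2) nn by (intro mult_right_mono)
      also have "\<dots> = (coeff_w B' A' g (Suc n))\<^sup>2 * deriv_factor j (a + b) n"
        by (simp add: coef power_mult_distrib)
      also have "\<dots> \<le> (coeff_w B' A' g (Suc n))\<^sup>2 * deriv_factor j (B' + A') (Suc n)"
        using deriv_factor_shift_le[of "a + b" j n] assms(1) c2 by (intro mult_left_mono) auto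
      finally show "c0 * ?t n \<le> (coeff_w B' A' g (Suc n))\<^sup>2 * deriv_factor j (B' + A') (Suc n)" .
    qed
    also have "\<dots> = (\<Sum>n\<in>Suc ` {..<N}. (coeff_w B' A' g n)\<^sup>2 * deriv_factor j (B' + A') n)"
      by (simp add: sum.reindex)
    also have "\<dots> \<le> inner_w (B' + real j) (A' + real j) h h"
      by (rule weak_deriv_coefficients_bounded[OF AB(4,3) gh g h]) simp
    finally show "(\<Sum>n<N. ?t n) \<le> inner_w (B' + real j) (A' + real j) h h / c0"
      using c0(1) by (simp add: pos_le_divide_eq mult.commute)
  qed
  from weak_deriv_of_expansion[OF ab1 pv this] show ?thesis
    unfolding a_def b_def v_def .
qed

end
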